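(* Let $(X_t,\mathcal{F}_t,\mathbf{P}^{\theta}_x)_{\theta\in\mathbb{R}}$ be a parametric family of recurrent strong Markov processes on the canonical space described in the context, fix $\theta^*\in\mathbb{R}$, a probability measure $\mu$ on $S$, and $\mathbf{P}=\int\mathbf{P}^{\theta^*}_x\,d\mu(x)$. Let $Y\colon(\Omega,\mathcal{F}_{\tau_2})\to(\mathbb{R},\mathcal{B}(\mathbb{R}))$ be measurable, bounded below, with $Y\in\bigcap_{d\in\mathtt{D}}L^2(\mathbf{P}_d)$ (where $\mathbf{P}_d=\mathbf{P}^{\theta^*}_d$). Let $Y_2=Y$ and $Y_n=Y\circ\mathrm{sh}_{\tau_{n-1}}$ for $n\ge3$. Let $\eta(\theta,d)=\mathbf{E}^{\theta}_d(Y)$ for $\theta\in\mathbb{R}$, $d\in\mathtt{D}$, and assume: (N1) for each $d\in\mathtt{D}$, $\eta(\cdot,d)$ is strictly monotone and twice continuously differentiable with non-vanishing derivative; (N2) there are $L,L'>0$ with $|\eta(\theta,d)-\eta(\theta^*,d)|\le L|\theta-\theta^*|+L'$ for all $\theta\in\mathbb{R}$, $d\in\mathtt{D}$. Let $V(\theta,d,y)=y-\eta(\theta,d)$, $\alpha(d)=-\frac{\partial\eta}{\partial\theta}(\theta^*,d)$, and let $(\Theta^N_n)$ be an $(\mathcal{F}_{\tau_n})$-adapted sequence with $\mathbf{E}((\Theta^N_1)^2)<\infty$ and $$\Theta^N_{n+1}=\Theta^N_n-\frac1n\,\frac{V(\Theta^N_n,X_{\tau_n},Y_{n+1})}{\alpha(X_{\tau_n})}.$$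 Then, under $\mathbf{P}$, $n^{1/2}(\Theta^N_n-\theta^* )$ is asymptotically normally distributed with mean zero and variance $$\sigma^2=\sum_{d\in\mathtt{D}}p_d\,\frac{\mathrm{Var}_d(Y)}{\alpha^2(d)}=\sum_{d\in\mathtt{D}}p_d\,\frac{\mathbf{E}_d(Y-\eta(\theta^*,d))^2}{\alpha^2(d)},$$ where $p=(p_d)$ is the left-fixed probability row vector of the Markov chain $(X_{\tau_n},\mathcal{F}_{\tau_n})$ under $\theta^*$.
   Context: $S$ is one of $\mathbb{R}$, $[0,\infty)$, $(0,\infty)$; $\Omega=C([0,\infty);S)$ with the topology of uniform convergence on compacts, $X_t$ the coordinate process, $\mathcal{F}_t=\sigma(X_u:u\le t)$, $\mathcal{F}_{t^+}=\bigcap_{\epsilon>0}\sigma(X_u:u\le t+\epsilon)$. $\mathtt{D}=\{d_1<\dots<d_s\}\subset S$ is finite ($s\ge2$); $\tau_1=\inf\{t\ge0:X_t\in\mathtt{D}\}$, $\tau_{n+1}=\inf\{t\ge\tau_n:X_t\in\mathtt{D}\setminus\{X_{\tau_n}\}\}$ (finite by recurrence). For a stopping time $\tau$, $\mathrm{sh}_\tau$ denotes the shift map $\mathrm{sh}_\tau(\omega)(\cdot)=\omega(\tau(\omega)+\cdot)$. $(X_{\tau_n})$ is a Markov chain on $\mathtt{D}$ whose transition matrix is irreducible; $p$ is its unique invariant probability row vector (all entries positive). *)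

theory Defs
  imports "HOL-Probability.Probability"
begin

text \<open>Paths are functions on the time set [0,oo), represented as extensional functions
  (value undefined outside [0,oo)), continuous and S-valued.  The sigma-algebra is the
  coordinate (product) sigma-algebra, which on continuous paths coincides with the Borel
  sigma-algebra of locally uniform convergence.\<close>

definition paths :: "real set \<Rightarrow> (real \<Rightarrow> real) set" where
  "paths S = {\<omega> \<in> ({0..} \<rightarrow>\<^sub>E S). continuous_on {0..} \<omega>}"

definition path_space :: "real set \<Rightarrow> (real \<Rightarrow> real) measure" where
  "path_space S = restrict_space (PiM {0::real..} (\<lambda>_. borel :: real measure)) (paths S)"

definition natF :: "real set \<Rightarrow> real \<Rightarrow> (real \<Rightarrow> real) measure" where
  "natF S t = sigma (space (path_space S))
     {{\<omega> \<in> space (path_space S). \<omega> u \<in> B} | u B. u \<in> {0..t} \<and> B \<in> sets (borel :: real measure)}"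

definition plusF :: "real set \<Rightarrow> real \<Rightarrow> (real \<Rightarrow> real) set set" where
  "plusF S t = {A. \<forall>\<epsilon>>0. A \<in> sets (natF S (t + \<epsilon>))}"

definition stopping_time_plus :: "real set \<Rightarrow> ((real \<Rightarrow> real) \<Rightarrow> ereal) \<Rightarrow> bool" where
  "stopping_time_plus S \<tau> \<longleftrightarrow>
     (\<forall>\<omega>\<in>space (path_space S). 0 \<le> \<tau> \<omega>) \<and>
     (\<forall>t\<ge>0. {\<omega> \<in> space (path_space S). \<tau> \<omega> \<le> ereal t} \<in> plusF S t)"

definition F_tau_plus :: "real set \<Rightarrow> ((real \<Rightarrow> real) \<Rightarrow> ereal) \<Rightarrow> (real \<Rightarrow> real) set set" where
  "F_tau_plus S \<tau> = {A \<in> sets (path_space S).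
      \<forall>t\<ge>0. {\<omega> \<in> A. \<tau> \<omega> \<le> ereal t} \<in> plusF S t}"

definition F_tau :: "real set \<Rightarrow> ((real \<Rightarrow> real) \<Rightarrow> ereal) \<Rightarrow> (real \<Rightarrow> real) measure" where
  "F_tau S \<tau> = sigma (space (path_space S)) {A \<in> sets (path_space S).
      \<forall>t\<ge>0. {\<omega> \<in> A. \<tau> \<omega> \<le> ereal t} \<in> sets (natF S t)}"

definition Xat :: "((real \<Rightarrow> real) \<Rightarrow> ereal) \<Rightarrow> (real \<Rightarrow> real) \<Rightarrow> real" where
  "Xat \<tau> \<omega> = \<omega> (real_of_ereal (\<tau> \<omega>))"

definition shift :: "((real \<Rightarrow> real) \<Rightarrow> ereal) \<Rightarrow> (real \<Rightarrow> real) \<Rightarrow> (real \<Rightarrow> real)" where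
  "shift \<tau> \<omega> = (\<lambda>t\<in>{0..}. \<omega> (real_of_ereal (\<tau> \<omega>) + t))"

definition path_family :: "real set \<Rightarrow> (real \<Rightarrow> (real \<Rightarrow> real) measure) \<Rightarrow> bool" where
  "path_family S P \<longleftrightarrow>
     P \<in> measurable (restrict_space borel S) (prob_algebra (path_space S)) \<and>
     (\<forall>x\<in>S. AE \<omega> in P x. \<omega> 0 = x)"

definition strong_markov :: "real set \<Rightarrow> (real \<Rightarrow> (real \<Rightarrow> real) measure) \<Rightarrow> bool" where
  "strong_markov S P \<longleftrightarrow>
     (\<forall>x\<in>S. \<forall>\<tau> (f :: (real \<Rightarrow> real) \<Rightarrow> real) A. stopping_time_plus S \<tau> \<longrightarrow>
        f \<in> borel_measurable (path_space S) \<longrightarrow>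
        (\<exists>B. \<forall>\<omega>\<in>space (path_space S). \<bar>f \<omega>\<bar> \<le> B) \<longrightarrow>
        A \<in> F_tau_plus S \<tau> \<longrightarrow>
        (LINT \<omega>:{\<omega>\<in>A. \<tau> \<omega> < \<infinity>}|P x. f (shift \<tau> \<omega>)) =
        (LINT \<omega>:{\<omega>\<in>A. \<tau> \<omega> < \<infinity>}|P x. (\<integral>\<omega>'. f \<omega>' \<partial>P (Xat \<tau> \<omega>))))"

definition recurrent :: "real set \<Rightarrow> (real \<Rightarrow> (real \<Rightarrow> real) measure) \<Rightarrow> bool" where
  "recurrent S P \<longleftrightarrow> (\<forall>x\<in>S. \<forall>y\<in>S. AE \<omega> in P x. \<exists>t\<ge>0. \<omega> t = y)"

definition hit_from :: "real set \<Rightarrow> ereal \<Rightarrow> (real \<Rightarrow> real) \<Rightarrow> ereal" where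
  "hit_from A s \<omega> =
     (if s \<noteq> \<infinity> \<and> (\<exists>t. ereal t \<ge> s \<and> 0 \<le> t \<and> \<omega> t \<in> A)
      then ereal (Inf {t. ereal t \<ge> s \<and> 0 \<le> t \<and> \<omega> t \<in> A}) else \<infinity>)"

text \<open>hit_times D n = tau_n for n >= 1 (index 0 is a dummy).\<close>
fun hit_times :: "real set \<Rightarrow> nat \<Rightarrow> (real \<Rightarrow> real) \<Rightarrow> ereal" where
  "hit_times D 0 \<omega> = 0"
| "hit_times D (Suc 0) \<omega> = hit_from D 0 \<omega>"
| "hit_times D (Suc (Suc n)) \<omega> =
     hit_from (D - {Xat (hit_times D (Suc n)) \<omega>}) (hit_times D (Suc n) \<omega>) \<omega>"

definition Yseq :: "real set \<Rightarrow> ((real \<Rightarrow> real) \<Rightarrow> real) \<Rightarrow> nat \<Rightarrow> (real \<Rightarrow> real) \<Rightarrow> real" where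
  "Yseq D Y n \<omega> = (if n = 2 then Y \<omega> else Y (shift (hit_times D (n - 1)) \<omega>))"

definition trans_mat :: "real set \<Rightarrow> (real \<Rightarrow> (real \<Rightarrow> real) measure) \<Rightarrow> real \<Rightarrow> real \<Rightarrow> real" where
  "trans_mat D P d d' = measure (P d) {\<omega> \<in> space (P d). Xat (hit_times D 2) \<omega> = d'}"

fun mat_pow :: "real set \<Rightarrow> (real \<Rightarrow> real \<Rightarrow> real) \<Rightarrow> nat \<Rightarrow> real \<Rightarrow> real \<Rightarrow> real" where
  "mat_pow D T 0 d d' = (if d = d' then 1 else 0)"
| "mat_pow D T (Suc n) d d' = (\<Sum>e\<in>D. mat_pow D T n d e * T e d')"

definition irreducible_on :: "real set \<Rightarrow> (real \<Rightarrow> real \<Rightarrow> real) \<Rightarrow> bool" where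
  "irreducible_on D T \<longleftrightarrow> (\<forall>d\<in>D. \<forall>d'\<in>D. \<exists>n>0. mat_pow D T n d d' > 0)"

definition invariant_prob :: "real set \<Rightarrow> (real \<Rightarrow> real \<Rightarrow> real) \<Rightarrow> (real \<Rightarrow> real) \<Rightarrow> bool" where
  "invariant_prob D T p \<longleftrightarrow> (\<forall>d\<in>D. 0 \<le> p d) \<and> (\<Sum>d\<in>D. p d) = 1 \<and>
     (\<forall>d'\<in>D. (\<Sum>d\<in>D. p d * T d d') = p d')"

definition normal_law :: "real \<Rightarrow> real \<Rightarrow> real measure" where
  "normal_law m v = (if 0 < v then density lborel (normal_density m (sqrt v)) else return borel m)"

end

theory Submission
  imports Defs
begin

text \<open>Put \<open>U n\<close> for the estimation error at the \<open>n\<close>-th hitting time.  The step \<open>1/n\<close> makes the linear part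
  telescope exactly: \<open>n * U (n+1)\<close> is the initial error minus the sum of the noise terms \<open>Z k\<close> minus the
  sum of the remainders \<open>r k\<close>, where \<open>r k = O((U k)^2)\<close> near \<open>0\<close>.

  The noise obeys a central limit theorem: by the strong Markov property the law of \<open>Z k\<close> given the past
  depends only on the state of the chain, and \<open>exp (i s sum Z + s^2/2 sum v)\<close>, with \<open>v\<close> the conditional
  variances, has expectation close to \<open>1\<close>, while the averages of \<open>v\<close> converge because the potentials of
  an irreducible finite chain are bounded.

  The remainders are negligible: on an event bounding the initial error, the second moment
  recursion forces \<open>U\<close> to be small at arbitrarily late times; from then on it stays in a small interval
  with high probability, and there its second moment is \<open>O(1/n)\<close>, so that the sum of the remainders is
  \<open>O(log n)\<close> in mean.\<close>

section \<open>Potentials of irreducible chains\<close>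

text \<open>In each state the drift is divided by its own slope, so every \<open>h d\<close> has
  slope 1 at 0. The linear part of the recursion is then the same in all states, and the chain
  enters the limit only through the conditional variances of the noise; hence the simple formula for
  the variance. Two obstacles shape the treatment of the remainders. Far from 0 only monotonicity,
  sign and a growth bound of \<open>h d\<close> are known: it may be bounded, so there is no global
  contraction, and a rate can be proved only after \<open>U\<close> has been localised near 0. And
  the recursion is entered at the second hitting time, where no moment of the error is known, so
  every second-moment estimate is made on an event of the past. For the noise only second moments
  are available, hence the truncated Taylor bound for characteristic functions. By path continuity
  the chain moves only between neighbouring points of \<open>D\<close>; it is therefore periodic and
  the powers of its matrix do not converge, which is why bounded sums of powers take their
  place.\<close>

lemma mat_pow_add:
  assumes "finite D" "d \<in> D" "d' \<in> D"
  shows "mat_pow D T (m + n) d d' = (\<Sum>e\<in>D. mat_pow D T m d e * mat_pow D T n e d')"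
  using assms(3)
proof (induction n arbitrary: d')
  case 0
  then show ?case using assms by (simp add: if_distrib[of "(*) _"] sum.delta cong: if_cong)
next
  case (Suc n)
  have "mat_pow D T (m + Suc n) d d' = (\<Sum>a\<in>D. (\<Sum>e\<in>D. mat_pow D T m d e * mat_pow D T n e a) * T a d')"
    using Suc.IH by simp
  also have "\<dots> = (\<Sum>e\<in>D. mat_pow D T m d e * (\<Sum>a\<in>D. mat_pow D T n e a * T a d'))"
    unfolding sum_distrib_left sum_distrib_right mult.assoc by (rule sum.swap)
  finally show ?case by simp
qed

text \<open>The action of the n-th power of \<open>T\<close> on functions; along the chain it is the
  conditional mean of \<open>f\<close> after n steps from \<open>d\<close>, see
  \<open>chain_steps\<close>.\<close>

definition mat_apply :: "real set \<Rightarrow> (real \<Rightarrow> real \<Rightarrow> real) \<Rightarrow> nat \<Rightarrow> (real \<Rightarrow> real) \<Rightarrow> real \<Rightarrow> real" where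
  "mat_apply D T n f d = (\<Sum>e\<in>D. mat_pow D T n d e * f e)"

lemma mat_apply_0: "finite D \<Longrightarrow> d \<in> D \<Longrightarrow> mat_apply D T 0 f d = f d"
  by (simp add: mat_apply_def if_distrib[of "\<lambda>x. x * _"] sum.delta cong: if_cong)

text \<open>The extra factor is moved next to \<open>f\<close>, not next to the starting state,
  because \<open>chain_steps\<close> peels off the last step of the chain.\<close>

lemma mat_apply_Suc:
  "mat_apply D T (Suc n) f d = mat_apply D T n (\<lambda>e. \<Sum>a\<in>D. T e a * f a) d"
proof -
  have "mat_apply D T (Suc n) f d = (\<Sum>a\<in>D. \<Sum>e\<in>D. mat_pow D T n d e * T e a * f a)"
    by (simp add: mat_apply_def sum_distrib_right)
  also have "\<dots> = (\<Sum>e\<in>D. \<Sum>a\<in>D. mat_pow D T n d e * T e a * f a)" by (rule sum.swap)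
  finally show ?thesis by (simp add: mat_apply_def sum_distrib_left mult.assoc)
qed

lemma mat_apply_add:
  assumes "finite D" "d \<in> D"
  shows "mat_apply D T (m + n) f d = mat_apply D T m (mat_apply D T n f) d"
proof -
  have "mat_apply D T (m + n) f d = (\<Sum>a\<in>D. \<Sum>e\<in>D. mat_pow D T m d e * mat_pow D T n e a * f a)"
    using assms by (simp add: mat_apply_def sum_distrib_right mat_pow_add)
  also have "\<dots> = (\<Sum>e\<in>D. \<Sum>a\<in>D. mat_pow D T m d e * mat_pow D T n e a * f a)" by (rule sum.swap)
  finally show ?thesis by (simp add: mat_apply_def sum_distrib_left mult.assoc)
qed

locale stochastic_matrix =
  fixes D :: "real set" and T :: "real \<Rightarrow> real \<Rightarrow> real"
  assumes finD: "finite D" and D_ne: "D \<noteq> {}"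
    and T_nonneg: "d \<in> D \<Longrightarrow> e \<in> D \<Longrightarrow> 0 \<le> T d e"
    and T_sum: "d \<in> D \<Longrightarrow> (\<Sum>e\<in>D. T d e) = 1"
begin

lemma mat_pow_nonneg: "d \<in> D \<Longrightarrow> e \<in> D \<Longrightarrow> 0 \<le> mat_pow D T n d e"
  by (induction n arbitrary: e) (auto intro!: sum_nonneg mult_nonneg_nonneg T_nonneg)

lemma mat_pow_sum: "d \<in> D \<Longrightarrow> (\<Sum>e\<in>D. mat_pow D T n d e) = 1"
proof (induction n)
  case 0 then show ?case using finD by simp
next
  case (Suc n)
  have "(\<Sum>e\<in>D. mat_pow D T (Suc n) d e) = (\<Sum>a\<in>D. \<Sum>e\<in>D. mat_pow D T n d a * T a e)"
    by simp (rule sum.swap)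
  also have "\<dots> = (\<Sum>a\<in>D. mat_pow D T n d a * (\<Sum>e\<in>D. T a e))"
    by (simp add: sum_distrib_left)
  also have "\<dots> = 1" using Suc by (simp add: T_sum)
  finally show ?case .
qed

lemma mat_apply_bound:
  assumes "d \<in> D" "\<And>e. e \<in> D \<Longrightarrow> \<bar>f e\<bar> \<le> B"
  shows "\<bar>mat_apply D T n f d\<bar> \<le> B"
proof -
  have "\<bar>mat_apply D T n f d\<bar> \<le> (\<Sum>e\<in>D. mat_pow D T n d e * B)"
    unfolding mat_apply_def using assms
    by (intro order.trans[OF sum_abs] sum_mono)
       (auto simp: abs_mult mat_pow_nonneg intro!: mult_left_mono)
  also have "\<dots> = B" using assms(1) by (simp add: mat_pow_sum flip: sum_distrib_right)
  finally show ?thesis .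
qed

lemma invariant_mat_apply:
  assumes "invariant_prob D T p"
  shows "(\<Sum>d\<in>D. p d * mat_apply D T n f d) = (\<Sum>d\<in>D. p d * f d)"
proof (induction n arbitrary: f)
  case 0 then show ?case using finD by (simp add: mat_apply_0)
next
  case (Suc n)
  have "(\<Sum>d\<in>D. p d * mat_apply D T (Suc n) f d) = (\<Sum>d\<in>D. p d * (\<Sum>a\<in>D. T d a * f a))"
    by (simp only: mat_apply_Suc Suc)
  also have "\<dots> = (\<Sum>d\<in>D. \<Sum>a\<in>D. p d * T d a * f a)"
    by (simp add: sum_distrib_left mult.assoc)
  also have "\<dots> = (\<Sum>a\<in>D. \<Sum>d\<in>D. p d * T d a * f a)" by (rule sum.swap)
  also have "\<dots> = (\<Sum>a\<in>D. p a * f a)"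
    using assms by (simp add: invariant_prob_def flip: sum_distrib_right)
  finally show ?case .
qed

text \<open>Averaging the powers of an irreducible matrix gives a matrix \<open>K\<close> with entries at least \<open>c > 0\<close>
  that almost fixes the potential \<open>G\<close>; comparing \<open>G\<close> and \<open>K G\<close> at a maximum point of \<open>G\<close> bounds
  the oscillation of \<open>G\<close>, and \<open>p G = 0\<close> then bounds \<open>G\<close> itself.\<close>

lemma potential_bounded:
  assumes irr: "irreducible_on D T" and inv: "invariant_prob D T p"
    and pf: "(\<Sum>d\<in>D. p d * f d) = 0"
  shows "\<exists>C. \<forall>n. \<forall>d\<in>D. \<bar>\<Sum>i<n. mat_apply D T i f d\<bar> \<le> C"
proof -
  obtain B where B: "\<And>d. d \<in> D \<Longrightarrow> \<bar>f d\<bar> \<le> B"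
    using finD by (intro that[of "\<Sum>e\<in>D. \<bar>f e\<bar>"] member_le_sum) auto
  have "\<forall>d\<in>D. \<forall>d'\<in>D. \<exists>n>0. mat_pow D T n d d' > 0" using irr by (simp add: irreducible_on_def)
  then obtain \<nu> where \<nu>: "\<And>d e. d \<in> D \<Longrightarrow> e \<in> D \<Longrightarrow> mat_pow D T (\<nu> d e) d e > 0" by metis
  \<comment> \<open>\<open>N\<close> exceeds every \<open>\<nu> d e\<close>, so each entry of the
    sum of the first \<open>N\<close> powers contains a positive term. A single power need not have
    all entries positive, since the chain may be periodic. The sum \<open>k\<close> is not
    normalised: its rows add up to \<open>N\<close>.\<close>
  define N where "N = Suc (Max ((\<lambda>(d,e). \<nu> d e) ` (D \<times> D)))"
  have N: "\<nu> d e < N" if "d \<in> D" "e \<in> D" for d e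
    using that finD unfolding N_def less_Suc_eq_le by (intro Max_ge) force+
  define k where "k d e = (\<Sum>j<N. mat_pow D T j d e)" for d e
  define c where "c = Min ((\<lambda>(d,e). k d e) ` (D \<times> D))"
  have kpos: "k d e > 0" if "d \<in> D" "e \<in> D" for d e
    unfolding k_def
    by (rule sum_pos2[where i="\<nu> d e"]) (use that N \<nu> mat_pow_nonneg in auto)
  have cpos: "c > 0" unfolding c_def using finD D_ne kpos by (subst Min_gr_iff) auto
  have kc: "k d e \<ge> c" if "d \<in> D" "e \<in> D" for d e
    unfolding c_def using finD that by (intro Min_le) force+
  have ksum: "(\<Sum>e\<in>D. k d e) = N" if "d \<in> D" for d
    unfolding k_def by (subst sum.swap) (simp add: mat_pow_sum that)
  \<comment> \<open>There are \<open>N\<close> powers, each moves \<open>G\<close> by at most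
    \<open>N * (2 * B)\<close>, and division by \<open>c\<close> passes from the averaged difference
    to the difference of two values.\<close>
  define C where "C = real N * (real N * (2 * B)) / c"
  have "\<bar>\<Sum>i<n. mat_apply D T i f d\<bar> \<le> C" if d: "d \<in> D" for n d
  proof -
    define G where "G = (\<lambda>d. \<Sum>i<n. mat_apply D T i f d)"
    have KG: "(\<Sum>e\<in>D. k d e * G e) = (\<Sum>j<N. mat_apply D T j G d)" for d
      unfolding k_def mat_apply_def sum_distrib_right by (rule sum.swap)
    \<comment> \<open>The j-th power shifts the summation index of \<open>G\<close> by
      \<open>j\<close>, so only \<open>j\<close> terms at either end differ, each of size at most
      \<open>B\<close>.\<close>
    have step: "\<bar>mat_apply D T j G d - G d\<bar> \<le> real j * (2 * B)" if d: "d \<in> D" for j d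
    proof -
      have "mat_apply D T j G d = (\<Sum>i<n. mat_apply D T (j + i) f d)"
      proof -
        have "mat_apply D T j G d = (\<Sum>e\<in>D. \<Sum>i<n. mat_pow D T j d e * mat_apply D T i f e)"
          by (simp add: mat_apply_def[of D T j] G_def sum_distrib_left)
        also have "\<dots> = (\<Sum>i<n. mat_apply D T j (mat_apply D T i f) d)"
          by (subst sum.swap) (simp add: mat_apply_def[of D T j])
        finally show ?thesis using d finD by (simp add: mat_apply_add)
      qed
      moreover have "(\<Sum>i<n. mat_apply D T (j + i) f d) - G d
          = (\<Sum>i<j. mat_apply D T (n + i) f d) - (\<Sum>i<j. mat_apply D T i f d)"
      proof -
        have *: "(\<Sum>i<a. g i) + (\<Sum>i<b. g (a + i)) = (\<Sum>i<a+b. g i)" for a b and g :: "nat \<Rightarrow> real"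
          by (induction b) (auto simp: algebra_simps)
        from *[of "\<lambda>i. mat_apply D T i f d" j n] *[of "\<lambda>i. mat_apply D T i f d" n j]
        show ?thesis by (simp add: G_def add.commute)
      qed
      moreover have "\<bar>\<Sum>i<j. mat_apply D T (a + i) f d\<bar> \<le> real j * B" for a
        using sum_bounded_above[of "{..<j}" "\<lambda>i. \<bar>mat_apply D T (a + i) f d\<bar>" B]
          mat_apply_bound[OF d B] by (intro order.trans[OF sum_abs]) auto
      from this[of n] this[of 0] have
        "\<bar>(\<Sum>i<j. mat_apply D T (n + i) f d) - (\<Sum>i<j. mat_apply D T i f d)\<bar> \<le> real j * (2 * B)"
        by simp
      ultimately show ?thesis by simp
    qed
    have B0: "B \<ge> 0" using B[OF d] by linarith
    have G_le: "G d - G e \<le> C" if d: "d \<in> D" "\<And>a. a \<in> D \<Longrightarrow> G a \<le> G d" and e: "e \<in> D" for d e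
    proof -
      have "N * G d - (\<Sum>a\<in>D. k d a * G a) = (\<Sum>j<N. G d - mat_apply D T j G d)"
        by (simp add: KG sum_subtractf)
      also have "\<dots> \<le> (\<Sum>j<N. real N * (2 * B))"
      proof (rule sum_mono)
        fix j assume "j \<in> {..<N}"
        then have "real j * (2 * B) \<le> real N * (2 * B)" using B0 by (intro mult_right_mono) auto
        then show "G d - mat_apply D T j G d \<le> real N * (2 * B)" using step[OF d(1), of j] by linarith
      qed
      finally have 1: "N * G d - (\<Sum>a\<in>D. k d a * G a) \<le> real N * (real N * (2 * B))" by simp
      \<comment> \<open>At a maximum point all the terms \<open>k d a * (G d - G a)\<close> are
        nonnegative, so the one with \<open>a = e\<close> is bounded by their sum.\<close>
      have "c * (G d - G e) \<le> k d e * (G d - G e)" using kc d e by (intro mult_right_mono) auto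
      also have "\<dots> \<le> (\<Sum>a\<in>D. k d a * (G d - G a))"
        using finD kpos d e
        by (intro member_le_sum[where f="\<lambda>a. k d a * (G d - G a)"]) (auto intro!: mult_nonneg_nonneg simp: less_imp_le)
      also have "\<dots> = N * G d - (\<Sum>a\<in>D. k d a * G a)"
        by (simp add: right_diff_distrib sum_subtractf ksum[OF d(1)] flip: sum_distrib_right)
      finally show ?thesis using 1 cpos by (simp add: C_def field_simps)
    qed
    have "Max (G ` D) \<in> G ` D" "Min (G ` D) \<in> G ` D" using finD D_ne by (auto intro!: Max_in Min_in)
    then obtain d1 d2 where d1: "d1 \<in> D" "G d1 = Max (G ` D)" and d2: "d2 \<in> D" "G d2 = Min (G ` D)"
      by auto
    have le1: "G a \<le> G d1" and le2: "G d2 \<le> G a" if "a \<in> D" for a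
      using that finD d1 d2 by auto
    \<comment> \<open>Every power preserves the \<open>p\<close>-mean, so each term of
      \<open>G\<close> has \<open>p\<close>-mean 0. The maximum of \<open>G\<close> is then
      nonnegative and its minimum nonpositive, and the oscillation bounds \<open>G\<close>.\<close>
    have pG: "(\<Sum>a\<in>D. p a * G a) = 0"
    proof -
      have "(\<Sum>a\<in>D. p a * G a) = (\<Sum>i<n. \<Sum>a\<in>D. p a * mat_apply D T i f a)"
        unfolding G_def sum_distrib_left by (rule sum.swap)
      then show ?thesis using pf by (simp add: invariant_mat_apply[OF inv])
    qed
    have psum: "(\<Sum>a\<in>D. p a) = 1" and pn: "\<And>a. a \<in> D \<Longrightarrow> 0 \<le> p a" using inv by (auto simp: invariant_prob_def)
    have "(\<Sum>a\<in>D. p a * G a) \<le> (\<Sum>a\<in>D. p a * G d1)"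
      by (intro sum_mono mult_left_mono le1 pn)
    then have m1: "0 \<le> G d1" using pG psum by (simp flip: sum_distrib_right)
    have "(\<Sum>a\<in>D. p a * G d2) \<le> (\<Sum>a\<in>D. p a * G a)"
      by (intro sum_mono mult_left_mono le2 pn)
    then have m2: "G d2 \<le> 0" using pG psum by (simp flip: sum_distrib_right)
    have "G d1 - G d2 \<le> C" by (rule G_le[OF d1(1) le1 d2(1)])
    then have "\<bar>G d\<bar> \<le> C" using le1[OF d] le2[OF d] m1 m2 by linarith
    then show ?thesis by (simp add: G_def)
  qed
  then show ?thesis by blast
qed

end

section \<open>Conditional laws\<close>

lemma complex_integrable_iff:
  fixes f :: "'a \<Rightarrow> complex"
  shows "integrable M f \<longleftrightarrow> integrable M (\<lambda>x. Re (f x)) \<and> integrable M (\<lambda>x. Im (f x))"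
proof (intro iffI conjI)
  assume "integrable M (\<lambda>x. Re (f x)) \<and> integrable M (\<lambda>x. Im (f x))"
  then have "integrable M (\<lambda>x. complex_of_real (Re (f x)) + \<i> * complex_of_real (Im (f x)))" by auto
  then show "integrable M f" by (simp flip: complex_eq)
qed auto

text \<open>The assumption \<open>law\<close> says that, given \<open>F\<close>, the variable
  \<open>V\<close> has conditional law \<open>\<kappa> (X \<omega>)\<close>. It is required for
  events only, which is what the strong Markov property gives for indicators and what survives
  integration over the starting point; integrals of functions are derived below. In the application
  \<open>V\<close> is the path shifted by a hitting time and \<open>\<kappa>\<close> is the Markov
  family itself.\<close>

locale conditional_law = prob_space M for M :: "'a measure" +
  fixes F :: "'a measure" and D :: "'d set" and X :: "'a \<Rightarrow> 'd"
    and N :: "'b measure" and V :: "'a \<Rightarrow> 'b" and \<kappa> :: "'d \<Rightarrow> 'b measure"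
  assumes subalg: "subalgebra M F" and finD: "finite D"
    and X_meas: "X \<in> measurable F (count_space D)"
    and V_meas: "V \<in> measurable M N"
    and kernel: "d \<in> D \<Longrightarrow> prob_space (\<kappa> d)" "d \<in> D \<Longrightarrow> sets (\<kappa> d) = sets N"
    and law: "d \<in> D \<Longrightarrow> A \<in> sets F \<Longrightarrow> B \<in> sets N \<Longrightarrow>
      prob (A \<inter> {\<omega>\<in>space M. X \<omega> = d} \<inter> {\<omega>\<in>space M. V \<omega> \<in> B}) =
      prob (A \<inter> {\<omega>\<in>space M. X \<omega> = d}) * measure (\<kappa> d) B"
begin

lemma space_F: "space F = space M" using subalg by (simp add: subalgebra_def)
lemma sets_F: "A \<in> sets F \<Longrightarrow> A \<in> sets M" using subalg by (auto simp: subalgebra_def)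
lemma X_in: "\<omega> \<in> space M \<Longrightarrow> X \<omega> \<in> D"
  using measurable_space[OF X_meas] by (simp add: space_F)
lemma X_event: "{\<omega>\<in>space M. X \<omega> = d} \<in> sets F"
proof (cases "d \<in> D")
  case True
  have "X -` {d} \<inter> space F \<in> sets F" by (rule measurable_sets[OF X_meas]) (use True in simp)
  also have "X -` {d} \<inter> space F = {\<omega>\<in>space M. X \<omega> = d}" by (auto simp: space_F)
  finally show ?thesis .
next
  case False
  then have "{\<omega>\<in>space M. X \<omega> = d} = {}" using X_in by auto
  then show ?thesis by (simp only: sets.empty_sets)
qed

lemma measurable_F_M: "g \<in> measurable F L \<Longrightarrow> g \<in> measurable M L"
  using subalg measurable_from_subalg by blast

lemma finite_measurable_select:
  assumes "\<And>d. d \<in> D \<Longrightarrow> (\<lambda>\<omega>. g d \<omega>) \<in> measurable F L"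
  shows "(\<lambda>\<omega>. g (X \<omega>) \<omega>) \<in> measurable F L"
  using assms by (rule measurable_compose_countable'[OF _ X_meas]) (auto simp: finD countable_finite)

text \<open>By \<open>law\<close>, the image under \<open>V\<close> of the measure restricted to
  \<open>E\<close> is \<open>\<kappa> d\<close> scaled by \<open>prob E\<close>; both claims are
  then changes of variables.\<close>

lemma integral_V_on:
  fixes g :: "'b \<Rightarrow> real"
  assumes d: "d \<in> D" and A: "A \<in> sets F" and g: "integrable (\<kappa> d) g"
  defines "E \<equiv> A \<inter> {\<omega>\<in>space M. X \<omega> = d}"
  shows "integrable M (\<lambda>\<omega>. indicator E \<omega> * g (V \<omega>))"
    and "(\<integral>\<omega>. indicator E \<omega> * g (V \<omega>) \<partial>M) = prob E * (\<integral>x. g x \<partial>\<kappa> d)"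
proof -
  have E[measurable]: "E \<in> sets M" unfolding E_def using sets_F[OF A] sets_F[OF X_event] by auto
  note V_meas[measurable]
  interpret \<kappa>: prob_space "\<kappa> d" using kernel d by blast
  have eq: "distr (density M (indicator E)) N V = density (\<kappa> d) (\<lambda>_. ennreal (prob E))"
  proof (rule measure_eqI)
    show "sets (distr (density M (indicator E)) N V) = sets (density (\<kappa> d) (\<lambda>_. ennreal (prob E)))"
      using kernel d by simp
    fix B assume "B \<in> sets (distr (density M (indicator E)) N V)"
    then have B[measurable]: "B \<in> sets N" by simp
    have "emeasure (distr (density M (indicator E)) N V) B = (\<integral>\<^sup>+\<omega>. indicator E \<omega> * indicator (V -` B \<inter> space M) \<omega> \<partial>M)"
      by (subst emeasure_distr) (auto simp: emeasure_density)
    also have "\<dots> = (\<integral>\<^sup>+\<omega>. indicator (E \<inter> (V -` B \<inter> space M)) \<omega> \<partial>M)"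
      by (intro nn_integral_cong) (simp add: indicator_inter_arith)
    also have "\<dots> = emeasure M (E \<inter> (V -` B \<inter> space M))" by (intro nn_integral_indicator) simp
    also have "\<dots> = prob (E \<inter> (V -` B \<inter> space M))" by (simp add: emeasure_eq_measure)
    also have "E \<inter> (V -` B \<inter> space M) = A \<inter> {\<omega>\<in>space M. X \<omega> = d} \<inter> {\<omega>\<in>space M. V \<omega> \<in> B}"
      by (auto simp: E_def)
    also have "prob \<dots> = prob E * measure (\<kappa> d) B" using law[OF d A B] by (simp add: E_def)
    also have "\<dots> = emeasure (density (\<kappa> d) (\<lambda>_. ennreal (prob E))) B"
      using kernel(2)[OF d] B
      by (subst emeasure_density) (auto simp: nn_integral_cmult \<kappa>.emeasure_eq_measure ennreal_mult)
    finally show "emeasure (distr (density M (indicator E)) N V) B = emeasure (density (\<kappa> d) (\<lambda>_. ennreal (prob E))) B" .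
  qed
  have gN[measurable]: "g \<in> borel_measurable N"
    using borel_measurable_integrable[OF g] kernel(2)[OF d] measurable_cong_sets by blast
  have gk: "g \<in> borel_measurable (\<kappa> d)" using g by auto
  have ind: "(\<lambda>\<omega>. ennreal (indicator E \<omega>)) = indicator E" by (auto simp: indicator_def)
  have "integrable (density (\<kappa> d) (\<lambda>_. ennreal (prob E))) g"
    by (subst integrable_density) (use g gk in auto)
  then have "integrable (density M (\<lambda>\<omega>. ennreal (indicator E \<omega>))) (\<lambda>\<omega>. g (V \<omega>))"
    unfolding eq[symmetric] ind by (subst (asm) integrable_distr_eq) auto
  then show "integrable M (\<lambda>\<omega>. indicator E \<omega> * g (V \<omega>))"
    by (subst (asm) integrable_density) auto
  have "(\<integral>\<omega>. indicator E \<omega> * g (V \<omega>) \<partial>M) = (\<integral>\<omega>. g (V \<omega>) \<partial>density M (\<lambda>\<omega>. ennreal (indicator E \<omega>)))"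
    by (subst integral_density) auto
  also have "\<dots> = (\<integral>x. g x \<partial>distr (density M (indicator E)) N V)"
    unfolding ind by (subst integral_distr) auto
  also have "\<dots> = prob E * (\<integral>x. g x \<partial>\<kappa> d)"
    unfolding eq by (subst integral_density) (use gk in auto)
  finally show "(\<integral>\<omega>. indicator E \<omega> * g (V \<omega>) \<partial>M) = prob E * (\<integral>x. g x \<partial>\<kappa> d)" .
qed

lemma split_X:
  fixes g :: "'d \<Rightarrow> 'a \<Rightarrow> real"
  assumes "\<omega> \<in> space M" "A \<subseteq> space M"
  shows "indicator A \<omega> * g (X \<omega>) \<omega> = (\<Sum>d\<in>D. indicator (A \<inter> {\<omega>\<in>space M. X \<omega> = d}) \<omega> * g d \<omega>)"
proof -
  have "(\<Sum>d\<in>D. indicator (A \<inter> {\<omega>\<in>space M. X \<omega> = d}) \<omega> * g d \<omega>)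
      = (\<Sum>d\<in>D. if d = X \<omega> then indicator A \<omega> * g d \<omega> else 0)"
    by (rule sum.cong) (use assms in \<open>auto simp: indicator_def\<close>)
  also have "\<dots> = indicator A \<omega> * g (X \<omega>) \<omega>" using finD X_in[OF assms(1)] by simp
  finally show ?thesis ..
qed

lemma integral_XV_on:
  fixes g :: "'d \<Rightarrow> 'b \<Rightarrow> real"
  assumes g: "\<And>d. d \<in> D \<Longrightarrow> integrable (\<kappa> d) (g d)" and A: "A \<in> sets F"
  shows "integrable M (\<lambda>\<omega>. indicator A \<omega> * g (X \<omega>) (V \<omega>))"
    and "integrable M (\<lambda>\<omega>. indicator A \<omega> * (\<integral>x. g (X \<omega>) x \<partial>\<kappa> (X \<omega>)))"
    and "(\<integral>\<omega>. indicator A \<omega> * g (X \<omega>) (V \<omega>) \<partial>M) = (\<integral>\<omega>. indicator A \<omega> * (\<integral>x. g (X \<omega>) x \<partial>\<kappa> (X \<omega>)) \<partial>M)"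
proof -
  have AM: "A \<in> sets M" and Asp: "A \<subseteq> space M" using sets_F[OF A] sets.sets_into_space by auto
  have Em: "A \<inter> {\<omega>\<in>space M. X \<omega> = d} \<in> sets M" for d using AM sets_F[OF X_event] by auto
  note s1 = split_X[OF _ Asp, of _ "\<lambda>d \<omega>. g d (V \<omega>)"]
  note s2 = split_X[OF _ Asp, of _ "\<lambda>d \<omega>. \<integral>x. g d x \<partial>\<kappa> d"]
  have i2: "integrable M (\<lambda>\<omega>. indicator (A \<inter> {\<omega>\<in>space M. X \<omega> = d}) \<omega> * (\<integral>x. g d x \<partial>\<kappa> d))" for d
    using Em by (intro integrable_mult_left integrable_real_indicator) (auto simp: emeasure_eq_measure)
  show "integrable M (\<lambda>\<omega>. indicator A \<omega> * g (X \<omega>) (V \<omega>))"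
    by (subst Bochner_Integration.integrable_cong[OF refl s1]) (auto intro!: Bochner_Integration.integrable_sum integral_V_on(1) A g)
  show "integrable M (\<lambda>\<omega>. indicator A \<omega> * (\<integral>x. g (X \<omega>) x \<partial>\<kappa> (X \<omega>)))"
    by (subst Bochner_Integration.integrable_cong[OF refl s2]) (auto intro!: Bochner_Integration.integrable_sum i2)
  have "(\<integral>\<omega>. indicator A \<omega> * g (X \<omega>) (V \<omega>) \<partial>M) = (\<Sum>d\<in>D. prob (A \<inter> {\<omega>\<in>space M. X \<omega> = d}) * (\<integral>x. g d x \<partial>\<kappa> d))"
    by (subst Bochner_Integration.integral_cong[OF refl s1]) (auto simp: Bochner_Integration.integral_sum integral_V_on A g)
  moreover have "(\<integral>\<omega>. indicator A \<omega> * (\<integral>x. g (X \<omega>) x \<partial>\<kappa> (X \<omega>)) \<partial>M) = (\<Sum>d\<in>D. prob (A \<inter> {\<omega>\<in>space M. X \<omega> = d}) * (\<integral>x. g d x \<partial>\<kappa> d))"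
    by (subst Bochner_Integration.integral_cong[OF refl s2], assumption, subst Bochner_Integration.integral_sum[OF i2])
       (auto simp: Em Int_absorb1[OF sets.sets_into_space[OF Em]])
  ultimately show "(\<integral>\<omega>. indicator A \<omega> * g (X \<omega>) (V \<omega>) \<partial>M) = (\<integral>\<omega>. indicator A \<omega> * (\<integral>x. g (X \<omega>) x \<partial>\<kappa> (X \<omega>)) \<partial>M)"
    by simp
qed

lemma integrable_XV:
  fixes g :: "'d \<Rightarrow> 'b \<Rightarrow> real"
  assumes g: "\<And>d. d \<in> D \<Longrightarrow> integrable (\<kappa> d) (g d)"
  shows "integrable M (\<lambda>\<omega>. g (X \<omega>) (V \<omega>))"
  using integral_XV_on(1)[OF g sets.top]
  by (rule iffD1[OF Bochner_Integration.integrable_cong, rotated 2]) (auto simp: space_F)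

text \<open>The identities of \<open>integral_XV_on\<close> for all events of \<open>F\<close>
  characterise the inner integral as the conditional expectation of
  \<open>g (X \<omega>) (V \<omega>)\<close> given \<open>F\<close>, so that the
  \<open>F\<close>-measurable factor \<open>H\<close> can be pulled out. \<open>H\<close> may be
  unbounded, as \<open>Z_orthogonal\<close> requires.\<close>

lemma integral_mult_XV:
  fixes g :: "'d \<Rightarrow> 'b \<Rightarrow> real"
  assumes g: "\<And>d. d \<in> D \<Longrightarrow> integrable (\<kappa> d) (g d)"
    and H: "H \<in> borel_measurable F" and int: "integrable M (\<lambda>\<omega>. H \<omega> * g (X \<omega>) (V \<omega>))"
  shows "integrable M (\<lambda>\<omega>. H \<omega> * (\<integral>x. g (X \<omega>) x \<partial>\<kappa> (X \<omega>)))"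
    and "(\<integral>\<omega>. H \<omega> * g (X \<omega>) (V \<omega>) \<partial>M) = (\<integral>\<omega>. H \<omega> * (\<integral>x. g (X \<omega>) x \<partial>\<kappa> (X \<omega>)) \<partial>M)"
proof -
  interpret finite_measure_subalgebra M F by unfold_locales (rule subalg)
  have m: "(\<lambda>\<omega>. \<integral>x. g (X \<omega>) x \<partial>\<kappa> (X \<omega>)) \<in> borel_measurable F"
    by (rule finite_measurable_select) simp
  have i: "integrable M (\<lambda>\<omega>. g (X \<omega>) (V \<omega>))" by (rule integrable_XV[OF g])
  have j: "integrable M (\<lambda>\<omega>. \<integral>x. g (X \<omega>) x \<partial>\<kappa> (X \<omega>))"
    using integral_XV_on(2)[OF g sets.top]
    by (rule iffD1[OF Bochner_Integration.integrable_cong, rotated 2]) (auto simp: space_F)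
  have ae: "AE \<omega> in M. real_cond_exp M F (\<lambda>\<omega>. g (X \<omega>) (V \<omega>)) \<omega> = (\<integral>x. g (X \<omega>) x \<partial>\<kappa> (X \<omega>))"
    by (rule real_cond_exp_charact[OF _ i j m])
       (simp add: set_lebesgue_integral_def integral_XV_on[OF g])
  note mi = borel_measurable_integrable[OF i]
  have [measurable]: "H \<in> borel_measurable M" "(\<lambda>\<omega>. \<integral>x. g (X \<omega>) x \<partial>\<kappa> (X \<omega>)) \<in> borel_measurable M"
    using measurable_F_M H m by auto
  show "integrable M (\<lambda>\<omega>. H \<omega> * (\<integral>x. g (X \<omega>) x \<partial>\<kappa> (X \<omega>)))"
    using real_cond_exp_intg(1)[OF int H mi] ae
    by (subst integrable_cong_AE[where g="\<lambda>\<omega>. H \<omega> * real_cond_exp M F (\<lambda>\<omega>. g (X \<omega>) (V \<omega>)) \<omega>"]) auto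
  show "(\<integral>\<omega>. H \<omega> * g (X \<omega>) (V \<omega>) \<partial>M) = (\<integral>\<omega>. H \<omega> * (\<integral>x. g (X \<omega>) x \<partial>\<kappa> (X \<omega>)) \<partial>M)"
    unfolding real_cond_exp_intg(2)[OF int H mi, symmetric]
    by (rule integral_cong_AE) (use ae in auto)
qed

lemma integral_mult_XV_bounded:
  fixes g :: "'d \<Rightarrow> 'b \<Rightarrow> real"
  assumes g: "\<And>d. d \<in> D \<Longrightarrow> integrable (\<kappa> d) (g d)"
    and H: "H \<in> borel_measurable F" and bd: "\<And>\<omega>. \<omega> \<in> space M \<Longrightarrow> \<bar>H \<omega>\<bar> \<le> B"
  shows "integrable M (\<lambda>\<omega>. H \<omega> * g (X \<omega>) (V \<omega>))"
    and "integrable M (\<lambda>\<omega>. H \<omega> * (\<integral>x. g (X \<omega>) x \<partial>\<kappa> (X \<omega>)))"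
    and "(\<integral>\<omega>. H \<omega> * g (X \<omega>) (V \<omega>) \<partial>M) = (\<integral>\<omega>. H \<omega> * (\<integral>x. g (X \<omega>) x \<partial>\<kappa> (X \<omega>)) \<partial>M)"
proof -
  have [measurable]: "H \<in> borel_measurable M" using measurable_F_M H by auto
  have i: "integrable M (\<lambda>\<omega>. g (X \<omega>) (V \<omega>))" by (rule integrable_XV[OF g])
  note [measurable] = borel_measurable_integrable[OF i]
  have "integrable M (\<lambda>\<omega>. B * \<bar>g (X \<omega>) (V \<omega>)\<bar>)" using i by simp
  then show int: "integrable M (\<lambda>\<omega>. H \<omega> * g (X \<omega>) (V \<omega>))"
  proof (rule Bochner_Integration.integrable_bound)
    show "AE \<omega> in M. norm (H \<omega> * g (X \<omega>) (V \<omega>)) \<le> norm (B * \<bar>g (X \<omega>) (V \<omega>)\<bar>)"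
    proof (rule AE_I2)
      fix \<omega> assume "\<omega> \<in> space M"
      from bd[OF this] show "norm (H \<omega> * g (X \<omega>) (V \<omega>)) \<le> norm (B * \<bar>g (X \<omega>) (V \<omega>)\<bar>)"
        by (auto simp: abs_mult intro!: mult_right_mono)
    qed
  qed simp
  show "integrable M (\<lambda>\<omega>. H \<omega> * (\<integral>x. g (X \<omega>) x \<partial>\<kappa> (X \<omega>)))"
    and "(\<integral>\<omega>. H \<omega> * g (X \<omega>) (V \<omega>) \<partial>M) = (\<integral>\<omega>. H \<omega> * (\<integral>x. g (X \<omega>) x \<partial>\<kappa> (X \<omega>)) \<partial>M)"
    using integral_mult_XV[OF g H int] by auto
qed

text \<open>The form used for characteristic functions. Both factors are split into real and
  imaginary parts, which leaves four real products.\<close>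

lemma integral_mult_XV_complex:
  fixes g :: "'d \<Rightarrow> 'b \<Rightarrow> complex"
  assumes g: "\<And>d. d \<in> D \<Longrightarrow> integrable (\<kappa> d) (g d)"
    and H: "H \<in> borel_measurable F" and bd: "\<And>\<omega>. \<omega> \<in> space M \<Longrightarrow> norm (H \<omega>) \<le> B"
  shows "integrable M (\<lambda>\<omega>. H \<omega> * g (X \<omega>) (V \<omega>))"
    and "integrable M (\<lambda>\<omega>. H \<omega> * (\<integral>x. g (X \<omega>) x \<partial>\<kappa> (X \<omega>)))"
    and "(\<integral>\<omega>. H \<omega> * g (X \<omega>) (V \<omega>) \<partial>M) = (\<integral>\<omega>. H \<omega> * (\<integral>x. g (X \<omega>) x \<partial>\<kappa> (X \<omega>)) \<partial>M)"
proof -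
  have gR: "\<And>d. d \<in> D \<Longrightarrow> integrable (\<kappa> d) (\<lambda>x. Re (g d x))" and gI: "\<And>d. d \<in> D \<Longrightarrow> integrable (\<kappa> d) (\<lambda>x. Im (g d x))"
    using g by auto
  have HR: "(\<lambda>\<omega>. Re (H \<omega>)) \<in> borel_measurable F" and HI: "(\<lambda>\<omega>. Im (H \<omega>)) \<in> borel_measurable F"
    using H by auto
  have bR: "\<And>\<omega>. \<omega> \<in> space M \<Longrightarrow> \<bar>Re (H \<omega>)\<bar> \<le> B" and bI: "\<And>\<omega>. \<omega> \<in> space M \<Longrightarrow> \<bar>Im (H \<omega>)\<bar> \<le> B"
    using bd abs_Re_le_cmod abs_Im_le_cmod order_trans by blast+
  note RR = integral_mult_XV_bounded[OF gR HR bR] and RI = integral_mult_XV_bounded[OF gI HR bR]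
    and IR = integral_mult_XV_bounded[OF gR HI bI] and II = integral_mult_XV_bounded[OF gI HI bI]
  have kR: "Re (\<integral>x. g (X \<omega>) x \<partial>\<kappa> (X \<omega>)) = (\<integral>x. Re (g (X \<omega>) x) \<partial>\<kappa> (X \<omega>))"
    and kI: "Im (\<integral>x. g (X \<omega>) x \<partial>\<kappa> (X \<omega>)) = (\<integral>x. Im (g (X \<omega>) x) \<partial>\<kappa> (X \<omega>))" if "\<omega> \<in> space M" for \<omega>
    using g[OF X_in[OF that]] by simp_all
  show 1: "integrable M (\<lambda>\<omega>. H \<omega> * g (X \<omega>) (V \<omega>))"
    unfolding complex_integrable_iff using RR(1) RI(1) IR(1) II(1) by simp
  have ReE: "Re (H \<omega> * (\<integral>x. g (X \<omega>) x \<partial>\<kappa> (X \<omega>))) = Re (H \<omega>) * (\<integral>x. Re (g (X \<omega>) x) \<partial>\<kappa> (X \<omega>)) - Im (H \<omega>) * (\<integral>x. Im (g (X \<omega>) x) \<partial>\<kappa> (X \<omega>))"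
    and ImE: "Im (H \<omega> * (\<integral>x. g (X \<omega>) x \<partial>\<kappa> (X \<omega>))) = Re (H \<omega>) * (\<integral>x. Im (g (X \<omega>) x) \<partial>\<kappa> (X \<omega>)) + Im (H \<omega>) * (\<integral>x. Re (g (X \<omega>) x) \<partial>\<kappa> (X \<omega>))"
    if "\<omega> \<in> space M" for \<omega>
    by (simp_all only: times_complex.sel kR[OF that] kI[OF that])
  show 2: "integrable M (\<lambda>\<omega>. H \<omega> * (\<integral>x. g (X \<omega>) x \<partial>\<kappa> (X \<omega>)))"
    unfolding complex_integrable_iff
  proof
    show "integrable M (\<lambda>\<omega>. Re (H \<omega> * (\<integral>x. g (X \<omega>) x \<partial>\<kappa> (X \<omega>))))"
      by (subst Bochner_Integration.integrable_cong[OF refl ReE], assumption)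
         (intro Bochner_Integration.integrable_diff RR II)
    show "integrable M (\<lambda>\<omega>. Im (H \<omega> * (\<integral>x. g (X \<omega>) x \<partial>\<kappa> (X \<omega>))))"
      by (subst Bochner_Integration.integrable_cong[OF refl ImE], assumption)
         (intro Bochner_Integration.integrable_add RI IR)
  qed
  show "(\<integral>\<omega>. H \<omega> * g (X \<omega>) (V \<omega>) \<partial>M) = (\<integral>\<omega>. H \<omega> * (\<integral>x. g (X \<omega>) x \<partial>\<kappa> (X \<omega>)) \<partial>M)"
  proof (rule complex_eqI)
    have "Re (\<integral>\<omega>. H \<omega> * g (X \<omega>) (V \<omega>) \<partial>M) = (\<integral>\<omega>. Re (H \<omega> * g (X \<omega>) (V \<omega>)) \<partial>M)"
      by (rule integral_Re[OF 1, symmetric])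
    also have "\<dots> = (\<integral>\<omega>. Re (H \<omega>) * Re (g (X \<omega>) (V \<omega>)) \<partial>M) - (\<integral>\<omega>. Im (H \<omega>) * Im (g (X \<omega>) (V \<omega>)) \<partial>M)"
      by (simp only: times_complex.sel Bochner_Integration.integral_diff[OF RR(1) II(1)])
    also have "\<dots> = (\<integral>\<omega>. Re (H \<omega> * (\<integral>x. g (X \<omega>) x \<partial>\<kappa> (X \<omega>))) \<partial>M)"
      by (subst Bochner_Integration.integral_cong[OF refl ReE], assumption,
          subst Bochner_Integration.integral_diff[OF RR(2) II(2)])
         (simp_all only: RR(3) II(3))
    finally show "Re (\<integral>\<omega>. H \<omega> * g (X \<omega>) (V \<omega>) \<partial>M) = Re (\<integral>\<omega>. H \<omega> * (\<integral>x. g (X \<omega>) x \<partial>\<kappa> (X \<omega>)) \<partial>M)"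
      using integral_Re[OF 2] by simp
  next
    have "Im (\<integral>\<omega>. H \<omega> * g (X \<omega>) (V \<omega>) \<partial>M) = (\<integral>\<omega>. Im (H \<omega> * g (X \<omega>) (V \<omega>)) \<partial>M)"
      by (rule integral_Im[OF 1, symmetric])
    also have "\<dots> = (\<integral>\<omega>. Re (H \<omega>) * Im (g (X \<omega>) (V \<omega>)) \<partial>M) + (\<integral>\<omega>. Im (H \<omega>) * Re (g (X \<omega>) (V \<omega>)) \<partial>M)"
      by (simp only: times_complex.sel Bochner_Integration.integral_add[OF RI(1) IR(1)])
    also have "\<dots> = (\<integral>\<omega>. Im (H \<omega> * (\<integral>x. g (X \<omega>) x \<partial>\<kappa> (X \<omega>))) \<partial>M)"
      by (subst Bochner_Integration.integral_cong[OF refl ImE], assumption,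
          subst Bochner_Integration.integral_add[OF RI(2) IR(2)])
         (simp_all only: RI(3) IR(3))
    finally show "Im (\<integral>\<omega>. H \<omega> * g (X \<omega>) (V \<omega>) \<partial>M) = Im (\<integral>\<omega>. H \<omega> * (\<integral>x. g (X \<omega>) x \<partial>\<kappa> (X \<omega>)) \<partial>M)"
      using integral_Im[OF 2] by simp
  qed
qed

end

section \<open>Second-order estimates\<close>

text \<open>Each pair of distinct indices is counted twice on both sides and the diagonal once more
  on the right. The inner sum runs over the indices from \<open>j\<close> on, so that conditioning
  at time \<open>j\<close> turns it into a potential.\<close>

lemma square_sum_le:
  fixes a :: "nat \<Rightarrow> real"
  shows "(\<Sum>k<n. a k)\<^sup>2 \<le> 2 * (\<Sum>j<n. a j * (\<Sum>i<n - j. a (j + i)))"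
proof (induction n)
  case (Suc n)
  have "(\<Sum>j<Suc n. a j * (\<Sum>i<Suc n - j. a (j + i))) = (\<Sum>j<n. a j * (\<Sum>i<Suc (n - j). a (j + i))) + a n * a n"
    by (simp add: Suc_diff_le less_imp_le)
  also have "\<dots> = (\<Sum>j<n. a j * (\<Sum>i<n - j. a (j + i))) + (\<Sum>j<n. a j) * a n + a n * a n"
    by (simp add: distrib_left sum.distrib sum_distrib_right)
  finally have *: "(\<Sum>j<Suc n. a j * (\<Sum>i<Suc n - j. a (j + i)))
    = (\<Sum>j<n. a j * (\<Sum>i<n - j. a (j + i))) + (\<Sum>j<n. a j) * a n + a n * a n" .
  have "(\<Sum>k<Suc n. a k)\<^sup>2 = (\<Sum>k<n. a k)\<^sup>2 + 2 * ((\<Sum>j<n. a j) * a n) + a n * a n"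
    by (simp add: power2_eq_square algebra_simps)
  moreover have "0 \<le> a n * a n" by simp
  ultimately show ?case using Suc unfolding * distrib_left by linarith
qed simp

text \<open>The exponential lies between its tangent \<open>1 - x\<close> and
  \<open>1 / (1 + x)\<close>; only the order of the error matters later, not the constant.\<close>

lemma exp_minus_second_order:
  fixes x :: real assumes "0 \<le> x" shows "\<bar>exp (- x) - (1 - x)\<bar> \<le> x\<^sup>2"
proof -
  have "exp (- x) = 1 / exp x" by (simp add: exp_minus inverse_eq_divide)
  also have "\<dots> \<le> 1 / (1 + x)"
    using exp_ge_add_one_self[of x] assms by (intro divide_left_mono) auto
  also have "\<dots> \<le> 1 - x + x\<^sup>2"
  proof -
    have "(1 - x + x\<^sup>2) * (1 + x) = 1 + x ^ 3" by algebra
    then have "1 \<le> (1 - x + x\<^sup>2) * (1 + x)" using assms by simp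
    then show ?thesis using assms by (subst pos_divide_le_eq) auto
  qed
  finally show ?thesis using exp_ge_add_one_self[of "- x"] by simp
qed

lemma abs_one_minus_exp_le:
  fixes q :: real assumes "\<bar>q\<bar> \<le> Q" shows "\<bar>1 - exp q\<bar> \<le> \<bar>q\<bar> * exp Q"
proof (cases "q \<ge> 0")
  case True
  have "exp q * (1 - q) \<le> exp q * exp (- q)"
    using exp_ge_add_one_self[of "- q"] by (intro mult_left_mono) auto
  then have "exp q - 1 \<le> q * exp q" by (simp add: exp_minus algebra_simps)
  also have "\<dots> \<le> q * exp Q" using True assms by (intro mult_left_mono) auto
  finally show ?thesis using True by simp
next
  case False
  have "exp q \<le> 1" "1 + q \<le> exp q" using exp_ge_add_one_self[of q] False by auto
  then have "\<bar>1 - exp q\<bar> \<le> \<bar>q\<bar>" by linarith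
  also have "\<dots> \<le> \<bar>q\<bar> * exp Q" using assms mult_left_mono[of 1 "exp Q" "\<bar>q\<bar>"] by simp
  finally show ?thesis .
qed

text \<open>The error of one step is o(1/n), so that n such errors still vanish. The comparison is
  with the exponential and not with \<open>1 - s^2 v / 2\<close>, because the compensator in
  \<open>compensated_step\<close> is a product of exponentials.\<close>

lemma (in prob_space) char_function_second_order:
  fixes f :: "'a \<Rightarrow> real" and s :: "nat \<Rightarrow> real"
  assumes [measurable]: "random_variable borel f" and i1: "integrable M f" and i2: "integrable M (\<lambda>x. (f x)\<^sup>2)"
    and m: "expectation f = 0" and v: "expectation (\<lambda>x. (f x)\<^sup>2) = v"
    and s: "(\<lambda>n. real n * (s n)\<^sup>2) \<longlonglongrightarrow> c"
  shows "(\<lambda>n. real n * cmod (expectation (\<lambda>x. iexp (s n * f x)) - of_real (exp (- ((s n)\<^sup>2 * v / 2))))) \<longlonglongrightarrow> 0"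
proof -
  have s2: "(\<lambda>n. (s n)\<^sup>2) \<longlonglongrightarrow> 0"
  proof -
    have "(\<lambda>n. real n * (s n)\<^sup>2 * inverse (real n)) \<longlonglongrightarrow> c * 0"
      by (intro tendsto_mult s lim_inverse_n)
    moreover have "eventually (\<lambda>n. real n * (s n)\<^sup>2 * inverse (real n) = (s n)\<^sup>2) sequentially"
      using eventually_gt_at_top[of 0] by eventually_elim simp
    ultimately show ?thesis by (simp add: tendsto_cong)
  qed
  then have s0: "s \<longlonglongrightarrow> 0"
    using tendsto_real_sqrt[OF s2] by (simp add: tendsto_rabs_zero_iff)
  have v0: "0 \<le> v" unfolding v[symmetric] by simp
  have char: "expectation (\<lambda>x. iexp (t * f x)) = char (distr M borel f) t" for t
    unfolding char_def by (subst integral_distr) auto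
  have le: "real n * cmod (expectation (\<lambda>x. iexp (s n * f x)) - of_real (exp (- ((s n)\<^sup>2 * v / 2))))
    \<le> (real n * (s n)\<^sup>2) / 6 * expectation (\<lambda>x. min (6 * (f x)\<^sup>2) (\<bar>s n\<bar> * \<bar>f x\<bar>^3)) + (real n * (s n)\<^sup>2) * (s n)\<^sup>2 * (v / 2)\<^sup>2" for n
  proof -
    define a where "a = char (distr M borel f) (s n)"
    define b where "b = 1 - (s n)\<^sup>2 * v / 2"
    define e where "e = exp (- ((s n)\<^sup>2 * v / 2))"
    have 1: "cmod (a - complex_of_real b) \<le> ((s n)^2 / 6) * expectation (\<lambda>x. min (6 * (f x)^2) (\<bar>s n\<bar> * \<bar>f x\<bar>^3))"
      using char_approx3'[OF assms(1) i1 i2 m _ refl, of v "s n"] v m unfolding a_def b_def by simp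
    have "cmod (complex_of_real b - complex_of_real e) = \<bar>e - b\<bar>"
      by (simp only: of_real_diff[symmetric] norm_of_real abs_minus_commute)
    also have "\<dots> \<le> ((s n)\<^sup>2 * v / 2)\<^sup>2" unfolding e_def b_def by (rule exp_minus_second_order) (use v0 in simp)
    finally have 2: "cmod (complex_of_real b - complex_of_real e) \<le> ((s n)\<^sup>2 * v / 2)\<^sup>2" .
    have "cmod (a - complex_of_real e) \<le> cmod (a - complex_of_real b) + cmod (complex_of_real b - complex_of_real e)"
      by (metis dist_norm dist_triangle)
    then have "cmod (a - complex_of_real e) \<le> ((s n)^2 / 6) * expectation (\<lambda>x. min (6 * (f x)^2) (\<bar>s n\<bar> * \<bar>f x\<bar>^3)) + ((s n)\<^sup>2 * v / 2)\<^sup>2"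
      using 1 2 by linarith
    from mult_left_mono[OF this, of "real n"]
    have "real n * cmod (a - complex_of_real e) \<le> real n * (((s n)^2 / 6) * expectation (\<lambda>x. min (6 * (f x)^2) (\<bar>s n\<bar> * \<bar>f x\<bar>^3)) + ((s n)\<^sup>2 * v / 2)\<^sup>2)"
      by simp
    moreover have "m * (q / 6 * E + (q * v / 2)\<^sup>2) = m * q / 6 * E + m * q * q * (v / 2)\<^sup>2" for m q E :: real
      by (simp add: power2_eq_square algebra_simps)
    ultimately show ?thesis unfolding char a_def e_def by simp
  qed
  \<comment> \<open>No third moment is available: the minimum tends to 0 pointwise through its cubic
    entry and is dominated by its quadratic one.\<close>
  have "(\<lambda>n. expectation (\<lambda>x. min (6 * (f x)\<^sup>2) (\<bar>s n\<bar> * \<bar>f x\<bar>^3))) \<longlonglongrightarrow> expectation (\<lambda>x. 0)"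
  proof (rule integral_dominated_convergence [where w = "\<lambda>x. 6 * (f x)^2"])
    show "AE x in M. (\<lambda>n. min (6 * (f x)\<^sup>2) (\<bar>s n\<bar> * \<bar>f x\<bar>^3)) \<longlonglongrightarrow> 0"
    proof (rule AE_I2)
      fix x
      have "(\<lambda>n. min (6 * (f x)\<^sup>2) (\<bar>s n\<bar> * \<bar>f x\<bar>^3)) \<longlonglongrightarrow> min (6 * (f x)\<^sup>2) (\<bar>0\<bar> * \<bar>f x\<bar>^3)"
        by (intro tendsto_intros s0)
      then show "(\<lambda>n. min (6 * (f x)\<^sup>2) (\<bar>s n\<bar> * \<bar>f x\<bar>^3)) \<longlonglongrightarrow> 0" by simp
    qed
  qed (use i2 in auto)
  then have "(\<lambda>n. (real n * (s n)\<^sup>2) / 6 * expectation (\<lambda>x. min (6 * (f x)\<^sup>2) (\<bar>s n\<bar> * \<bar>f x\<bar>^3)) + (real n * (s n)\<^sup>2) * (s n)\<^sup>2 * (v / 2)\<^sup>2)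
    \<longlonglongrightarrow> c / 6 * expectation (\<lambda>x. 0) + c * 0 * (v/2)\<^sup>2"
    by (intro tendsto_intros s s2) auto
  then have "(\<lambda>n. (real n * (s n)\<^sup>2) / 6 * expectation (\<lambda>x. min (6 * (f x)\<^sup>2) (\<bar>s n\<bar> * \<bar>f x\<bar>^3)) + (real n * (s n)\<^sup>2) * (s n)\<^sup>2 * (v / 2)\<^sup>2) \<longlonglongrightarrow> 0"
    by simp
  then show ?thesis
    by (rule Lim_null_comparison[rotated]) (use le in \<open>auto intro!: always_eventually simp: abs_mult\<close>)
qed

section \<open>The modulating chain\<close>

text \<open>The arithmetic-geometric inequality in place of Cauchy-Schwarz; the free parameter
  \<open>b\<close> is set to \<open>sqrt n\<close> in \<open>noise_clt\<close>.\<close>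

lemma (in prob_space) abs_expectation_le:
  fixes f :: "'a \<Rightarrow> real"
  assumes "integrable M (\<lambda>x. (f x)\<^sup>2)" "f \<in> borel_measurable M" "expectation (\<lambda>x. (f x)\<^sup>2) \<le> a" "0 < b"
  shows "expectation (\<lambda>x. \<bar>f x\<bar>) \<le> (a / b + b) / 2"
proof -
  have "expectation (\<lambda>x. \<bar>f x\<bar>) \<le> expectation (\<lambda>x. ((f x)\<^sup>2 / b + b) / 2)"
  proof (rule integral_mono)
    show "integrable M (\<lambda>x. \<bar>f x\<bar>)"
      using square_integrable_imp_integrable[OF assms(2,1)] by simp
    show "integrable M (\<lambda>x. ((f x)\<^sup>2 / b + b) / 2)" using assms by auto
    fix x
    have "0 \<le> (\<bar>f x\<bar> - b)\<^sup>2" by simp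
    then have "2 * \<bar>f x\<bar> * b \<le> (f x)\<^sup>2 + b\<^sup>2" by (simp add: power2_diff)
    then show "\<bar>f x\<bar> \<le> ((f x)\<^sup>2 / b + b) / 2" using assms(4) by (simp add: field_simps power2_eq_square)
  qed
  also have "\<dots> = (expectation (\<lambda>x. (f x)\<^sup>2) / b + b) / 2"
    using assms by (simp add: prob_space)
  also have "\<dots> \<le> (a / b + b) / 2" using assms by (simp add: divide_right_mono)
  finally show ?thesis .
qed

text \<open>\<open>V n\<close> is the whole future after time \<open>n\<close>: \<open>\<xi>\<close>
  reads the next state off it and \<open>\<zeta>\<close> the noise. That \<open>X\<close> is a
  Markov chain with matrix \<open>T\<close> is a consequence. \<open>V n\<close> itself is not
  measurable at time \<open>n + 1\<close>, and \<open>X_Suc\<close> and \<open>Z_eq\<close> hold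
  only almost everywhere, so measurability of \<open>Z n\<close> at time \<open>n + 1\<close> is a
  separate assumption.\<close>

locale modulated_noise = prob_space M for M :: "'a measure" +
  fixes F :: "nat \<Rightarrow> 'a measure" and D :: "real set" and X :: "nat \<Rightarrow> 'a \<Rightarrow> real"
    and N :: "'b measure" and V :: "nat \<Rightarrow> 'a \<Rightarrow> 'b" and \<kappa> :: "real \<Rightarrow> 'b measure"
    and \<xi> :: "'b \<Rightarrow> real" and T :: "real \<Rightarrow> real \<Rightarrow> real"
    and Z :: "nat \<Rightarrow> 'a \<Rightarrow> real" and \<zeta> :: "real \<Rightarrow> 'b \<Rightarrow> real" and p :: "real \<Rightarrow> real"
  assumes cond: "conditional_law M (F n) D (X n) N (V n) \<kappa>"
    and F_mono: "sets (F n) \<subseteq> sets (F (Suc n))"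
    and \<xi>_meas: "\<xi> \<in> measurable N (count_space D)"
    and X_Suc: "AE \<omega> in M. X (Suc n) \<omega> = \<xi> (V n \<omega>)"
    and T_eq: "d \<in> D \<Longrightarrow> e \<in> D \<Longrightarrow> T d e = measure (\<kappa> d) {x\<in>space N. \<xi> x = e}"
    and irr: "irreducible_on D T" and inv: "invariant_prob D T p"
    and Z_meas: "Z n \<in> borel_measurable (F (Suc n))"
    and Z_eq: "AE \<omega> in M. Z n \<omega> = \<zeta> (X n \<omega>) (V n \<omega>)"
    and \<zeta>_int: "d \<in> D \<Longrightarrow> integrable (\<kappa> d) (\<zeta> d)" "d \<in> D \<Longrightarrow> integrable (\<kappa> d) (\<lambda>x. (\<zeta> d x)\<^sup>2)"
    and \<zeta>_mean: "d \<in> D \<Longrightarrow> (\<integral>x. \<zeta> d x \<partial>\<kappa> d) = 0"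
begin

sublocale C: conditional_law M "F n" D "X n" N "V n" \<kappa> for n by (rule cond)

lemma finD: "finite D" by (rule C.finD)

lemma F_le: "m \<le> n \<Longrightarrow> sets (F m) \<subseteq> sets (F n)"
  by (rule lift_Suc_mono_le[of "\<lambda>n. sets (F n)"]) (auto intro: F_mono[THEN subsetD])

lemma measurable_F_mono: "m \<le> n \<Longrightarrow> g \<in> measurable (F m) L \<Longrightarrow> g \<in> measurable (F n) L"
  by (rule measurable_from_subalg[rotated]) (auto simp: subalgebra_def C.space_F dest: F_le[THEN subsetD, rotated])

lemma X_borel: "m \<le> n \<Longrightarrow> (\<lambda>\<omega>. f (X m \<omega>)) \<in> borel_measurable (F n)"
  by (rule measurable_F_mono, assumption) (rule C.finite_measurable_select, simp)

lemma X_borel_M[measurable]: "(\<lambda>\<omega>. f (X m \<omega>)) \<in> borel_measurable M"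
  by (rule C.measurable_F_M[OF X_borel[OF order_refl]])

lemma V_meas[measurable]: "V n \<in> measurable M N" by (rule C.V_meas)

lemma X_in_D: "\<omega> \<in> space M \<Longrightarrow> X n \<omega> \<in> D" by (rule C.X_in)

lemma D_ne: "D \<noteq> {}" using X_in_D not_empty by blast

lemma \<xi>_in: "x \<in> space N \<Longrightarrow> \<xi> x \<in> D" using measurable_space[OF \<xi>_meas] by simp

lemma space_\<kappa>: "d \<in> D \<Longrightarrow> space (\<kappa> d) = space N"
  using C.kernel(2) by (rule sets_eq_imp_space_eq)

lemma \<xi>_event: "e \<in> D \<Longrightarrow> {x\<in>space N. \<xi> x = e} \<in> sets N"
  using measurable_sets[OF \<xi>_meas, of "{e}"] by (simp add: vimage_def Int_def conj_commute)

lemma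
  fixes f :: "real \<Rightarrow> real"
  assumes d: "d \<in> D"
  shows \<xi>_integrable: "integrable (\<kappa> d) (\<lambda>x. f (\<xi> x))"
    and \<xi>_integral: "(\<integral>x. f (\<xi> x) \<partial>\<kappa> d) = (\<Sum>e\<in>D. T d e * f e)"
proof -
  interpret K: prob_space "\<kappa> d" using C.kernel(1)[OF d] .
  have eq: "f (\<xi> x) = (\<Sum>e\<in>D. f e * indicator {x\<in>space N. \<xi> x = e} x)" if "x \<in> space (\<kappa> d)" for x
  proof -
    have "x \<in> space N" using that space_\<kappa>[OF d] by simp
    then have "(\<Sum>e\<in>D. f e * indicator {x\<in>space N. \<xi> x = e} x) = (\<Sum>e\<in>D. if e = \<xi> x then f e else 0)"
      by (intro sum.cong) (auto simp: indicator_def)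
    then show ?thesis using finD \<xi>_in[OF \<open>x \<in> space N\<close>] by simp
  qed
  have ev: "{x\<in>space N. \<xi> x = e} \<in> sets (\<kappa> d)" if "e \<in> D" for e using that unfolding C.kernel(2)[OF d] by (rule \<xi>_event)
  have i: "integrable (\<kappa> d) (\<lambda>x. f e * indicator {x\<in>space N. \<xi> x = e} x)" if "e \<in> D" for e
    by (intro integrable_mult_right integrable_real_indicator ev that) (simp add: K.emeasure_eq_measure)
  show "integrable (\<kappa> d) (\<lambda>x. f (\<xi> x))"
    by (subst Bochner_Integration.integrable_cong[OF refl eq], assumption) (rule Bochner_Integration.integrable_sum, rule i)
  have "(\<integral>x. f (\<xi> x) \<partial>\<kappa> d) = (\<Sum>e\<in>D. \<integral>x. f e * indicator {x\<in>space N. \<xi> x = e} x \<partial>\<kappa> d)"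
    by (subst Bochner_Integration.integral_cong[OF refl eq], assumption, rule Bochner_Integration.integral_sum, rule i)
  also have "\<dots> = (\<Sum>e\<in>D. T d e * f e)"
  proof (rule sum.cong[OF refl])
    fix e assume e: "e \<in> D"
    have "(\<integral>x. f e * indicator {x\<in>space N. \<xi> x = e} x \<partial>\<kappa> d) = f e * measure (\<kappa> d) {x\<in>space N. \<xi> x = e}"
      by (simp only: integral_mult_right_zero Bochner_Integration.integral_indicator real_scaleR_def mult_1_right
          Int_absorb2[OF sets.sets_into_space[OF ev[OF e]]])
    then show "(\<integral>x. f e * indicator {x\<in>space N. \<xi> x = e} x \<partial>\<kappa> d) = T d e * f e" by (simp only: T_eq[OF d e] mult.commute)
  qed
  finally show "(\<integral>x. f (\<xi> x) \<partial>\<kappa> d) = (\<Sum>e\<in>D. T d e * f e)" .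
qed

sublocale stochastic_matrix D T
proof
  fix d assume d: "d \<in> D"
  interpret K: prob_space "\<kappa> d" using C.kernel(1)[OF d] .
  show "(\<Sum>e\<in>D. T d e) = 1" using \<xi>_integral[OF d, of "\<lambda>_. 1"] K.prob_space by simp
qed (auto simp: finD D_ne T_eq)

text \<open>The Markov property tested against bounded functions of the past: the next state is a
  function of \<open>V n\<close>, whose law given the past is known.\<close>

lemma chain_step:
  assumes H: "H \<in> borel_measurable (F n)" and bd: "\<And>\<omega>. \<omega> \<in> space M \<Longrightarrow> \<bar>H \<omega>\<bar> \<le> B"
  shows "expectation (\<lambda>\<omega>. H \<omega> * f (X (Suc n) \<omega>)) = expectation (\<lambda>\<omega>. H \<omega> * (\<Sum>e\<in>D. T (X n \<omega>) e * f e))"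
proof -
  note [measurable] = C.measurable_F_M[OF H]
  have [measurable]: "(\<lambda>x. f (\<xi> x)) \<in> borel_measurable N"
    using \<xi>_meas by (rule measurable_compose) simp
  have "expectation (\<lambda>\<omega>. H \<omega> * f (X (Suc n) \<omega>)) = expectation (\<lambda>\<omega>. H \<omega> * f (\<xi> (V n \<omega>)))"
    by (rule integral_cong_AE) (use X_Suc[of n] in auto)
  also have "\<dots> = expectation (\<lambda>\<omega>. H \<omega> * (\<integral>x. f (\<xi> x) \<partial>\<kappa> (X n \<omega>)))"
    by (rule C.integral_mult_XV_bounded(3)[of "\<lambda>d x. f (\<xi> x)", OF \<xi>_integrable H bd])
  also have "\<dots> = expectation (\<lambda>\<omega>. H \<omega> * (\<Sum>e\<in>D. T (X n \<omega>) e * f e))"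
    by (rule Bochner_Integration.integral_cong) (auto simp: \<xi>_integral X_in_D)
  finally show ?thesis .
qed

lemma chain_steps:
  assumes H: "H \<in> borel_measurable (F n)" and bd: "\<And>\<omega>. \<omega> \<in> space M \<Longrightarrow> \<bar>H \<omega>\<bar> \<le> B"
  shows "expectation (\<lambda>\<omega>. H \<omega> * f (X (n + i) \<omega>)) = expectation (\<lambda>\<omega>. H \<omega> * mat_apply D T i f (X n \<omega>))"
proof (induction i arbitrary: f)
  case 0
  then show ?case by (auto intro!: Bochner_Integration.integral_cong simp: mat_apply_0 finD X_in_D)
next
  case (Suc i)
  show ?case
    using chain_step[OF measurable_F_mono[OF _ H, of "n + i"] bd, of f] Suc[of "\<lambda>d. \<Sum>e\<in>D. T d e * f e"]
    by (simp add: mat_apply_Suc)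
qed

lemma f_bounded: "\<exists>B. \<forall>d\<in>D. \<bar>(f :: real \<Rightarrow> real) d\<bar> \<le> B"
  using finD by (intro exI[of _ "\<Sum>d\<in>D. \<bar>f d\<bar>"] ballI member_le_sum) auto

text \<open>After \<open>square_sum_le\<close>, conditioning at time \<open>j\<close> replaces the
  inner sum by a potential evaluated at \<open>X j\<close>. This is bounded uniformly, so each of
  the n terms contributes a constant and the square grows linearly instead of quadratically.\<close>

lemma second_moment:
  assumes pf: "(\<Sum>d\<in>D. p d * f d) = 0"
  shows "\<exists>C. \<forall>n. expectation (\<lambda>\<omega>. (\<Sum>k<n. f (X k \<omega>))\<^sup>2) \<le> C * real n"
proof -
  obtain B where B: "\<And>d. d \<in> D \<Longrightarrow> \<bar>f d\<bar> \<le> B" using f_bounded by blast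
  obtain C where C: "\<And>n d. d \<in> D \<Longrightarrow> \<bar>\<Sum>i<n. mat_apply D T i f d\<bar> \<le> C"
    using potential_bounded[OF irr inv pf] by blast
  have B0: "B \<ge> 0" and C0: "C \<ge> 0" using B C[of _ 0] D_ne by fastforce+
  have bint: "integrable M g" if "g \<in> borel_measurable M" "\<And>\<omega>. \<omega> \<in> space M \<Longrightarrow> \<bar>g \<omega>\<bar> \<le> K" for g :: "'a \<Rightarrow> real" and K
    using that by (intro integrable_const_bound[where B=K]) auto
  have "expectation (\<lambda>\<omega>. (\<Sum>k<n. f (X k \<omega>))\<^sup>2) \<le> (2 * B * C) * real n" for n
  proof -
    have i1: "integrable M (\<lambda>\<omega>. f (X j \<omega>) * f (X k \<omega>))" for j k
      by (rule bint[of _ "B * B"]) (auto simp: abs_mult intro!: mult_mono B X_in_D B0)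
    have "expectation (\<lambda>\<omega>. (\<Sum>k<n. f (X k \<omega>))\<^sup>2) \<le> expectation (\<lambda>\<omega>. 2 * (\<Sum>j<n. f (X j \<omega>) * (\<Sum>i<n - j. f (X (j + i) \<omega>))))"
      by (intro integral_mono square_sum_le)
         (auto simp: power2_eq_square sum_product sum_distrib_left[of "f _"] simp del: sum_distrib_left intro!: Bochner_Integration.integrable_sum i1 integrable_mult_right)
    also have "\<dots> = 2 * (\<Sum>j<n. \<Sum>i<n - j. expectation (\<lambda>\<omega>. f (X j \<omega>) * f (X (j + i) \<omega>)))"
      by (simp add: sum_distrib_left[of "f _"] Bochner_Integration.integral_sum Bochner_Integration.integrable_sum i1)
    also have "\<dots> = 2 * (\<Sum>j<n. \<Sum>i<n - j. expectation (\<lambda>\<omega>. f (X j \<omega>) * mat_apply D T i f (X j \<omega>)))"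
      by (simp add: chain_steps[of "\<lambda>\<omega>. f (X _ \<omega>)" _ B f] X_borel B X_in_D)
    also have "\<dots> = 2 * (\<Sum>j<n. expectation (\<lambda>\<omega>. f (X j \<omega>) * (\<Sum>i<n - j. mat_apply D T i f (X j \<omega>))))"
    proof -
      have "integrable M (\<lambda>\<omega>. f (X j \<omega>) * mat_apply D T i f (X j \<omega>))" for i j
        by (rule bint[of _ "B * B"]) (auto simp: abs_mult intro!: mult_mono B mat_apply_bound X_in_D B0)
      then show ?thesis by (simp add: sum_distrib_left[of "f _"] Bochner_Integration.integral_sum)
    qed
    also have "\<dots> \<le> 2 * (\<Sum>j<n. B * C)"
    proof (intro mult_left_mono sum_mono)
      fix j
      have le: "\<bar>f (X j \<omega>) * (\<Sum>i<n - j. mat_apply D T i f (X j \<omega>))\<bar> \<le> B * C" if "\<omega> \<in> space M" for \<omega>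
        unfolding abs_mult using that by (intro mult_mono B C X_in_D B0) auto
      have "integrable M (\<lambda>\<omega>. f (X j \<omega>) * (\<Sum>i<n - j. mat_apply D T i f (X j \<omega>)))"
        by (rule bint[OF _ le]) auto
      then have "expectation (\<lambda>\<omega>. f (X j \<omega>) * (\<Sum>i<n - j. mat_apply D T i f (X j \<omega>))) \<le> expectation (\<lambda>_. B * C)"
        using le by (intro integral_mono) (auto simp: abs_le_iff)
      then show "expectation (\<lambda>\<omega>. f (X j \<omega>) * (\<Sum>i<n - j. mat_apply D T i f (X j \<omega>))) \<le> B * C"
        by (simp add: prob_space)
    qed simp
    finally show ?thesis by (simp add: algebra_simps)
  qed
  then show ?thesis by blast
qed

end

section \<open>Central limit theorem for the noise\<close>

context modulated_noise
begin

definition v :: "real \<Rightarrow> real" where "v d = (\<integral>x. (\<zeta> d x)\<^sup>2 \<partial>\<kappa> d)"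

lemma v_nonneg: "0 \<le> v d" by (simp add: v_def)

lemma Z_borel: "m < n \<Longrightarrow> Z m \<in> borel_measurable (F n)"
  using Z_meas by (rule measurable_F_mono[rotated]) simp

lemma Z_borel_M[measurable]: "Z n \<in> borel_measurable M"
  by (rule C.measurable_F_M[OF Z_meas])

lemma norm_iexp: "norm (iexp x) = 1" for x :: real
  by (simp add: norm_exp_eq_Re)

text \<open>Compensating \<open>iexp (s * sum Z)\<close> by the exponential of half the conditional variances gives
  a process whose expectation is nearly constant.\<close>

lemma compensated_step:
  fixes s :: real and k :: nat
  assumes vm: "\<And>d. d \<in> D \<Longrightarrow> v d \<le> vm"
  defines "G \<equiv> \<lambda>k \<omega>. iexp (s * (\<Sum>j<k. Z j \<omega>)) * of_real (exp (s\<^sup>2 / 2 * (\<Sum>j<k. v (X j \<omega>))))"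
    and "\<rho> \<equiv> \<Sum>d\<in>D. cmod ((\<integral>x. iexp (s * \<zeta> d x) \<partial>\<kappa> d) - of_real (exp (- (s\<^sup>2 * v d / 2))))"
  shows "integrable M (G k)"
    and "cmod (expectation (G (Suc k)) - expectation (G k)) \<le> exp (s\<^sup>2 / 2 * (real (Suc k) * vm)) * \<rho>"
proof -
  have vsum: "(\<Sum>j<k. v (X j \<omega>)) \<le> real k * vm" if "\<omega> \<in> space M" for k \<omega>
    using sum_bounded_above[of "{..<k}" "\<lambda>j. v (X j \<omega>)" vm] vm X_in_D[OF that] by simp
  have G_norm: "cmod (G k \<omega>) \<le> exp (s\<^sup>2 / 2 * (real k * vm))" if "\<omega> \<in> space M" for k \<omega>
    unfolding G_def norm_mult norm_iexp norm_of_real using vsum[OF that, of k] by (simp add: mult_left_mono)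
  have G_F: "G k \<in> borel_measurable (F k)" for k
  proof -
    have [measurable]: "\<And>j. j \<in> {..<k} \<Longrightarrow> Z j \<in> borel_measurable (F k)"
      "\<And>j. j \<in> {..<k} \<Longrightarrow> (\<lambda>\<omega>. v (X j \<omega>)) \<in> borel_measurable (F k)"
      by (simp_all add: Z_borel X_borel)
    show ?thesis unfolding G_def by measurable
  qed
  have G_M[measurable]: "G k \<in> borel_measurable M" for k by (rule C.measurable_F_M[OF G_F])
  show G_int: "integrable M (G k)" for k
    using G_norm by (intro integrable_const_bound[where B="exp (s\<^sup>2 / 2 * (real k * vm))"]) auto
  \<comment> \<open>\<open>H\<close> is \<open>G k\<close> with the compensator of step
    \<open>k\<close> already included. It is known at time \<open>k\<close>, and
    \<open>G (Suc k)\<close> and \<open>G k\<close> are \<open>H\<close> times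
    \<open>iexp (s * Z k)\<close> and \<open>H\<close> times the Gaussian factor; their difference
    is governed by the error of a single characteristic function.\<close>
  define H where "H \<omega> = G k \<omega> * of_real (exp (s\<^sup>2 / 2 * v (X k \<omega>)))" for \<omega>
  have H_F: "H \<in> borel_measurable (F k)"
  proof -
    note [measurable] = G_F[of k] X_borel[OF order_refl, of v k]
    show ?thesis unfolding H_def by measurable
  qed
  note [measurable] = C.measurable_F_M[OF H_F]
  have H_norm: "cmod (H \<omega>) \<le> exp (s\<^sup>2 / 2 * (real (Suc k) * vm))" if "\<omega> \<in> space M" for \<omega>
  proof -
    have "cmod (H \<omega>) \<le> exp (s\<^sup>2 / 2 * (real k * vm)) * exp (s\<^sup>2 / 2 * vm)"
      unfolding H_def norm_mult norm_of_real
      using G_norm[OF that] vm[OF X_in_D[OF that]] by (intro mult_mono) (auto intro!: mult_left_mono)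
    then show ?thesis by (simp add: algebra_simps add_divide_distrib flip: exp_add)
  qed
  have \<zeta>_m: "d \<in> D \<Longrightarrow> \<zeta> d \<in> borel_measurable (\<kappa> d)" for d using \<zeta>_int(1) by auto
  have i\<kappa>: "integrable (\<kappa> d) (\<lambda>x. iexp (s * \<zeta> d x))" if d: "d \<in> D" for d
  proof -
    interpret K: prob_space "\<kappa> d" using C.kernel(1)[OF d] .
    show ?thesis using \<zeta>_m[OF d] by (intro K.integrable_const_bound[where B=1]) auto
  qed
  have step: "expectation (G (Suc k)) = expectation (\<lambda>\<omega>. H \<omega> * (\<integral>x. iexp (s * \<zeta> (X k \<omega>) x) \<partial>\<kappa> (X k \<omega>)))"
    and step_int: "integrable M (\<lambda>\<omega>. H \<omega> * (\<integral>x. iexp (s * \<zeta> (X k \<omega>) x) \<partial>\<kappa> (X k \<omega>)))"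
  proof -
    have eq: "G (Suc k) \<omega> = H \<omega> * iexp (s * Z k \<omega>)" for \<omega>
      unfolding G_def H_def sum.lessThan_Suc distrib_left of_real_add exp_add of_real_mult by (simp only: mult_ac)
    note I = C.integral_mult_XV_complex[OF i\<kappa> H_F H_norm]
    have "expectation (G (Suc k)) = expectation (\<lambda>\<omega>. H \<omega> * iexp (s * \<zeta> (X k \<omega>) (V k \<omega>)))"
      by (rule integral_cong_AE) (use Z_eq[of k] I(1) in \<open>auto simp: eq\<close>)
    also have "\<dots> = expectation (\<lambda>\<omega>. H \<omega> * (\<integral>x. iexp (s * \<zeta> (X k \<omega>) x) \<partial>\<kappa> (X k \<omega>)))"
      by (rule I(3))
    finally show "expectation (G (Suc k)) = expectation (\<lambda>\<omega>. H \<omega> * (\<integral>x. iexp (s * \<zeta> (X k \<omega>) x) \<partial>\<kappa> (X k \<omega>)))" .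
    show "integrable M (\<lambda>\<omega>. H \<omega> * (\<integral>x. iexp (s * \<zeta> (X k \<omega>) x) \<partial>\<kappa> (X k \<omega>)))" by (rule I(2))
  qed
  have G_eq: "G k \<omega> = H \<omega> * of_real (exp (- (s\<^sup>2 * v (X k \<omega>) / 2)))" for \<omega>
  proof -
    have "exp (s\<^sup>2 / 2 * v (X k \<omega>)) * exp (- (s\<^sup>2 * v (X k \<omega>) / 2)) = 1" by (simp flip: exp_add)
    then show ?thesis unfolding H_def mult.assoc of_real_mult[symmetric] by simp
  qed
  have "expectation (G (Suc k)) - expectation (G k) =
     expectation (\<lambda>\<omega>. H \<omega> * (\<integral>x. iexp (s * \<zeta> (X k \<omega>) x) \<partial>\<kappa> (X k \<omega>)) - G k \<omega>)"
    unfolding step by (rule Bochner_Integration.integral_diff[symmetric, OF step_int G_int])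
  also have "cmod \<dots> \<le> expectation (\<lambda>_. exp (s\<^sup>2 / 2 * (real (Suc k) * vm)) * \<rho>)"
  proof (rule order.trans[OF integral_norm_bound integral_mono])
    show "integrable M (\<lambda>\<omega>. cmod (H \<omega> * (\<integral>x. iexp (s * \<zeta> (X k \<omega>) x) \<partial>\<kappa> (X k \<omega>)) - G k \<omega>))"
      using step_int G_int by auto
    fix \<omega> assume \<omega>: "\<omega> \<in> space M"
    have "cmod (H \<omega> * (\<integral>x. iexp (s * \<zeta> (X k \<omega>) x) \<partial>\<kappa> (X k \<omega>)) - G k \<omega>)
      = cmod (H \<omega>) * cmod ((\<integral>x. iexp (s * \<zeta> (X k \<omega>) x) \<partial>\<kappa> (X k \<omega>)) - of_real (exp (- (s\<^sup>2 * v (X k \<omega>) / 2))))"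
      by (simp only: G_eq right_diff_distrib[symmetric] norm_mult)
    also have "\<dots> \<le> exp (s\<^sup>2 / 2 * (real (Suc k) * vm)) * \<rho>"
      unfolding \<rho>_def
      by (intro mult_mono H_norm \<omega> member_le_sum[where f="\<lambda>d. cmod ((\<integral>x. iexp (s * \<zeta> d x) \<partial>\<kappa> d) - of_real (exp (- (s\<^sup>2 * v d / 2))))"])
         (auto simp: finD X_in_D \<omega>)
    finally show "cmod (H \<omega> * (\<integral>x. iexp (s * \<zeta> (X k \<omega>) x) \<partial>\<kappa> (X k \<omega>)) - G k \<omega>) \<le> exp (s\<^sup>2 / 2 * (real (Suc k) * vm)) * \<rho>" .
  qed simp
  finally show "cmod (expectation (G (Suc k)) - expectation (G k)) \<le> exp (s\<^sup>2 / 2 * (real (Suc k) * vm)) * \<rho>"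
    by (simp add: prob_space)
qed

text \<open>The scaling is left general, with only \<open>n * s n ^ 2\<close> convergent, because
  the recursion leads to \<open>s n = - t * sqrt (n + 2) / (n + 1)\<close> and not to
  \<open>t / sqrt n\<close>. Two replacements are made: the compensated expectation by 1, and the
  random compensator by its deterministic limit.\<close>

theorem noise_clt:
  fixes s :: "nat \<Rightarrow> real"
  assumes s: "(\<lambda>n. real n * (s n)\<^sup>2) \<longlonglongrightarrow> c"
  shows "(\<lambda>n. expectation (\<lambda>\<omega>. iexp (s n * (\<Sum>j<n. Z j \<omega>)))) \<longlonglongrightarrow> of_real (exp (- (c * (\<Sum>d\<in>D. p d * v d) / 2)))"
proof -
  define \<sigma> where "\<sigma> = (\<Sum>d\<in>D. p d * v d)"
  obtain vm where vm: "\<And>d. d \<in> D \<Longrightarrow> v d \<le> vm" using f_bounded[of v] by (auto simp: abs_le_iff)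
  have vm0: "0 \<le> vm" using vm D_ne v_nonneg order_trans by blast
  have psum: "(\<Sum>d\<in>D. p d) = 1" using inv by (simp add: invariant_prob_def)
  define f where "f d = v d - \<sigma>" for d
  have "(\<Sum>d\<in>D. p d * f d) = 0"
    by (simp add: f_def right_diff_distrib sum_subtractf \<sigma>_def psum flip: sum_distrib_right)
  then obtain C where C: "\<And>n. expectation (\<lambda>\<omega>. (\<Sum>k<n. f (X k \<omega>))\<^sup>2) \<le> C * real n"
    using second_moment by blast
  obtain B where B: "\<And>d. d \<in> D \<Longrightarrow> \<bar>f d\<bar> \<le> B" using f_bounded[of f] by blast
  define \<rho> where "\<rho> n = (\<Sum>d\<in>D. cmod ((\<integral>x. iexp (s n * \<zeta> d x) \<partial>\<kappa> d) - of_real (exp (- ((s n)\<^sup>2 * v d / 2)))))" for n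
  define G where "G n k \<omega> = iexp (s n * (\<Sum>j<k. Z j \<omega>)) * of_real (exp ((s n)\<^sup>2 / 2 * (\<Sum>j<k. v (X j \<omega>))))" for n k \<omega>
  have G_int: "integrable M (G n k)" for n k
    using compensated_step(1)[OF vm, of "s n" k] by (simp add: G_def[abs_def])
  have \<rho>: "(\<lambda>n. real n * \<rho> n) \<longlonglongrightarrow> 0"
  proof -
    have "(\<lambda>n. \<Sum>d\<in>D. real n * cmod ((\<integral>x. iexp (s n * \<zeta> d x) \<partial>\<kappa> d) - of_real (exp (- ((s n)\<^sup>2 * v d / 2))))) \<longlonglongrightarrow> (\<Sum>d\<in>D. 0)"
    proof (rule tendsto_sum)
      fix d assume d: "d \<in> D"
      interpret K: prob_space "\<kappa> d" using C.kernel(1)[OF d] .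
      show "(\<lambda>n. real n * cmod ((\<integral>x. iexp (s n * \<zeta> d x) \<partial>\<kappa> d) - of_real (exp (- ((s n)\<^sup>2 * v d / 2))))) \<longlonglongrightarrow> 0"
        by (rule K.char_function_second_order[OF _ \<zeta>_int[OF d] \<zeta>_mean[OF d] _ s]) (auto simp: v_def \<zeta>_int d intro: borel_measurable_integrable)
    qed
    then show ?thesis by (simp add: \<rho>_def sum_distrib_left)
  qed
  have \<rho>0: "0 \<le> \<rho> n" for n unfolding \<rho>_def by (simp add: sum_nonneg)
  have G_diff: "cmod (expectation (G n n) - 1) \<le> exp (real n * (s n)\<^sup>2 / 2 * vm) * (real n * \<rho> n)" for n
  proof -
    have "expectation (G n k) - 1 = (\<Sum>i<k. expectation (G n (Suc i)) - expectation (G n i))" for k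
      using sum_lessThan_telescope[of "\<lambda>i. expectation (G n i)" k] by (simp add: G_def[of n 0, abs_def] prob_space)
    then have "cmod (expectation (G n n) - 1) \<le> (\<Sum>i<n. cmod (expectation (G n (Suc i)) - expectation (G n i)))"
      by (simp add: norm_sum)
    also have "\<dots> \<le> (\<Sum>i<n. exp (real n * (s n)\<^sup>2 / 2 * vm) * \<rho> n)"
    proof (rule sum_mono)
      fix i assume i: "i \<in> {..<n}"
      have "cmod (expectation (G n (Suc i)) - expectation (G n i)) \<le> exp ((s n)\<^sup>2 / 2 * (real (Suc i) * vm)) * \<rho> n"
        using compensated_step(2)[OF vm, of "s n" i] by (simp add: G_def[abs_def] \<rho>_def)
      also have "\<dots> \<le> exp ((s n)\<^sup>2 / 2 * (real n * vm)) * \<rho> n"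
        using i vm0 by (intro mult_right_mono \<rho>0) (auto intro!: mult_left_mono mult_right_mono)
      finally show "cmod (expectation (G n (Suc i)) - expectation (G n i)) \<le> exp (real n * (s n)\<^sup>2 / 2 * vm) * \<rho> n"
        by (simp add: mult_ac)
    qed
    finally show ?thesis by (simp add: mult_ac)
  qed
  \<comment> \<open>The logarithm of the compensator divided by its limit
    \<open>exp (c * \<sigma> / 2)\<close>. It has the deterministic bound \<open>Q\<close>, so
    \<open>1 - exp (q n \<omega>)\<close> is controlled linearly by
    \<open>q n \<omega>\<close>.\<close>
  define q where "q n \<omega> = (s n)\<^sup>2 / 2 * (\<Sum>j<n. v (X j \<omega>)) - c * \<sigma> / 2" for n \<omega>
  obtain Q0 where Q0: "\<And>n. real n * (s n)\<^sup>2 \<le> Q0"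
    using convergent_imp_Bseq[OF convergentI[OF s]] by (auto simp: Bseq_def abs_le_iff)
  have c0: "0 \<le> c" by (rule LIMSEQ_le_const[OF s]) auto
  have \<sigma>0: "0 \<le> \<sigma>" unfolding \<sigma>_def using inv by (intro sum_nonneg) (auto simp: invariant_prob_def v_nonneg)
  define Q where "Q = Q0 / 2 * vm + c * \<sigma> / 2"
  have qQ: "\<bar>q n \<omega>\<bar> \<le> Q" if "\<omega> \<in> space M" for n \<omega>
  proof -
    have 1: "0 \<le> (s n)\<^sup>2 / 2 * (\<Sum>j<n. v (X j \<omega>))" by (simp add: sum_nonneg v_nonneg)
    have "(\<Sum>j<n. v (X j \<omega>)) \<le> real n * vm"
      using sum_bounded_above[of "{..<n}" "\<lambda>j. v (X j \<omega>)" vm] vm X_in_D[OF that] by simp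
    then have "(s n)\<^sup>2 / 2 * (\<Sum>j<n. v (X j \<omega>)) \<le> (s n)\<^sup>2 / 2 * (real n * vm)" by (intro mult_left_mono) auto
    also have "\<dots> = real n * (s n)\<^sup>2 / 2 * vm" by simp
    also have "\<dots> \<le> Q0 / 2 * vm" using Q0[of n] vm0 by (intro mult_right_mono) auto
    finally have 2: "(s n)\<^sup>2 / 2 * (\<Sum>j<n. v (X j \<omega>)) \<le> Q0 / 2 * vm" .
    have "0 \<le> c * \<sigma> / 2" using c0 \<sigma>0 by simp
    then show ?thesis unfolding q_def Q_def using 1 2 by linarith
  qed
  have q_meas[measurable]: "q n \<in> borel_measurable M" for n unfolding q_def by measurable
  \<comment> \<open>The first term comes from \<open>abs_expectation_le\<close> with parameter
    \<open>sqrt n\<close> and second moment at most \<open>C * n\<close>, which bounds the mean of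
    the absolute sum by \<open>(C + 1) / 2 * sqrt n\<close>; the second is the deviation of
    \<open>n * s n ^ 2\<close> from \<open>c\<close>.\<close>
  define b where "b n = (real n * (s n)\<^sup>2 / 2 * ((C + 1) / 2)) / sqrt (real n) + \<bar>real n * (s n)\<^sup>2 - c\<bar> * \<sigma> / 2" for n
  have Eq: "expectation (\<lambda>\<omega>. \<bar>q n \<omega>\<bar>) \<le> b n" if n: "n > 0" for n
  proof -
    have qe: "q n \<omega> = (s n)\<^sup>2 / 2 * (\<Sum>j<n. f (X j \<omega>)) + (real n * (s n)\<^sup>2 - c) * \<sigma> / 2" for \<omega>
      by (simp add: q_def f_def sum_subtractf field_simps)
    have m: "(\<lambda>\<omega>. \<Sum>j<n. f (X j \<omega>)) \<in> borel_measurable M" by measurable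
    have bd: "\<bar>\<Sum>j<n. f (X j \<omega>)\<bar> \<le> real n * B" if "\<omega> \<in> space M" for \<omega>
      using sum_bounded_above[of "{..<n}" "\<lambda>j. \<bar>f (X j \<omega>)\<bar>" B] B X_in_D[OF that]
      by (intro order.trans[OF sum_abs]) simp
    have i1: "integrable M (\<lambda>\<omega>. \<Sum>j<n. f (X j \<omega>))"
      using bd m by (intro integrable_const_bound[where B="real n * B"]) auto
    have "integrable M (\<lambda>\<omega>. (\<Sum>j<n. f (X j \<omega>))\<^sup>2)"
    proof (rule integrable_const_bound[where B="(real n * B)\<^sup>2"])
      show "AE \<omega> in M. norm ((\<Sum>j<n. f (X j \<omega>))\<^sup>2) \<le> (real n * B)\<^sup>2"
      proof (rule AE_I2)
        fix \<omega> assume "\<omega> \<in> space M"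
        from power_mono[OF bd[OF this], of 2] show "norm ((\<Sum>j<n. f (X j \<omega>))\<^sup>2) \<le> (real n * B)\<^sup>2" by simp
      qed
    qed (use m in measurable)
    from abs_expectation_le[OF this m C[of n], of "sqrt (real n)"]
    have e: "expectation (\<lambda>\<omega>. \<bar>\<Sum>j<n. f (X j \<omega>)\<bar>) \<le> (C * real n / sqrt (real n) + sqrt (real n)) / 2" using n by simp
    have "expectation (\<lambda>\<omega>. \<bar>q n \<omega>\<bar>) \<le> expectation (\<lambda>\<omega>. (s n)\<^sup>2 / 2 * \<bar>\<Sum>j<n. f (X j \<omega>)\<bar> + \<bar>real n * (s n)\<^sup>2 - c\<bar> * \<sigma> / 2)"
    proof (rule integral_mono)
      show "integrable M (\<lambda>\<omega>. \<bar>q n \<omega>\<bar>)"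
        using qQ by (intro integrable_const_bound[where B=Q]) auto
      show "integrable M (\<lambda>\<omega>. (s n)\<^sup>2 / 2 * \<bar>\<Sum>j<n. f (X j \<omega>)\<bar> + \<bar>real n * (s n)\<^sup>2 - c\<bar> * \<sigma> / 2)"
        using i1 by auto
      show "\<bar>q n \<omega>\<bar> \<le> (s n)\<^sup>2 / 2 * \<bar>\<Sum>j<n. f (X j \<omega>)\<bar> + \<bar>real n * (s n)\<^sup>2 - c\<bar> * \<sigma> / 2" for \<omega>
        unfolding qe using \<sigma>0 by (rule_tac order.trans[OF abs_triangle_ineq]) (simp add: abs_mult)
    qed
    also have "\<dots> = (s n)\<^sup>2 / 2 * expectation (\<lambda>\<omega>. \<bar>\<Sum>j<n. f (X j \<omega>)\<bar>) + \<bar>real n * (s n)\<^sup>2 - c\<bar> * \<sigma> / 2"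
      using i1 by (simp add: prob_space)
    also have "\<dots> \<le> (s n)\<^sup>2 / 2 * ((C * real n / sqrt (real n) + sqrt (real n)) / 2) + \<bar>real n * (s n)\<^sup>2 - c\<bar> * \<sigma> / 2"
      using e by (intro add_right_mono mult_left_mono) auto
    also have "\<dots> = b n"
    proof -
      have "sqrt (real n) = real n / sqrt (real n)" by (simp add: real_div_sqrt)
      then have "C * real n / sqrt (real n) + sqrt (real n) = (C + 1) * real n / sqrt (real n)"
        by (simp add: algebra_simps add_divide_distrib)
      then show ?thesis unfolding b_def by simp
    qed
    finally show ?thesis .
  qed
  have b: "b \<longlonglongrightarrow> 0"
  proof -
    have "b \<longlonglongrightarrow> 0 + \<bar>c - c\<bar> * \<sigma> / 2"
      unfolding b_def
    proof (intro tendsto_add)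
      show "(\<lambda>n. (real n * (s n)\<^sup>2 / 2 * ((C + 1) / 2)) / sqrt (real n)) \<longlonglongrightarrow> 0"
        by (rule real_tendsto_divide_at_top[OF tendsto_mult[OF tendsto_divide[OF s tendsto_const] tendsto_const]])
           (auto intro: filterlim_compose[OF sqrt_at_top filterlim_real_sequentially])
    qed (intro tendsto_intros s; simp)
    then show ?thesis by simp
  qed
  define \<phi> where "\<phi> n = expectation (\<lambda>\<omega>. iexp (s n * (\<Sum>j<n. Z j \<omega>)))" for n
  define w where "w = exp (- (c * \<sigma> / 2))"
  \<comment> \<open>The first term pays for the random compensator, the second for the distance of
    the compensated expectation from 1.\<close>
  have main: "cmod (\<phi> n - of_real w) \<le> exp Q * b n + exp (real n * (s n)\<^sup>2 / 2 * vm) * (real n * \<rho> n)" if n: "n > 0" for n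
  proof -
    have ii: "integrable M (\<lambda>\<omega>. iexp (s n * (\<Sum>j<n. Z j \<omega>)))"
      by (rule integrable_const_bound[where B=1]) auto
    have Gq: "of_real w * G n n \<omega> = iexp (s n * (\<Sum>j<n. Z j \<omega>)) * of_real (exp (q n \<omega>))" for \<omega>
    proof -
      have "w * exp ((s n)\<^sup>2 / 2 * (\<Sum>j<n. v (X j \<omega>))) = exp (q n \<omega>)"
        by (simp add: w_def q_def flip: exp_add)
      then have "of_real w * complex_of_real (exp ((s n)\<^sup>2 / 2 * (\<Sum>j<n. v (X j \<omega>)))) = of_real (exp (q n \<omega>))"
        by (simp only: of_real_mult[symmetric])
      then show ?thesis unfolding G_def by (simp only: mult.left_commute[of "complex_of_real w" "iexp (s n * (\<Sum>j<n. Z j \<omega>))"])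
    qed
    have "\<phi> n - of_real w * expectation (G n n) = expectation (\<lambda>\<omega>. iexp (s n * (\<Sum>j<n. Z j \<omega>)) - of_real w * G n n \<omega>)"
      unfolding \<phi>_def using ii G_int by simp
    also have "cmod \<dots> \<le> expectation (\<lambda>\<omega>. \<bar>q n \<omega>\<bar> * exp Q)"
    proof (rule order.trans[OF integral_norm_bound integral_mono])
      show "integrable M (\<lambda>\<omega>. cmod (iexp (s n * (\<Sum>j<n. Z j \<omega>)) - of_real w * G n n \<omega>))"
        using ii G_int by auto
      show "integrable M (\<lambda>\<omega>. \<bar>q n \<omega>\<bar> * exp Q)"
        using qQ by (intro integrable_mult_left integrable_const_bound[where B=Q]) auto
      fix \<omega> assume \<omega>: "\<omega> \<in> space M"
      have "cmod (iexp (s n * (\<Sum>j<n. Z j \<omega>)) - of_real w * G n n \<omega>) = cmod (iexp (s n * (\<Sum>j<n. Z j \<omega>)) * of_real (1 - exp (q n \<omega>)))"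
        unfolding Gq by (simp only: of_real_diff right_diff_distrib of_real_1 mult_1_right)
      also have "\<dots> = \<bar>1 - exp (q n \<omega>)\<bar>" by (simp only: norm_mult norm_iexp norm_of_real mult_1_left)
      also have "\<dots> \<le> \<bar>q n \<omega>\<bar> * exp Q" by (rule abs_one_minus_exp_le[OF qQ[OF \<omega>]])
      finally show "cmod (iexp (s n * (\<Sum>j<n. Z j \<omega>)) - of_real w * G n n \<omega>) \<le> \<bar>q n \<omega>\<bar> * exp Q" .
    qed
    also have "\<dots> \<le> exp Q * b n" using Eq[OF n] by simp
    finally have 1: "cmod (\<phi> n - of_real w * expectation (G n n)) \<le> exp Q * b n" .
    have "cmod (of_real w * expectation (G n n) - of_real w) = w * cmod (expectation (G n n) - 1)"
    proof -
      have "of_real w * expectation (G n n) - of_real w = of_real w * (expectation (G n n) - 1)"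
        by (simp add: right_diff_distrib)
      then show ?thesis by (simp only: norm_mult norm_of_real) (simp add: w_def)
    qed
    also have "\<dots> \<le> 1 * cmod (expectation (G n n) - 1)"
      using c0 \<sigma>0 by (intro mult_right_mono) (auto simp: w_def)
    also have "\<dots> \<le> exp (real n * (s n)\<^sup>2 / 2 * vm) * (real n * \<rho> n)" using G_diff[of n] by simp
    finally have 2: "cmod (of_real w * expectation (G n n) - of_real w) \<le> exp (real n * (s n)\<^sup>2 / 2 * vm) * (real n * \<rho> n)" .
    have "cmod (\<phi> n - of_real w) \<le> cmod (\<phi> n - of_real w * expectation (G n n)) + cmod (of_real w * expectation (G n n) - of_real w)"
      by (metis dist_norm dist_triangle)
    then show ?thesis using 1 2 by linarith
  qed
  have "(\<lambda>n. exp Q * b n + exp (real n * (s n)\<^sup>2 / 2 * vm) * (real n * \<rho> n)) \<longlonglongrightarrow> exp Q * 0 + exp (c / 2 * vm) * 0"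
    by (intro tendsto_intros s b \<rho>) auto
  then have "(\<lambda>n. exp Q * b n + exp (real n * (s n)\<^sup>2 / 2 * vm) * (real n * \<rho> n)) \<longlonglongrightarrow> 0" by simp
  then have "(\<lambda>n. \<phi> n - of_real w) \<longlonglongrightarrow> 0"
    by (rule Lim_null_comparison[rotated]) (use main in \<open>auto intro: eventually_mono[OF eventually_gt_at_top[of 0]]\<close>)
  then have "\<phi> \<longlonglongrightarrow> of_real w" by (simp add: LIM_zero_iff)
  then show ?thesis unfolding \<phi>_def w_def \<sigma>_def .
qed

end

section \<open>Robbins-Monro recursion\<close>

text \<open>A deterministic counterpart of the Robbins-Siegmund lemma. The products of
  \<open>1 + a n\<close> are bounded, hence so is \<open>w\<close>, and summing the recursion makes
  the series of \<open>g n * e n\<close> converge; as the weights \<open>g\<close> have infinite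
  sum, \<open>e\<close> cannot stay above \<open>\<epsilon>\<close>.\<close>

lemma weighted_recursion_recurrent:
  fixes w e a g :: "nat \<Rightarrow> real"
  assumes w: "\<And>n. 0 \<le> w n" and e: "\<And>n. 0 \<le> e n" and a: "\<And>n. 0 \<le> a n" "summable a"
    and g: "\<And>n. 0 \<le> g n" "\<not> summable g"
    and rec: "\<And>n. w (Suc n) \<le> (1 + a n) * w n - g n * e n"
    and \<epsilon>: "\<epsilon> > 0"
  shows "\<exists>n\<ge>m. e n < \<epsilon>"
proof (rule ccontr)
  assume "\<not> ?thesis"
  then have big: "\<And>n. n \<ge> m \<Longrightarrow> \<epsilon> \<le> e n" by (auto simp: not_less)
  define A where "A = (\<Sum>n. a n)"
  have sA: "(\<Sum>i<n. a i) \<le> A" for n unfolding A_def using a by (intro sum_le_suminf) auto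
  have "w n \<le> w 0 * exp (\<Sum>i<n. a i)" for n
  proof (induction n)
    case (Suc n)
    have "w (Suc n) \<le> (1 + a n) * w n" using rec[of n] mult_nonneg_nonneg[OF g(1)[of n] e[of n]] by linarith
    also have "\<dots> \<le> exp (a n) * (w 0 * exp (\<Sum>i<n. a i))"
      using Suc a w by (intro mult_mono exp_ge_add_one_self) auto
    finally show ?case by (simp add: exp_add mult_ac)
  qed simp
  then have wW: "w n \<le> w 0 * exp A" for n
    using w sA[of n] by (meson exp_le_cancel_iff mult_left_mono order_trans)
  have "w n + (\<Sum>i<n. g i * e i) \<le> w 0 + w 0 * exp A * (\<Sum>i<n. a i)" for n
  proof (induction n)
    case (Suc n)
    have "a n * w n \<le> a n * (w 0 * exp A)" using a wW by (intro mult_left_mono) auto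
    then show ?case using rec[of n] Suc by (simp add: algebra_simps)
  qed simp
  then have "(\<Sum>i<n. g i * e i) \<le> w 0 + w 0 * exp A * A" for n
    using w[of n] mult_left_mono[OF sA[of n], of "w 0 * exp A"] w[of 0] by (smt (verit) exp_gt_zero mult_nonneg_nonneg)
  then have "(\<Sum>i\<le>n. g i * e i) \<le> w 0 + w 0 * exp A * A" for n
    by (simp only: lessThan_Suc_atMost[symmetric])
  then have "summable (\<lambda>i. g i * e i)"
    using g e by (intro bounded_imp_summable[where B="w 0 + w 0 * exp A * A"]) auto
  moreover have "norm (\<epsilon> * g n) \<le> g n * e n" if "n \<ge> m" for n
    using mult_right_mono[OF big[OF that] g(1)[of n]] g(1)[of n] \<epsilon> by (simp add: abs_mult mult.commute)
  ultimately have "summable (\<lambda>n. \<epsilon> * g n)" by (rule summable_comparison_test')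
  then have "summable (\<lambda>n. inverse \<epsilon> * (\<epsilon> * g n))" by (rule summable_mult)
  then show False using g(2) \<epsilon> by (simp flip: mult.assoc)
qed

text \<open>Logarithmic growth against a square root: this makes remainders of harmonic size
  invisible at the scale of the central limit theorem.\<close>

lemma sum_inverse_over_sqrt:
  "(\<lambda>n. (\<Sum>k<n. 1 / (real k + 1)) / sqrt (real n)) \<longlonglongrightarrow> 0"
proof -
  obtain l where l: "(\<lambda>n. harm n - ln (real n)) \<longlonglongrightarrow> (l::real)"
    using euler_mascheroni_convergent by (auto simp: convergent_def)
  have top: "filterlim (\<lambda>n. sqrt (real n)) at_top sequentially"
    by (rule filterlim_compose[OF sqrt_at_top filterlim_real_sequentially])
  have "(\<lambda>n. (harm n - ln (real n)) / sqrt (real n)) \<longlonglongrightarrow> 0"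
    by (rule real_tendsto_divide_at_top[OF l top])
  moreover have "(\<lambda>n. ln (real n) / sqrt (real n)) \<longlonglongrightarrow> 0"
    using lim_ln_over_power[of "1/2"] by (simp add: powr_half_sqrt)
  ultimately have "(\<lambda>n. (harm n - ln (real n)) / sqrt (real n) + ln (real n) / sqrt (real n)) \<longlonglongrightarrow> 0 + 0"
    by (rule tendsto_add)
  moreover have "(harm n - ln (real n)) / sqrt (real n) + ln (real n) / sqrt (real n) = harm n / sqrt (real n)" for n
    by (simp add: diff_divide_distrib)
  moreover have "harm n = (\<Sum>k<n. 1 / (real k + 1))" for n
    by (simp add: harm_altdef inverse_eq_divide add.commute)
  ultimately show ?thesis by simp
qed

text \<open>Bounds the second-order error of a step by a telescoping difference, so that
  \<open>K2 / (n + 1)\<close> can be carried through the induction \<open>tele\<close> in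
  \<open>exists_trap\<close> as the budget still to be spent.\<close>

lemma sum_inverse_square_tail: "1 / (real n + 2)\<^sup>2 \<le> 1 / (real n + 1) - 1 / (real n + 2)"
proof -
  have "1 / (real n + 2)\<^sup>2 \<le> 1 / ((real n + 1) * (real n + 2))"
    by (rule divide_left_mono) (auto simp: power2_eq_square)
  also have "\<dots> = 1 / (real n + 1) - 1 / (real n + 2)"
    by (simp add: diff_frac_eq add_pos_nonneg)
  finally show ?thesis .
qed

text \<open>A positive variance is an affine image of the standard normal law. The value 0 is a
  genuine case, reached when the conditional variances vanish, and there the law is the point mass
  at 0.\<close>

lemma char_normal_law:
  assumes "0 \<le> v"
  shows "char (normal_law 0 v) t = of_real (exp (- (t\<^sup>2 * v / 2)))" and "real_distribution (normal_law 0 v)"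
proof -
  have "char (normal_law 0 v) t = of_real (exp (- (t\<^sup>2 * v / 2))) \<and> real_distribution (normal_law 0 v)"
  proof (cases "v = 0")
    case True
    interpret prob_space "return borel (0::real)" by (rule prob_space_return) simp
    show ?thesis
      using True by (auto simp: normal_law_def char_def integral_return real_distribution_def real_distribution_axioms_def prob_space_axioms)
  next
    case False
    then have v: "0 < sqrt v" using assms by simp
    interpret P: prob_space std_normal_distribution by (rule prob_space_normal_density) simp
    have d: "distributed std_normal_distribution lborel (\<lambda>x. x) std_normal_density"
      by (auto simp: distributed_def distr_id2)
    have d': "distributed std_normal_distribution lborel (\<lambda>x. 0 + sqrt v * x) (normal_density (0 + sqrt v * 0) (\<bar>sqrt v\<bar> * 1))"
      by (rule P.normal_density_affine[OF d]) (use v in auto)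
    then have eq: "distr std_normal_distribution lborel (\<lambda>x. sqrt v * x) = normal_law 0 v"
      using v by (simp add: distributed_def normal_law_def)
    have "char (normal_law 0 v) t = (\<integral>x. iexp (t * (sqrt v * x)) \<partial>std_normal_distribution)"
      unfolding eq[symmetric] char_def by (subst integral_distr) auto
    also have "\<dots> = char std_normal_distribution (t * sqrt v)" by (simp add: char_def mult_ac)
    also have "\<dots> = of_real (exp (- (t\<^sup>2 * v / 2)))"
      using assms by (simp add: char_std_normal_distribution power_mult_distrib)
    finally show ?thesis
      using v prob_space_normal_density[of "sqrt v" 0]
      by (simp add: normal_law_def real_distribution_def real_distribution_axioms_def)
  qed
  then show "char (normal_law 0 v) t = of_real (exp (- (t\<^sup>2 * v / 2)))" "real_distribution (normal_law 0 v)" by auto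
qed

text \<open>Slutsky's theorem at the level of characteristic functions: \<open>iexp\<close> is
  Lipschitz with constant 1 where the arguments are close, and elsewhere the difference is at most
  2.\<close>

lemma (in prob_space) norm_char_diff_le:
  fixes f g :: "'a \<Rightarrow> real"
  assumes [measurable]: "random_variable borel f" "random_variable borel g" and \<eta>: "0 \<le> \<eta>"
  shows "cmod (expectation (\<lambda>x. iexp (f x)) - expectation (\<lambda>x. iexp (g x))) \<le> \<eta> + 2 * prob {x\<in>space M. \<bar>f x - g x\<bar> > \<eta>}"
proof -
  let ?E = "{x\<in>space M. \<bar>f x - g x\<bar> > \<eta>}"
  have i: "integrable M (\<lambda>x. iexp (f x))" "integrable M (\<lambda>x. iexp (g x))"
    by (auto intro!: integrable_const_bound[where B=1])
  have "expectation (\<lambda>x. iexp (f x)) - expectation (\<lambda>x. iexp (g x)) = expectation (\<lambda>x. iexp (f x) - iexp (g x))"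
    using i by simp
  also have "cmod \<dots> \<le> expectation (\<lambda>x. \<eta> + 2 * indicator ?E x)"
  proof (rule order.trans[OF integral_norm_bound integral_mono])
    show "integrable M (\<lambda>x. cmod (iexp (f x) - iexp (g x)))" using i by auto
    show "integrable M (\<lambda>x. \<eta> + 2 * indicator ?E x)"
      by (intro Bochner_Integration.integrable_add integrable_mult_right integrable_real_indicator) (auto simp: emeasure_eq_measure)
    fix x assume x: "x \<in> space M"
    have eq: "iexp (f x) - iexp (g x) = iexp (g x) * (iexp (f x - g x) - 1)"
    proof -
      have "iexp (g x) * iexp (f x - g x) = iexp (f x)" by (simp add: algebra_simps flip: exp_add)
      then show ?thesis by (simp only: right_diff_distrib mult_1_right)
    qed
    have n: "cmod (iexp (f x) - iexp (g x)) = cmod (iexp (f x - g x) - 1)"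
      unfolding eq norm_mult by simp
    show "cmod (iexp (f x) - iexp (g x)) \<le> \<eta> + 2 * indicator ?E x"
    proof (cases "x \<in> ?E")
      case True
      then show ?thesis using norm_triangle_ineq4[of "iexp (f x)" "iexp (g x)"] \<eta> by simp
    next
      case False
      then show ?thesis using iexp_approx1[of "f x - g x" 0] x unfolding n by simp
    qed
  qed
  also have "\<dots> = \<eta> + 2 * prob ?E"
    by (subst Bochner_Integration.integral_add) (auto simp: prob_space emeasure_eq_measure Int_absorb1 Int_def intro!: arg_cong[of _ _ prob])
  finally show ?thesis .
qed

text \<open>\<open>h\<close> is the drift divided by its slope, so that \<open>h_lin\<close> has
  slope 1 in every state. Linearisation is local; away from 0 only monotonicity, sign and linear
  growth are given, and a bounded \<open>h\<close> is allowed. The denominator is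
  \<open>n + 2\<close> because \<open>U n\<close> is the error at the hitting time with index
  \<open>n + 2\<close>.\<close>

locale robbins_monro = modulated_noise +
  fixes U :: "nat \<Rightarrow> 'a \<Rightarrow> real" and h :: "real \<Rightarrow> real \<Rightarrow> real" and K C \<delta>0 :: real
  assumes U_meas: "U n \<in> borel_measurable (F n)"
    and h_meas: "d \<in> D \<Longrightarrow> h d \<in> borel_measurable borel"
    and U_rec: "\<omega> \<in> space M \<Longrightarrow> U (Suc n) \<omega> = U n \<omega> - (h (X n \<omega>) (U n \<omega>) + Z n \<omega>) / (real n + 2)"
    and h_growth: "d \<in> D \<Longrightarrow> \<bar>h d u\<bar> \<le> K * (1 + \<bar>u\<bar>)"
    and h_mono: "d \<in> D \<Longrightarrow> mono (h d)"
    and h_sign: "d \<in> D \<Longrightarrow> u \<noteq> 0 \<Longrightarrow> 0 < u * h d u"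
    and h_lin: "d \<in> D \<Longrightarrow> \<bar>u\<bar> \<le> \<delta>0 \<Longrightarrow> \<bar>h d u - u\<bar> \<le> C * u\<^sup>2"
    and C_pos: "0 < C" and \<delta>0_pos: "0 < \<delta>0"
begin

section \<open>Second moments of the error on events of the past\<close>

definition hU :: "nat \<Rightarrow> 'a \<Rightarrow> real" where "hU n \<omega> = h (X n \<omega>) (U n \<omega>)"

lemma U_M[measurable]: "U n \<in> borel_measurable M" by (rule C.measurable_F_M[OF U_meas])

lemma hU_F: "hU n \<in> borel_measurable (F n)"
  unfolding hU_def using measurable_compose[OF U_meas h_meas] by (rule C.finite_measurable_select)

lemma hU_M[measurable]: "hU n \<in> borel_measurable M" by (rule C.measurable_F_M[OF hU_F])

lemma hU_nonneg: "\<omega> \<in> space M \<Longrightarrow> 0 \<le> U n \<omega> * hU n \<omega>"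
  using h_sign[OF X_in_D, of \<omega> "U n \<omega>" n] unfolding hU_def by (cases "U n \<omega> = 0") auto

lemma hU_sq: "\<omega> \<in> space M \<Longrightarrow> (hU n \<omega>)\<^sup>2 \<le> 2 * K\<^sup>2 * (1 + (U n \<omega>)\<^sup>2)"
proof -
  assume "\<omega> \<in> space M"
  then have "\<bar>hU n \<omega>\<bar> \<le> K * (1 + \<bar>U n \<omega>\<bar>)" unfolding hU_def by (intro h_growth X_in_D)
  then have "(hU n \<omega>)\<^sup>2 \<le> (K * (1 + \<bar>U n \<omega>\<bar>))\<^sup>2" using abs_le_square_iff by fastforce
  also have "\<dots> \<le> K\<^sup>2 * (2 * (1 + (U n \<omega>)\<^sup>2))"
  proof -
    have "0 \<le> (1 - \<bar>U n \<omega>\<bar>)\<^sup>2" by simp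
    then have "(1 + \<bar>U n \<omega>\<bar>)\<^sup>2 \<le> 2 * (1 + (U n \<omega>)\<^sup>2)" by (simp add: power2_sum power2_diff)
    then show ?thesis unfolding power_mult_distrib by (rule mult_left_mono) simp
  qed
  finally show ?thesis by (simp only: mult_ac)
qed

lemma Z_sq_int: "integrable M (\<lambda>\<omega>. (Z n \<omega>)\<^sup>2)"
  using C.integrable_XV[of "\<lambda>d x. (\<zeta> d x)\<^sup>2" n, OF \<zeta>_int(2)]
  by (rule iffD1[OF integrable_cong_AE, rotated 3])
     (use Z_eq[of n] C.integrable_XV[of "\<lambda>d x. (\<zeta> d x)\<^sup>2" n, OF \<zeta>_int(2)] in auto)

lemma indicator_F: "A \<in> sets (F n) \<Longrightarrow> (indicator A :: _ \<Rightarrow> real) \<in> borel_measurable (F n)"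
  by simp

definition vm :: real where "vm = (\<Sum>d\<in>D. v d)"

lemma v_le_vm: "d \<in> D \<Longrightarrow> v d \<le> vm"
  unfolding vm_def by (rule member_le_sum) (auto simp: finD v_nonneg)

lemma vm_nonneg: "0 \<le> vm" by (simp add: vm_def sum_nonneg v_nonneg)

lemma Z_sq_on:
  assumes A: "A \<in> sets (F n)"
  shows "expectation (\<lambda>\<omega>. indicator A \<omega> * (Z n \<omega>)\<^sup>2) \<le> vm"
proof -
  note I = C.integral_mult_XV_bounded[of "\<lambda>d x. (\<zeta> d x)\<^sup>2" "indicator A" n 1, OF \<zeta>_int(2) indicator_F[OF A]]
  have [measurable]: "A \<in> sets M" using C.sets_F[OF A] .
  have I1: "integrable M (\<lambda>\<omega>. indicator A \<omega> * (\<zeta> (X n \<omega>) (V n \<omega>))\<^sup>2)" by (rule I(1)) auto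
  have "expectation (\<lambda>\<omega>. indicator A \<omega> * (Z n \<omega>)\<^sup>2) = expectation (\<lambda>\<omega>. indicator A \<omega> * (\<zeta> (X n \<omega>) (V n \<omega>))\<^sup>2)"
    by (rule integral_cong_AE) (use Z_eq[of n] I1 in auto)
  also have "\<dots> = expectation (\<lambda>\<omega>. indicator A \<omega> * v (X n \<omega>))"
    unfolding v_def by (rule I(3)) auto
  also have "\<dots> \<le> expectation (\<lambda>_. vm)"
  proof (rule integral_mono)
    show "integrable M (\<lambda>\<omega>. indicator A \<omega> * v (X n \<omega>))" unfolding v_def by (rule I(2)) auto
    show "indicator A \<omega> * v (X n \<omega>) \<le> vm" if "\<omega> \<in> space M" for \<omega>
      using v_le_vm[OF X_in_D[OF that]] vm_nonneg by (auto simp: indicator_def)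
  qed simp
  finally show ?thesis by (simp add: prob_space)
qed

text \<open>The martingale difference property of the noise. It is stated for square-integrable
  \<open>H\<close>, since \<open>one_step\<close> applies it to the unbounded error before the noise
  is added.\<close>

lemma Z_orthogonal:
  assumes H: "H \<in> borel_measurable (F n)" and sq: "integrable M (\<lambda>\<omega>. (H \<omega>)\<^sup>2)"
  shows "integrable M (\<lambda>\<omega>. H \<omega> * Z n \<omega>)" and "expectation (\<lambda>\<omega>. H \<omega> * Z n \<omega>) = 0"
proof -
  note [measurable] = C.measurable_F_M[OF H]
  show i: "integrable M (\<lambda>\<omega>. H \<omega> * Z n \<omega>)"
  proof (rule Bochner_Integration.integrable_bound)
    show "integrable M (\<lambda>\<omega>. (H \<omega>)\<^sup>2 + (Z n \<omega>)\<^sup>2)" using sq Z_sq_int by simp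
    show "AE \<omega> in M. norm (H \<omega> * Z n \<omega>) \<le> norm ((H \<omega>)\<^sup>2 + (Z n \<omega>)\<^sup>2)"
    proof (rule AE_I2)
      fix \<omega>
      have "2 * (\<bar>H \<omega>\<bar> * \<bar>Z n \<omega>\<bar>) \<le> (H \<omega>)\<^sup>2 + (Z n \<omega>)\<^sup>2"
        using sum_squares_bound[of "\<bar>H \<omega>\<bar>" "\<bar>Z n \<omega>\<bar>"] by simp
      moreover have "0 \<le> \<bar>H \<omega>\<bar> * \<bar>Z n \<omega>\<bar>" by simp
      ultimately show "norm (H \<omega> * Z n \<omega>) \<le> norm ((H \<omega>)\<^sup>2 + (Z n \<omega>)\<^sup>2)"
        unfolding real_norm_def abs_mult by linarith
    qed
  qed simp
  have m: "(\<lambda>\<omega>. \<zeta> (X n \<omega>) (V n \<omega>)) \<in> borel_measurable M"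
    using C.integrable_XV[of \<zeta> n, OF \<zeta>_int(1)] by auto
  have ae: "AE \<omega> in M. H \<omega> * Z n \<omega> = H \<omega> * \<zeta> (X n \<omega>) (V n \<omega>)" using Z_eq[of n] by auto
  have i2: "integrable M (\<lambda>\<omega>. H \<omega> * \<zeta> (X n \<omega>) (V n \<omega>))"
    by (rule iffD1[OF integrable_cong_AE i]) (use m ae in auto)
  have "expectation (\<lambda>\<omega>. H \<omega> * Z n \<omega>) = expectation (\<lambda>\<omega>. H \<omega> * \<zeta> (X n \<omega>) (V n \<omega>))"
    by (rule integral_cong_AE) (use m ae in auto)
  also have "\<dots> = expectation (\<lambda>\<omega>. H \<omega> * (\<integral>x. \<zeta> (X n \<omega>) x \<partial>\<kappa> (X n \<omega>)))"
    by (rule C.integral_mult_XV(2)[OF \<zeta>_int(1) H i2])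
  also have "\<dots> = expectation (\<lambda>\<omega>. 0)"
    by (rule Bochner_Integration.integral_cong) (auto simp: \<zeta>_mean X_in_D)
  finally show "expectation (\<lambda>\<omega>. H \<omega> * Z n \<omega>) = 0" by simp
qed

text \<open>The coefficient of the second-order term of one step: \<open>2 * K^2\<close> comes from
  squaring the growth bound of \<open>h\<close> (see \<open>hU_sq\<close>), \<open>vm\<close> from
  the conditional variance of the noise.\<close>

definition K1 :: real where "K1 = 2 * K\<^sup>2 + vm"

lemma K1_nonneg: "0 \<le> K1" by (simp add: K1_def vm_nonneg)

text \<open>The square of the recursion is expanded. The cross term with the noise vanishes because
  the rest is known at time \<open>n\<close>; the quadratic terms are at most \<open>K1\<close>
  times one plus the second moment. The restriction to an event \<open>A\<close> of the past is
  essential, as \<open>U n\<close> need not be square integrable on the whole space.\<close>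

lemma one_step:
  assumes A: "A \<in> sets (F n)" and sq: "integrable M (\<lambda>\<omega>. indicator A \<omega> * (U n \<omega>)\<^sup>2)"
  shows "integrable M (\<lambda>\<omega>. indicator A \<omega> * (U n \<omega> * hU n \<omega>))"
    and "integrable M (\<lambda>\<omega>. indicator A \<omega> * (U (Suc n) \<omega>)\<^sup>2)"
    and "expectation (\<lambda>\<omega>. indicator A \<omega> * (U (Suc n) \<omega>)\<^sup>2) \<le>
      expectation (\<lambda>\<omega>. indicator A \<omega> * (U n \<omega>)\<^sup>2)
      - 2 / (real n + 2) * expectation (\<lambda>\<omega>. indicator A \<omega> * (U n \<omega> * hU n \<omega>))
      + K1 / (real n + 2)\<^sup>2 * (1 + expectation (\<lambda>\<omega>. indicator A \<omega> * (U n \<omega>)\<^sup>2))"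
proof -
  define g where "g = 1 / (real n + 2)"
  have g0: "0 < g" by (simp add: g_def)
  have A_M[measurable]: "A \<in> sets M" using C.sets_F[OF A] .
  have iA: "integrable M (indicator A :: _ \<Rightarrow> real)" by (simp add: emeasure_eq_measure)
  have ih: "integrable M (\<lambda>\<omega>. indicator A \<omega> * (hU n \<omega>)\<^sup>2)"
  proof (rule Bochner_Integration.integrable_bound)
    show "integrable M (\<lambda>\<omega>. 2 * K\<^sup>2 * (indicator A \<omega> + indicator A \<omega> * (U n \<omega>)\<^sup>2))"
      using sq iA by (intro integrable_mult_right Bochner_Integration.integrable_add)
    show "AE \<omega> in M. norm (indicator A \<omega> * (hU n \<omega>)\<^sup>2) \<le> norm (2 * K\<^sup>2 * (indicator A \<omega> + indicator A \<omega> * (U n \<omega>)\<^sup>2))"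
    proof (rule AE_I2)
      fix \<omega> assume "\<omega> \<in> space M"
      from hU_sq[OF this, of n] show "norm (indicator A \<omega> * (hU n \<omega>)\<^sup>2) \<le> norm (2 * K\<^sup>2 * (indicator A \<omega> + indicator A \<omega> * (U n \<omega>)\<^sup>2))"
        by (cases "\<omega> \<in> A") auto
    qed
  qed simp
  show ip: "integrable M (\<lambda>\<omega>. indicator A \<omega> * (U n \<omega> * hU n \<omega>))"
  proof (rule Bochner_Integration.integrable_bound)
    show "integrable M (\<lambda>\<omega>. indicator A \<omega> * (U n \<omega>)\<^sup>2 + indicator A \<omega> * (hU n \<omega>)\<^sup>2)"
      using sq ih by (rule Bochner_Integration.integrable_add)
    show "AE \<omega> in M. norm (indicator A \<omega> * (U n \<omega> * hU n \<omega>)) \<le> norm (indicator A \<omega> * (U n \<omega>)\<^sup>2 + indicator A \<omega> * (hU n \<omega>)\<^sup>2)"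
    proof (rule AE_I2)
      fix \<omega> assume \<omega>: "\<omega> \<in> space M"
      have "2 * (U n \<omega> * hU n \<omega>) \<le> (U n \<omega>)\<^sup>2 + (hU n \<omega>)\<^sup>2"
        using sum_squares_bound[of "U n \<omega>" "hU n \<omega>"] by simp
      then have "U n \<omega> * hU n \<omega> \<le> (U n \<omega>)\<^sup>2 + (hU n \<omega>)\<^sup>2" using hU_nonneg[OF \<omega>, of n] by linarith
      then show "norm (indicator A \<omega> * (U n \<omega> * hU n \<omega>)) \<le> norm (indicator A \<omega> * (U n \<omega>)\<^sup>2 + indicator A \<omega> * (hU n \<omega>)\<^sup>2)"
        using hU_nonneg[OF \<omega>, of n] by (cases "\<omega> \<in> A") auto
    qed
  qed simp
  \<comment> \<open>The part of the next error that is known at time \<open>n\<close>, restricted to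
    \<open>A\<close>; the cross term is then \<open>H\<close> times the noise.\<close>
  define H where "H \<omega> = indicator A \<omega> * (U n \<omega> - g * hU n \<omega>)" for \<omega>
  have H_F: "H \<in> borel_measurable (F n)"
    unfolding H_def by (intro borel_measurable_times borel_measurable_diff borel_measurable_const indicator_F A U_meas hU_F)
  have H_sq: "(H \<omega>)\<^sup>2 = indicator A \<omega> * (U n \<omega>)\<^sup>2 - 2 * g * (indicator A \<omega> * (U n \<omega> * hU n \<omega>)) + g\<^sup>2 * (indicator A \<omega> * (hU n \<omega>)\<^sup>2)" for \<omega>
    by (cases "\<omega> \<in> A") (auto simp: H_def power2_eq_square algebra_simps)
  have iH: "integrable M (\<lambda>\<omega>. (H \<omega>)\<^sup>2)" unfolding H_sq using sq ip ih by simp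
  note ZH = Z_orthogonal[OF H_F iH]
  have iZ: "integrable M (\<lambda>\<omega>. indicator A \<omega> * (Z n \<omega>)\<^sup>2)"
    using integrable_mult_indicator[OF A_M Z_sq_int] by simp
  have eq: "indicator A \<omega> * (U (Suc n) \<omega>)\<^sup>2 = (H \<omega>)\<^sup>2 - 2 * g * (H \<omega> * Z n \<omega>) + g\<^sup>2 * (indicator A \<omega> * (Z n \<omega>)\<^sup>2)" if "\<omega> \<in> space M" for \<omega>
  proof -
    have "U (Suc n) \<omega> = U n \<omega> - g * hU n \<omega> - g * Z n \<omega>"
      using U_rec[OF that, of n] by (simp add: hU_def g_def add_divide_distrib)
    then have "(U (Suc n) \<omega>)\<^sup>2 = (U n \<omega> - g * hU n \<omega>)\<^sup>2 - 2 * g * ((U n \<omega> - g * hU n \<omega>) * Z n \<omega>) + g\<^sup>2 * (Z n \<omega>)\<^sup>2"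
      by (simp only: power2_diff) (simp add: power2_eq_square)
    then show ?thesis by (cases "\<omega> \<in> A") (auto simp: H_def)
  qed
  show "integrable M (\<lambda>\<omega>. indicator A \<omega> * (U (Suc n) \<omega>)\<^sup>2)"
    by (subst Bochner_Integration.integrable_cong[OF refl eq], assumption) (use iH ZH(1) iZ in simp)
  have "expectation (\<lambda>\<omega>. indicator A \<omega> * (U (Suc n) \<omega>)\<^sup>2) =
     expectation (\<lambda>\<omega>. (H \<omega>)\<^sup>2 - 2 * g * (H \<omega> * Z n \<omega>) + g\<^sup>2 * (indicator A \<omega> * (Z n \<omega>)\<^sup>2))"
    by (rule Bochner_Integration.integral_cong[OF refl eq])
  also have "\<dots> = expectation (\<lambda>\<omega>. (H \<omega>)\<^sup>2) + g\<^sup>2 * expectation (\<lambda>\<omega>. indicator A \<omega> * (Z n \<omega>)\<^sup>2)"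
    using iH ZH iZ by simp
  also have "expectation (\<lambda>\<omega>. (H \<omega>)\<^sup>2) = expectation (\<lambda>\<omega>. indicator A \<omega> * (U n \<omega>)\<^sup>2)
      - 2 * g * expectation (\<lambda>\<omega>. indicator A \<omega> * (U n \<omega> * hU n \<omega>)) + g\<^sup>2 * expectation (\<lambda>\<omega>. indicator A \<omega> * (hU n \<omega>)\<^sup>2)"
    unfolding H_sq using sq ip ih by simp
  finally have "expectation (\<lambda>\<omega>. indicator A \<omega> * (U (Suc n) \<omega>)\<^sup>2) = expectation (\<lambda>\<omega>. indicator A \<omega> * (U n \<omega>)\<^sup>2)
      - 2 * g * expectation (\<lambda>\<omega>. indicator A \<omega> * (U n \<omega> * hU n \<omega>))
      + g\<^sup>2 * (expectation (\<lambda>\<omega>. indicator A \<omega> * (hU n \<omega>)\<^sup>2) + expectation (\<lambda>\<omega>. indicator A \<omega> * (Z n \<omega>)\<^sup>2))"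
    by (simp add: distrib_left)
  moreover have "expectation (\<lambda>\<omega>. indicator A \<omega> * (hU n \<omega>)\<^sup>2) + expectation (\<lambda>\<omega>. indicator A \<omega> * (Z n \<omega>)\<^sup>2)
     \<le> K1 * (1 + expectation (\<lambda>\<omega>. indicator A \<omega> * (U n \<omega>)\<^sup>2))"
  proof -
    let ?u = "expectation (\<lambda>\<omega>. indicator A \<omega> * (U n \<omega>)\<^sup>2)"
    have "expectation (\<lambda>\<omega>. indicator A \<omega> * (hU n \<omega>)\<^sup>2) \<le> expectation (\<lambda>\<omega>. 2 * K\<^sup>2 * (1 + indicator A \<omega> * (U n \<omega>)\<^sup>2))"
    proof (rule integral_mono[OF ih])
      show "integrable M (\<lambda>\<omega>. 2 * K\<^sup>2 * (1 + indicator A \<omega> * (U n \<omega>)\<^sup>2))" using sq by simp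
      show "indicator A \<omega> * (hU n \<omega>)\<^sup>2 \<le> 2 * K\<^sup>2 * (1 + indicator A \<omega> * (U n \<omega>)\<^sup>2)" if "\<omega> \<in> space M" for \<omega>
        using hU_sq[OF that, of n] by (cases "\<omega> \<in> A") auto
    qed
    also have "\<dots> = 2 * K\<^sup>2 * (1 + ?u)" using sq by (simp add: prob_space)
    finally have 1: "expectation (\<lambda>\<omega>. indicator A \<omega> * (hU n \<omega>)\<^sup>2) \<le> 2 * K\<^sup>2 * (1 + ?u)" .
    have "0 \<le> ?u" by (intro integral_nonneg_AE) auto
    then have "vm * 1 \<le> vm * (1 + ?u)" using vm_nonneg by (intro mult_left_mono) auto
    then have "vm \<le> vm * (1 + ?u)" by simp
    then show ?thesis using 1 Z_sq_on[OF A] unfolding K1_def distrib_right[of "2 * K\<^sup>2"] by linarith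
  qed
  ultimately have "expectation (\<lambda>\<omega>. indicator A \<omega> * (U (Suc n) \<omega>)\<^sup>2) \<le> expectation (\<lambda>\<omega>. indicator A \<omega> * (U n \<omega>)\<^sup>2)
      - 2 * g * expectation (\<lambda>\<omega>. indicator A \<omega> * (U n \<omega> * hU n \<omega>))
      + g\<^sup>2 * (K1 * (1 + expectation (\<lambda>\<omega>. indicator A \<omega> * (U n \<omega>)\<^sup>2)))"
    using g0 by (simp add: mult_left_mono)
  then show "expectation (\<lambda>\<omega>. indicator A \<omega> * (U (Suc n) \<omega>)\<^sup>2) \<le>
      expectation (\<lambda>\<omega>. indicator A \<omega> * (U n \<omega>)\<^sup>2)
      - 2 / (real n + 2) * expectation (\<lambda>\<omega>. indicator A \<omega> * (U n \<omega> * hU n \<omega>))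
      + K1 / (real n + 2)\<^sup>2 * (1 + expectation (\<lambda>\<omega>. indicator A \<omega> * (U n \<omega>)\<^sup>2))"
    by (simp add: g_def power_divide mult_ac)
qed

text \<open>It suffices to bound the error at time 0 on an event of \<open>F 0\<close>:
  \<open>one_step\<close> passes integrability on this event from each time to the next.\<close>

lemma sq_integrable:
  assumes G: "G \<in> sets (F 0)" and bd: "\<And>\<omega>. \<omega> \<in> G \<Longrightarrow> \<bar>U 0 \<omega>\<bar> \<le> B"
  shows "integrable M (\<lambda>\<omega>. indicator G \<omega> * (U n \<omega>)\<^sup>2)"
proof (induction n)
  case 0
  have [measurable]: "G \<in> sets M" using C.sets_F[OF G] .
  show ?case
  proof (rule integrable_const_bound[where B="B\<^sup>2"])
    show "AE \<omega> in M. norm (indicator G \<omega> * (U 0 \<omega>)\<^sup>2) \<le> B\<^sup>2"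
      using bd by (auto intro!: AE_I2 simp: indicator_def power2_le_iff_abs_le) (metis abs_ge_zero abs_le_square_iff abs_of_nonneg order_trans)
  qed simp
next
  case (Suc n)
  show ?case by (rule one_step(2)[OF _ Suc]) (use F_le[of 0 n] G in auto)
qed

text \<open>Monotonicity reduces the bound to the values of \<open>h d\<close> at
  \<open>\<epsilon>\<close> and \<open>- \<epsilon>\<close>, which have the right sign, and
  \<open>D\<close> is finite. This is the only repulsion from large values that is available, a
  constant and not a multiple of \<open>u^2\<close>.\<close>

lemma h_lower:
  assumes "0 < \<epsilon>"
  shows "\<exists>c>0. \<forall>d\<in>D. \<forall>u. \<bar>u\<bar> \<ge> \<epsilon> \<longrightarrow> c \<le> u * h d u"
proof -
  define c where "c = Min ((\<lambda>d. \<epsilon> * min (h d \<epsilon>) (- h d (- \<epsilon>))) ` D)"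
  have pos: "0 < h d \<epsilon>" "0 < - h d (- \<epsilon>)" if "d \<in> D" for d
    using h_sign[OF that, of \<epsilon>] h_sign[OF that, of "- \<epsilon>"] assms by (auto simp: zero_less_mult_iff mult_less_0_iff)
  have "c > 0" unfolding c_def using finD D_ne pos assms by (subst Min_gr_iff) auto
  moreover have "c \<le> u * h d u" if d: "d \<in> D" and u: "\<bar>u\<bar> \<ge> \<epsilon>" for d u
  proof -
    have "c \<le> \<epsilon> * min (h d \<epsilon>) (- h d (- \<epsilon>))" unfolding c_def using finD d by (intro Min_le) auto
    also have "\<dots> \<le> \<bar>u\<bar> * \<bar>h d u\<bar>"
    proof (rule mult_mono)
      show "min (h d \<epsilon>) (- h d (- \<epsilon>)) \<le> \<bar>h d u\<bar>"
      proof (cases "u \<ge> 0")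
        case True
        then have "h d \<epsilon> \<le> h d u" using u by (intro monoD[OF h_mono[OF d]]) auto
        then show ?thesis by linarith
      next
        case False
        then have "h d u \<le> h d (- \<epsilon>)" using u by (intro monoD[OF h_mono[OF d]]) auto
        then show ?thesis by linarith
      qed
    qed (use u pos[OF d] in auto)
    also have "\<dots> = u * h d u"
    proof -
      have "u \<noteq> 0" using u assms by auto
      from h_sign[OF d this] show ?thesis by (simp flip: abs_mult)
    qed
    finally show ?thesis .
  qed
  ultimately show ?thesis by blast
qed

text \<open>\<open>one_step\<close> has the form required by
  \<open>weighted_recursion_recurrent\<close>, with summable coefficients of order 1/n^2 and
  non-summable weights of order 1/n. Hence the mean of \<open>U n * hU n\<close> on \<open>G\<close>
  is small at some late time, and \<open>h_lower\<close> turns this into a small probability.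
  Nothing is said about the following times; that is the task of \<open>exists_trap\<close>.\<close>

lemma recurrent_near_0:
  assumes G: "G \<in> sets (F 0)" and bd: "\<And>\<omega>. \<omega> \<in> G \<Longrightarrow> \<bar>U 0 \<omega>\<bar> \<le> B"
    and \<epsilon>: "0 < \<epsilon>" and \<gamma>: "0 < \<gamma>"
  shows "\<exists>m\<ge>m0. prob (G \<inter> {\<omega>\<in>space M. \<epsilon> < \<bar>U m \<omega>\<bar>}) < \<gamma>"
proof -
  note sq = sq_integrable[OF G bd]
  have Gn: "G \<in> sets (F n)" for n using F_le[of 0 n] G by auto
  have [measurable]: "G \<in> sets M" using C.sets_F[OF G] .
  obtain c where c: "c > 0" "\<And>d u. d \<in> D \<Longrightarrow> \<bar>u\<bar> \<ge> \<epsilon> \<Longrightarrow> c \<le> u * h d u" using h_lower[OF \<epsilon>] by blast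
  define e where "e n = expectation (\<lambda>\<omega>. indicator G \<omega> * (U n \<omega> * hU n \<omega>))" for n
  define w where "w n = 1 + expectation (\<lambda>\<omega>. indicator G \<omega> * (U n \<omega>)\<^sup>2)" for n
  have summ: "summable (\<lambda>n. inverse ((real n + 2)\<^sup>2))"
  proof -
    have "summable (\<lambda>n. inverse ((real (n + 2))\<^sup>2))"
      using inverse_power_summable[of 2, where 'a=real] by (subst summable_iff_shift) auto
    then show ?thesis by (simp add: add.commute)
  qed
  have nsumm: "\<not> summable (\<lambda>n. 2 / (real n + 2))"
  proof
    assume "summable (\<lambda>n. 2 / (real n + 2))"
    then have "summable (\<lambda>n. inverse 2 * (2 / (real n + 2)))" by (rule summable_mult)
    moreover have "(\<lambda>n. inverse 2 * (2 / (real n + 2))) = (\<lambda>n. inverse (real (n + 2)))"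
      by (rule ext) (simp add: inverse_eq_divide)
    ultimately have "summable (\<lambda>n. inverse (real (n + 2)))" by simp
    then have "summable (\<lambda>n. inverse (real n))"
      by (rule iffD1[OF summable_iff_shift[of "\<lambda>n. inverse (real n)" 2]])
    then show False using not_summable_harmonic[where 'a=real] by simp
  qed
  have "\<exists>n\<ge>m0. e n < c * \<gamma>"
  proof (rule weighted_recursion_recurrent)
    show "0 \<le> w n" "0 \<le> e n" for n
      unfolding w_def e_def by (auto intro!: add_nonneg_nonneg integral_nonneg_AE AE_I2 mult_nonneg_nonneg hU_nonneg)
    show "0 \<le> K1 * inverse ((real n + 2)\<^sup>2)" "0 \<le> 2 / (real n + 2)" for n using K1_nonneg by auto
    show "summable (\<lambda>n. K1 * inverse ((real n + 2)\<^sup>2))" using summ by (rule summable_mult)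
    show "\<not> summable (\<lambda>n. 2 / (real n + 2))" by (rule nsumm)
    show "w (Suc n) \<le> (1 + K1 * inverse ((real n + 2)\<^sup>2)) * w n - 2 / (real n + 2) * e n" for n
      using one_step(3)[OF Gn sq, of n] by (simp add: w_def e_def divide_inverse algebra_simps)
    show "0 < c * \<gamma>" using c \<gamma> by simp
  qed
  then obtain n where n: "n \<ge> m0" "e n < c * \<gamma>" by blast
  have "c * prob (G \<inter> {\<omega>\<in>space M. \<epsilon> < \<bar>U n \<omega>\<bar>}) = expectation (\<lambda>\<omega>. c * indicator (G \<inter> {\<omega>\<in>space M. \<epsilon> < \<bar>U n \<omega>\<bar>}) \<omega>)"
    by (simp add: Int_absorb1 Int_assoc Int_absorb2 sets.sets_into_space)
  also have "\<dots> \<le> e n"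
    unfolding e_def
  proof (rule integral_mono[OF _ one_step(1)[OF Gn sq]])
    show "integrable M (\<lambda>\<omega>. c * indicator (G \<inter> {\<omega>\<in>space M. \<epsilon> < \<bar>U n \<omega>\<bar>}) \<omega>)"
      by (intro integrable_mult_right integrable_real_indicator) (auto simp: emeasure_eq_measure)
    show "c * indicator (G \<inter> {\<omega>\<in>space M. \<epsilon> < \<bar>U n \<omega>\<bar>}) \<omega> \<le> indicator G \<omega> * (U n \<omega> * hU n \<omega>)" if "\<omega> \<in> space M" for \<omega>
      using c(2)[OF X_in_D[OF that], of "U n \<omega>" n] hU_nonneg[OF that, of n]
      by (auto simp: indicator_def hU_def)
  qed
  finally have "c * prob (G \<inter> {\<omega>\<in>space M. \<epsilon> < \<bar>U n \<omega>\<bar>}) < c * \<gamma>" using n(2) by linarith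
  then show ?thesis using c n(1) by auto
qed

end

lemma (in prob_space) tail_small:
  fixes f :: "'a \<Rightarrow> real"
  assumes [measurable]: "random_variable borel f" and \<gamma>: "0 < \<gamma>"
  shows "\<exists>K. prob {\<omega>\<in>space M. K < \<bar>f \<omega>\<bar>} < \<gamma>"
proof -
  let ?A = "\<lambda>i::nat. {\<omega>\<in>space M. real i < \<bar>f \<omega>\<bar>}"
  have "(\<lambda>i. prob (?A i)) \<longlonglongrightarrow> prob (\<Inter>i. ?A i)"
    by (rule finite_Lim_measure_decseq) (auto simp: decseq_def)
  moreover have "(\<Inter>i. ?A i) = {}"
  proof -
    have "\<omega> \<notin> (\<Inter>i. ?A i)" for \<omega>
      using real_arch_simple[of "\<bar>f \<omega>\<bar>"] by (auto simp: not_less)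
    then show ?thesis by blast
  qed
  ultimately have "(\<lambda>i. prob (?A i)) \<longlonglongrightarrow> 0" by simp
  from order_tendstoD(2)[OF this \<gamma>] show ?thesis by (auto simp: eventually_sequentially)
qed

lemma (in prob_space) tail_tendsto:
  fixes f :: "'a \<Rightarrow> real"
  assumes [measurable]: "random_variable borel f" and b: "filterlim b at_top sequentially"
  shows "(\<lambda>n. prob {\<omega>\<in>space M. b n < \<bar>f \<omega>\<bar>}) \<longlonglongrightarrow> 0"
proof (rule order_tendstoI)
  fix \<gamma> :: real assume "0 < \<gamma>"
  then obtain K where K: "prob {\<omega>\<in>space M. K < \<bar>f \<omega>\<bar>} < \<gamma>" using tail_small[OF assms(1)] by blast
  have "eventually (\<lambda>n. K \<le> b n) sequentially" using b by (simp add: filterlim_at_top)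
  then show "eventually (\<lambda>n. prob {\<omega>\<in>space M. b n < \<bar>f \<omega>\<bar>} < \<gamma>) sequentially"
  proof eventually_elim
    case (elim n)
    have "prob {\<omega>\<in>space M. b n < \<bar>f \<omega>\<bar>} \<le> prob {\<omega>\<in>space M. K < \<bar>f \<omega>\<bar>}"
      using elim by (intro finite_measure_mono) auto
    then show ?case using K by simp
  qed
qed (simp add: always_eventually less_le_trans[OF _ measure_nonneg])

section \<open>Trapping near zero and the size of the remainders\<close>

context robbins_monro
begin

text \<open>Once \<open>U\<close> is close to \<open>0\<close> at a late time, the second moment of the process stopped on leaving
  \<open>[-\<delta>, \<delta>]\<close> grows by a summable amount, so with high probability it never leaves.\<close>

lemma exists_trap:
  assumes \<delta>: "0 < \<delta>" and \<gamma>: "0 < \<gamma>"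
  shows "\<exists>m A. \<forall>n\<ge>m. A n \<in> sets (F n) \<and> A (Suc n) \<subseteq> A n \<and> (\<forall>\<omega>\<in>A n. \<bar>U n \<omega>\<bar> \<le> \<delta>) \<and> prob (space M - A n) < \<gamma>"
proof -
  \<comment> \<open>The budget \<open>\<gamma>\<close> is split into a quarter for a large initial
    error, a quarter for a failure at the late time \<open>m\<close>, and two quarters for later
    exits, of which one pays for the second moment at time \<open>m\<close> and one for all
    increments after \<open>m\<close>.\<close>
  obtain K0 where K0: "prob {\<omega>\<in>space M. K0 < \<bar>U 0 \<omega>\<bar>} < \<gamma> / 4" using tail_small[OF U_M, of "\<gamma> / 4" 0] \<gamma> by auto
  define G where "G = {\<omega>\<in>space M. \<bar>U 0 \<omega>\<bar> \<le> K0}"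
  have U_F: "k \<le> n \<Longrightarrow> U k \<in> borel_measurable (F n)" for k n by (rule measurable_F_mono[OF _ U_meas])
  have "{\<omega>\<in>space (F 0). \<bar>U 0 \<omega>\<bar> \<le> K0} \<in> sets (F 0)" using U_meas[of 0] by measurable
  then have G_F: "G \<in> sets (F 0)" by (simp only: G_def C.space_F)
  have [measurable]: "G \<in> sets M" using C.sets_F[OF G_F] .
  note sq = sq_integrable[OF G_F, of K0]
  \<comment> \<open>On the trap the second moment is at most \<open>\<delta>^2\<close>, so
    \<open>K2\<close> bounds \<open>K1 * (1 + a n)\<close>.\<close>
  define K2 where "K2 = K1 * (1 + \<delta>\<^sup>2)"
  have K2: "0 \<le> K2" using K1_nonneg by (simp add: K2_def)
  \<comment> \<open>The starting level is so small that its square costs at most a quarter of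
    \<open>\<gamma>\<close> when exits are counted with weight \<open>\<delta>^2\<close>.\<close>
  define \<epsilon> where "\<epsilon> = min \<delta> (\<delta> * sqrt (\<gamma> / 4))"
  have \<epsilon>: "0 < \<epsilon>" "\<epsilon> \<le> \<delta>" using \<delta> \<gamma> by (auto simp: \<epsilon>_def)
  have \<epsilon>2: "\<epsilon>\<^sup>2 \<le> \<delta>\<^sup>2 * (\<gamma> / 4)"
  proof -
    have "\<epsilon>\<^sup>2 \<le> (\<delta> * sqrt (\<gamma> / 4))\<^sup>2" using \<epsilon>(1) by (intro power_mono) (auto simp: \<epsilon>_def)
    then show ?thesis using \<gamma> by (simp add: power_mult_distrib)
  qed
  obtain m0 :: nat where m0: "K2 / (\<delta>\<^sup>2 * (\<gamma> / 4)) \<le> real m0" using real_arch_simple by blast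
  obtain m where m: "m \<ge> m0" "prob (G \<inter> {\<omega>\<in>space M. \<epsilon> < \<bar>U m \<omega>\<bar>}) < \<gamma> / 4"
    using recurrent_near_0[OF G_F _ \<epsilon>(1), of K0 "\<gamma> / 4" m0] \<gamma> by (auto simp: G_def)
  define A where "A n = {\<omega>\<in>space M. \<omega> \<in> G \<and> \<bar>U m \<omega>\<bar> \<le> \<epsilon> \<and> (\<forall>k\<in>{m..n}. \<bar>U k \<omega>\<bar> \<le> \<delta>)}" for n
  have A_F: "A n \<in> sets (F n)" if n: "n \<ge> m" for n
  proof -
    have [measurable]: "G \<in> sets (F n)" using F_le[of 0 n] G_F by auto
    have [measurable]: "U m \<in> borel_measurable (F n)" "\<And>k. k \<in> {m..n} \<Longrightarrow> U k \<in> borel_measurable (F n)"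
      using n U_F by auto
    have "{\<omega>\<in>space (F n). \<omega> \<in> G \<and> \<bar>U m \<omega>\<bar> \<le> \<epsilon> \<and> (\<forall>k\<in>{m..n}. \<bar>U k \<omega>\<bar> \<le> \<delta>)} \<in> sets (F n)"
      by measurable
    then show ?thesis by (simp only: A_def C.space_F)
  qed
  have A_dec: "A (Suc n) \<subseteq> A n" for n by (auto simp: A_def)
  have A_\<delta>: "\<omega> \<in> A n \<Longrightarrow> \<bar>U n \<omega>\<bar> \<le> \<delta>" if "n \<ge> m" for n \<omega> using that by (auto simp: A_def)
  have A_Suc: "\<omega> \<in> A n \<Longrightarrow> \<omega> \<notin> A (Suc n) \<Longrightarrow> \<delta> < \<bar>U (Suc n) \<omega>\<bar>" if "n \<ge> m" for n \<omega>
    using that by (auto simp: A_def le_Suc_eq)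
  have A_M: "A n \<in> sets M" if "n \<ge> m" for n using C.sets_F[OF A_F[OF that]] .
  define a where "a n = expectation (\<lambda>\<omega>. indicator (A n) \<omega> * (U n \<omega>)\<^sup>2)" for n
  have a_int: "integrable M (\<lambda>\<omega>. indicator (A n) \<omega> * (U n \<omega>)\<^sup>2)" if "n \<ge> m" for n
  proof (rule integrable_const_bound[where B="\<delta>\<^sup>2"])
    show "AE \<omega> in M. norm (indicator (A n) \<omega> * (U n \<omega>)\<^sup>2) \<le> \<delta>\<^sup>2"
    proof (rule AE_I2)
      fix \<omega>
      show "norm (indicator (A n) \<omega> * (U n \<omega>)\<^sup>2) \<le> \<delta>\<^sup>2"
        using A_\<delta>[OF that, of \<omega>] \<delta> abs_le_square_iff[of "U n \<omega>" \<delta>] by (cases "\<omega> \<in> A n") auto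
    qed
  qed (use A_M[OF that] in measurable)
  have a_le: "a n \<le> b\<^sup>2" if "n \<ge> m" "\<And>\<omega>. \<omega> \<in> A n \<Longrightarrow> \<bar>U n \<omega>\<bar> \<le> b" "0 \<le> b" for n b
  proof -
    have "a n \<le> expectation (\<lambda>\<omega>. b\<^sup>2)" unfolding a_def
    proof (rule integral_mono[OF a_int[OF that(1)]])
      fix \<omega>
      show "indicator (A n) \<omega> * (U n \<omega>)\<^sup>2 \<le> b\<^sup>2"
        using that(2)[of \<omega>] that(3) abs_le_square_iff[of "U n \<omega>" b] by (cases "\<omega> \<in> A n") auto
    qed simp
    then show ?thesis by (simp add: prob_space)
  qed
  \<comment> \<open>A path that leaves the trap at time \<open>n + 1\<close> has square larger than
    \<open>\<delta>^2\<close> there. Adding the probability of exit with this weight therefore gives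
    a lower bound for the second moment at time \<open>n + 1\<close> on the whole of
    \<open>A n\<close>, to which \<open>one_step\<close> applies.\<close>
  have one: "a (Suc n) + \<delta>\<^sup>2 * (prob (A n) - prob (A (Suc n))) \<le> a n + K2 / (real n + 2)\<^sup>2" if n: "n \<ge> m" for n
  proof -
    have AS: "A (Suc n) \<in> sets M" "A n \<in> sets M" using A_M n by auto
    have "a (Suc n) + \<delta>\<^sup>2 * (prob (A n) - prob (A (Suc n)))
      = expectation (\<lambda>\<omega>. indicator (A (Suc n)) \<omega> * (U (Suc n) \<omega>)\<^sup>2 + \<delta>\<^sup>2 * indicator (A n - A (Suc n)) \<omega>)"
    proof -
      have "prob (A n) - prob (A (Suc n)) = prob (A n - A (Suc n))"
        using finite_measure_Diff[OF AS(2,1) A_dec] by simp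
      moreover have "A n - A (Suc n) \<in> sets M" using AS by auto
      ultimately show ?thesis
        using a_int[of "Suc n"] n sets.sets_into_space[of "A n - A (Suc n)" M]
        by (subst Bochner_Integration.integral_add) (auto simp: a_def emeasure_eq_measure Int_absorb2)
    qed
    also have "\<dots> \<le> expectation (\<lambda>\<omega>. indicator (A n) \<omega> * (U (Suc n) \<omega>)\<^sup>2)"
    proof (rule integral_mono)
      show "integrable M (\<lambda>\<omega>. indicator (A (Suc n)) \<omega> * (U (Suc n) \<omega>)\<^sup>2 + \<delta>\<^sup>2 * indicator (A n - A (Suc n)) \<omega>)"
        using a_int[of "Suc n"] n AS by (auto simp: emeasure_eq_measure)
      show "integrable M (\<lambda>\<omega>. indicator (A n) \<omega> * (U (Suc n) \<omega>)\<^sup>2)"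
        by (rule one_step(2)[OF A_F[OF n] a_int[OF n]])
      fix \<omega>
      show "indicator (A (Suc n)) \<omega> * (U (Suc n) \<omega>)\<^sup>2 + \<delta>\<^sup>2 * indicator (A n - A (Suc n)) \<omega> \<le> indicator (A n) \<omega> * (U (Suc n) \<omega>)\<^sup>2"
        using A_Suc[OF n, of \<omega>] A_dec[of n] \<delta> abs_le_square_iff[of \<delta> "U (Suc n) \<omega>"]
        by (cases "\<omega> \<in> A (Suc n)"; cases "\<omega> \<in> A n") auto
    qed
    also have "\<dots> \<le> a n - 2 / (real n + 2) * expectation (\<lambda>\<omega>. indicator (A n) \<omega> * (U n \<omega> * hU n \<omega>)) + K1 / (real n + 2)\<^sup>2 * (1 + a n)"
      unfolding a_def by (rule one_step(3)[OF A_F[OF n] a_int[OF n]])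
    \<comment> \<open>Only the sign of the drift is used here; its linear size near 0 enters in
      \<open>trapped_rate\<close>.\<close>
    also have "\<dots> \<le> a n - 0 + K1 / (real n + 2)\<^sup>2 * (1 + \<delta>\<^sup>2)"
    proof (intro add_mono diff_mono mult_left_mono order.refl)
      show "0 \<le> 2 / (real n + 2) * expectation (\<lambda>\<omega>. indicator (A n) \<omega> * (U n \<omega> * hU n \<omega>))"
        by (rule mult_nonneg_nonneg[OF _ integral_nonneg_AE[OF AE_I2[OF mult_nonneg_nonneg[OF indicator_pos_le hU_nonneg]]]]) simp
      show "a n \<le> \<delta>\<^sup>2" using a_le[OF n A_\<delta>[OF n]] \<delta> by simp
    qed (use K1_nonneg in auto)
    finally show ?thesis by (simp add: K2_def)
  qed
  \<comment> \<open>The term \<open>K2 / (n + 1)\<close> dominates all increments still to come,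
    which makes the left-hand side nonincreasing in \<open>n\<close>.\<close>
  have tele: "a n + \<delta>\<^sup>2 * (prob (A m) - prob (A n)) + K2 / (real n + 1) \<le> \<epsilon>\<^sup>2 + K2 / (real m + 1)" if "n \<ge> m" for n
    using that
  proof (induction n rule: dec_induct)
    case base
    have "a m \<le> \<epsilon>\<^sup>2" using a_le[of m \<epsilon>] \<epsilon> by (auto simp: A_def)
    then show ?case by simp
  next
    case (step n)
    have "K2 * (1 / (real n + 2)\<^sup>2) \<le> K2 * (1 / (real n + 1) - 1 / (real n + 2))"
      by (intro mult_left_mono sum_inverse_square_tail K2)
    then have "K2 / (real n + 2)\<^sup>2 \<le> K2 / (real n + 1) - K2 / (real n + 2)" by (simp add: right_diff_distrib)
    moreover have "K2 / (real (Suc n) + 1) = K2 / (real n + 2)" by (simp add: add.commute)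
    moreover have "\<delta>\<^sup>2 * (prob (A m) - prob (A (Suc n))) = \<delta>\<^sup>2 * (prob (A m) - prob (A n)) + \<delta>\<^sup>2 * (prob (A n) - prob (A (Suc n)))"
      by (simp add: algebra_simps)
    ultimately show ?case using one[OF step.hyps(1)] step.IH by linarith
  qed
  have "prob (space M - A n) < \<gamma>" if n: "n \<ge> m" for n
  proof -
    have "0 \<le> a n" unfolding a_def by (intro integral_nonneg_AE) auto
    moreover have "K2 / (real m + 1) \<le> \<delta>\<^sup>2 * (\<gamma> / 4)"
    proof -
      have p: "0 < \<delta>\<^sup>2 * (\<gamma> / 4)" using \<delta> \<gamma> by simp
      have "K2 \<le> real m0 * (\<delta>\<^sup>2 * (\<gamma> / 4))" using m0 p by (simp add: pos_divide_le_eq)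
      also have "\<dots> \<le> (real m + 1) * (\<delta>\<^sup>2 * (\<gamma> / 4))" using m(1) p by (intro mult_right_mono) auto
      finally show ?thesis by (simp add: pos_divide_le_eq mult.commute)
    qed
    moreover have "0 \<le> K2 / (real n + 1)" using K2 by simp
    ultimately have "\<delta>\<^sup>2 * (prob (A m) - prob (A n)) \<le> \<delta>\<^sup>2 * (\<gamma> / 4 + \<gamma> / 4)"
      using tele[OF n] \<epsilon>2 unfolding distrib_left[of "\<delta>\<^sup>2" "\<gamma> / 4"] by linarith
    then have 1: "prob (A m) - prob (A n) \<le> \<gamma> / 2" using \<delta> by simp
    have "space M - A m \<subseteq> {\<omega>\<in>space M. K0 < \<bar>U 0 \<omega>\<bar>} \<union> (G \<inter> {\<omega>\<in>space M. \<epsilon> < \<bar>U m \<omega>\<bar>})"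
      using \<epsilon> by (auto simp: A_def G_def)
    then have "prob (space M - A m) \<le> prob {\<omega>\<in>space M. K0 < \<bar>U 0 \<omega>\<bar>} + prob (G \<inter> {\<omega>\<in>space M. \<epsilon> < \<bar>U m \<omega>\<bar>})"
      by (intro order.trans[OF finite_measure_mono measure_Un_le]) auto
    then have "1 - prob (A m) < \<gamma> / 2" using K0 m(2) prob_compl[OF A_M[of m]] by simp
    then show ?thesis using 1 prob_compl[OF A_M[OF n]] by simp
  qed
  then show ?thesis using A_F A_dec A_\<delta> by (intro exI[of _ m] exI[of _ A]) auto
qed

text \<open>Since \<open>C * \<delta>\<close> is at most 1/4, the product of \<open>u\<close> and
  the drift is at least \<open>3/4 * u^2\<close> on the trap. The second moment thus contracts by
  the factor \<open>1 - (3/2) / (n + 2)\<close> up to an error of order 1/n^2, and as 3/2 exceeds 1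
  this forces the rate 1/n.\<close>

lemma trapped_rate:
  assumes A: "\<And>n. n \<ge> m \<Longrightarrow> A n \<in> sets (F n)" "\<And>n. n \<ge> m \<Longrightarrow> A (Suc n) \<subseteq> A n"
      "\<And>n \<omega>. n \<ge> m \<Longrightarrow> \<omega> \<in> A n \<Longrightarrow> \<bar>U n \<omega>\<bar> \<le> \<delta>"
    and \<delta>: "0 < \<delta>" "\<delta> \<le> 1" "\<delta> \<le> \<delta>0" "C * \<delta> \<le> 1 / 4"
  shows "\<exists>B. \<forall>n\<ge>m. integrable M (\<lambda>\<omega>. indicator (A n) \<omega> * (U n \<omega>)\<^sup>2) \<and>
    expectation (\<lambda>\<omega>. indicator (A n) \<omega> * (U n \<omega>)\<^sup>2) \<le> B / (real n + 1)"
proof -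
  have A_M: "A n \<in> sets M" if "n \<ge> m" for n using C.sets_F[OF A(1)[OF that]] .
  have le1: "indicator (A n) \<omega> * (U n \<omega>)\<^sup>2 \<le> 1" if "n \<ge> m" for n \<omega>
  proof (cases "\<omega> \<in> A n")
    case True
    then have "\<bar>U n \<omega>\<bar> \<le> 1" using A(3)[OF that, of \<omega>] \<delta> by linarith
    then show ?thesis using abs_le_square_iff[of "U n \<omega>" 1] by (simp add: indicator_def)
  qed simp
  have int: "integrable M (\<lambda>\<omega>. indicator (A n) \<omega> * (U n \<omega>)\<^sup>2)" if "n \<ge> m" for n
    by (rule integrable_const_bound[where B=1]) (use le1[OF that] A_M[OF that] in \<open>auto intro!: AE_I2\<close>)
  define a where "a n = expectation (\<lambda>\<omega>. indicator (A n) \<omega> * (U n \<omega>)\<^sup>2)" for n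
  have a0: "0 \<le> a n" for n unfolding a_def by (intro integral_nonneg_AE) auto
  have a1: "a n \<le> 1" if "n \<ge> m" for n
  proof -
    have "a n \<le> expectation (\<lambda>\<omega>. 1)" unfolding a_def
      by (rule integral_mono[OF int[OF that] integrable_const le1[OF that]])
    then show ?thesis by (simp add: prob_space)
  qed
  have one: "a (Suc n) \<le> a n - 2 / (real n + 2) * (3 / 4 * a n) + K1 / (real n + 2)\<^sup>2 * 2" if n: "n \<ge> m" for n
  proof -
    note os = one_step[OF A(1)[OF n] int[OF n]]
    have "a (Suc n) \<le> expectation (\<lambda>\<omega>. indicator (A n) \<omega> * (U (Suc n) \<omega>)\<^sup>2)"
      unfolding a_def
    proof (rule integral_mono[OF int os(2)])
      show "indicator (A (Suc n)) \<omega> * (U (Suc n) \<omega>)\<^sup>2 \<le> indicator (A n) \<omega> * (U (Suc n) \<omega>)\<^sup>2" for \<omega>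
        using A(2)[OF n] by (auto simp: indicator_def)
    qed (use n in simp)
    also have "\<dots> \<le> a n - 2 / (real n + 2) * expectation (\<lambda>\<omega>. indicator (A n) \<omega> * (U n \<omega> * hU n \<omega>)) + K1 / (real n + 2)\<^sup>2 * (1 + a n)"
      unfolding a_def by (rule os(3))
    also have "\<dots> \<le> a n - 2 / (real n + 2) * (3 / 4 * a n) + K1 / (real n + 2)\<^sup>2 * 2"
    proof (intro add_mono diff_mono mult_left_mono order.refl)
      have "3 / 4 * a n = expectation (\<lambda>\<omega>. 3 / 4 * (indicator (A n) \<omega> * (U n \<omega>)\<^sup>2))" by (simp add: a_def)
      also have "\<dots> \<le> expectation (\<lambda>\<omega>. indicator (A n) \<omega> * (U n \<omega> * hU n \<omega>))"
      proof (rule integral_mono[OF _ os(1)])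
        show "integrable M (\<lambda>\<omega>. 3 / 4 * (indicator (A n) \<omega> * (U n \<omega>)\<^sup>2))" using int[OF n] by simp
        fix \<omega> assume \<omega>: "\<omega> \<in> space M"
        show "3 / 4 * (indicator (A n) \<omega> * (U n \<omega>)\<^sup>2) \<le> indicator (A n) \<omega> * (U n \<omega> * hU n \<omega>)"
        proof (cases "\<omega> \<in> A n")
          case True
          let ?u = "U n \<omega>"
          have u: "\<bar>?u\<bar> \<le> \<delta>" using A(3)[OF n True] .
          have "\<bar>hU n \<omega> - ?u\<bar> \<le> C * ?u\<^sup>2" unfolding hU_def using u \<delta> by (intro h_lin X_in_D \<omega>) auto
          also have "\<dots> = (C * \<bar>?u\<bar>) * \<bar>?u\<bar>" by (simp add: power2_eq_square)
          also have "\<dots> \<le> 1 / 4 * \<bar>?u\<bar>"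
          proof (rule mult_right_mono)
            have "C * \<bar>?u\<bar> \<le> C * \<delta>" using u C_pos by (intro mult_left_mono) auto
            then show "C * \<bar>?u\<bar> \<le> 1 / 4" using \<delta>(4) by linarith
          qed simp
          finally have "\<bar>?u\<bar> * \<bar>hU n \<omega> - ?u\<bar> \<le> \<bar>?u\<bar> * (1 / 4 * \<bar>?u\<bar>)" by (intro mult_left_mono) auto
          then have "\<bar>?u * (hU n \<omega> - ?u)\<bar> \<le> 1 / 4 * ?u\<^sup>2" by (simp add: abs_mult power2_eq_square)
          then have "3 / 4 * ?u\<^sup>2 \<le> ?u * hU n \<omega>" unfolding right_diff_distrib power2_eq_square by linarith
          then show ?thesis using True by simp
        qed simp
      qed
      finally show "3 / 4 * a n \<le> expectation (\<lambda>\<omega>. indicator (A n) \<omega> * (U n \<omega> * hU n \<omega>))" .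
      show "1 + a n \<le> 2" using a1[OF n] by simp
    qed (use K1_nonneg in auto)
    finally show ?thesis .
  qed
  \<comment> \<open>The summand \<open>m + 1\<close> settles the start of the induction, where the
    second moment is at most 1. The summand \<open>4 * K1\<close> makes the error
    \<open>2 * K1\<close> at most \<open>B / 2\<close>, and 1/2 is exactly the excess of the
    contraction coefficient 3/2 over 1.\<close>
  define B where "B = 4 * K1 + real m + 1"
  have B0: "0 \<le> B" using K1_nonneg by (simp add: B_def)
  have "a n \<le> B / (real n + 1)" if "n \<ge> m" for n
    using that
  proof (induction n rule: dec_induct)
    case base
    have "1 \<le> B / (real m + 1)" using K1_nonneg by (simp add: B_def le_divide_eq)
    then show ?case using a1[OF order.refl] by (rule order.trans[rotated])
  next
    case (step n)
    let ?x = "real n + 1" and ?y = "real n + 2"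
    have f: "0 \<le> 1 - 3 / (2 * ?y)" by (simp add: field_simps)
    have "a (Suc n) \<le> a n * (1 - 3 / (2 * ?y)) + 2 * K1 / ?y\<^sup>2"
    proof -
      have "a n - 2 / y * (3 / 4 * a n) = a n * (1 - 3 / (2 * y))" if "y > 0" for y :: real
        using that by (simp add: field_simps)
      from this[of ?y] have "a n - 2 / ?y * (3 / 4 * a n) = a n * (1 - 3 / (2 * ?y))" by (simp add: add_nonneg_pos)
      moreover have "K1 / ?y\<^sup>2 * 2 = 2 * K1 / ?y\<^sup>2" by simp
      ultimately show ?thesis using one[OF step.hyps(1)] by linarith
    qed
    also have "\<dots> \<le> B / ?x * (1 - 3 / (2 * ?y)) + (B / 2) / (?x * ?y)"
    proof (rule add_mono[OF mult_right_mono[OF step.IH f]])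
      have "2 * K1 / ?y\<^sup>2 \<le> (B / 2) / ?y\<^sup>2" by (rule divide_right_mono) (auto simp: B_def)
      also have "\<dots> \<le> (B / 2) / (?x * ?y)" using B0 by (intro divide_left_mono) (auto simp: power2_eq_square)
      finally show "2 * K1 / ?y\<^sup>2 \<le> (B / 2) / (?x * ?y)" .
    qed
    also have "\<dots> = B / ?y"
    proof -
      have "B / ?x * (1 - 3 / (2 * ?y)) + (B / 2) / (?x * ?y) = B / (?x * ?y) * (?y - 3 / 2 + 1 / 2)"
      proof -
        have "B / x * (1 - 3 / (2 * y)) + (B / 2) / (x * y) = B / (x * y) * (y - 3 / 2 + 1 / 2)" if "x > 0" "y > 0" for x y :: real
          using that by (simp add: field_simps)
        from this[of ?x ?y] show ?thesis by (simp only: add_nonneg_pos of_nat_0_le_iff zero_less_one zero_less_numeral)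
      qed
      also have "?y - 3 / 2 + 1 / 2 = ?x" by simp
      also have "B / (?x * ?y) * ?x = B / ?y"
      proof -
        have "?x \<noteq> 0" by linarith
        from nonzero_mult_divide_mult_cancel_left[OF this, of B ?y] show ?thesis by (simp only: times_divide_eq_left mult.commute[of B ?x])
      qed
      finally show ?thesis .
    qed
    finally show ?case by (simp add: add.commute)
  qed
  then show ?thesis using int unfolding a_def by blast
qed

definition remainder :: "nat \<Rightarrow> 'a \<Rightarrow> real" where
  "remainder n \<omega> = (\<Sum>k<n. hU k \<omega> - U k \<omega>)"

lemma remainder_borel[measurable]: "remainder n \<in> borel_measurable M"
  unfolding remainder_def by measurable

lemma linearization:
  "\<omega> \<in> space M \<Longrightarrow> (real n + 1) * U n \<omega> = U 0 \<omega> - remainder n \<omega> - (\<Sum>k<n. Z k \<omega>)"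
proof (induction n)
  case (Suc n)
  have "(real n + 2) * U (Suc n) \<omega> = (real n + 2) * U n \<omega> - (hU n \<omega> + Z n \<omega>)"
    using U_rec[OF Suc.prems, of n] by (simp add: hU_def right_diff_distrib add_nonneg_pos)
  also have "(real n + 2) * U n \<omega> = (real n + 1) * U n \<omega> + U n \<omega>" by (simp add: algebra_simps)
  finally show ?case using Suc by (simp add: remainder_def algebra_simps)
qed (simp add: remainder_def)

text \<open>The traps decrease, so on \<open>A n\<close> every time from \<open>m\<close> to
  \<open>n\<close> was spent near 0, where the remainder terms are at most \<open>C\<close> times
  the squared error. Markov's inequality compares their mean with \<open>sqrt n\<close>; the terms
  before \<open>m\<close> form a fixed random variable, for which no moment is required.\<close>

lemma remainder_negligible:
  assumes \<epsilon>: "0 < \<epsilon>"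
  shows "(\<lambda>n. prob {\<omega>\<in>space M. \<epsilon> * sqrt (real n) < \<bar>U 0 \<omega> - remainder n \<omega>\<bar>}) \<longlonglongrightarrow> 0"
proof (rule order_tendstoI)
  fix \<gamma> :: real assume "0 < \<gamma>"
  then have \<gamma>: "0 < \<gamma> / 3" by simp
  define \<delta> where "\<delta> = min 1 (min \<delta>0 (1 / (4 * C)))"
  have \<delta>: "0 < \<delta>" "\<delta> \<le> 1" "\<delta> \<le> \<delta>0" "C * \<delta> \<le> 1 / 4"
  proof -
    show "0 < \<delta>" "\<delta> \<le> 1" "\<delta> \<le> \<delta>0" using \<delta>0_pos C_pos by (auto simp: \<delta>_def)
    have "C * \<delta> \<le> C * (1 / (4 * C))" using C_pos by (intro mult_left_mono) (auto simp: \<delta>_def)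
    then show "C * \<delta> \<le> 1 / 4" using C_pos by simp
  qed
  obtain m A where mA: "\<And>n. n \<ge> m \<Longrightarrow> A n \<in> sets (F n)" "\<And>n. n \<ge> m \<Longrightarrow> A (Suc n) \<subseteq> A n"
      "\<And>n \<omega>. n \<ge> m \<Longrightarrow> \<omega> \<in> A n \<Longrightarrow> \<bar>U n \<omega>\<bar> \<le> \<delta>" "\<And>n. n \<ge> m \<Longrightarrow> prob (space M - A n) < \<gamma> / 3"
    using exists_trap[OF \<delta>(1) \<gamma>] by metis
  obtain B where B: "\<And>n. n \<ge> m \<Longrightarrow> integrable M (\<lambda>\<omega>. indicator (A n) \<omega> * (U n \<omega>)\<^sup>2)"
      "\<And>n. n \<ge> m \<Longrightarrow> expectation (\<lambda>\<omega>. indicator (A n) \<omega> * (U n \<omega>)\<^sup>2) \<le> B / (real n + 1)"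
    using trapped_rate[OF mA(1-3) \<delta>] by blast
  have B0: "0 \<le> B"
  proof -
    have "0 \<le> expectation (\<lambda>\<omega>. indicator (A m) \<omega> * (U m \<omega>)\<^sup>2)" by (intro integral_nonneg_AE) auto
    then have "0 \<le> B / (real m + 1)" using B(2)[of m] by linarith
    then show ?thesis by (simp add: zero_le_divide_iff)
  qed
  have A_M: "A n \<in> sets M" if "n \<ge> m" for n using C.sets_F[OF mA(1)[OF that]] .
  have A_anti: "A n \<subseteq> A k" if "m \<le> k" "k \<le> n" for k n
    using that(2,1) by (induction n rule: dec_induct) (auto dest: mA(2)[THEN subsetD, rotated])
  \<comment> \<open>All that is not controlled by the trap: it does not depend on \<open>n\<close>,
    so \<open>tail_tendsto\<close> disposes of it.\<close>
  define W where "W \<omega> = \<bar>U 0 \<omega>\<bar> + (\<Sum>k<m. \<bar>hU k \<omega> - U k \<omega>\<bar>)" for \<omega>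
  have W[measurable]: "W \<in> borel_measurable M" unfolding W_def by measurable
  \<comment> \<open>Each term carries the indicator of the trap at its own time and not at time
    \<open>n\<close>, so that \<open>trapped_rate\<close> applies term by term.\<close>
  define Q where "Q n \<omega> = (\<Sum>k\<in>{m..<n}. indicator (A k) \<omega> * (U k \<omega>)\<^sup>2)" for n \<omega>
  have Q_int: "integrable M (Q n)" for n
    unfolding Q_def by (intro Bochner_Integration.integrable_sum B(1)) auto
  note Q_M[measurable] = borel_measurable_integrable[OF Q_int]
  have Q_exp: "expectation (Q n) \<le> B * (\<Sum>k<n. 1 / (real k + 1))" for n
  proof -
    have "expectation (Q n) = (\<Sum>k\<in>{m..<n}. expectation (\<lambda>\<omega>. indicator (A k) \<omega> * (U k \<omega>)\<^sup>2))"
      unfolding Q_def by (rule Bochner_Integration.integral_sum) (auto intro: B(1))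
    also have "\<dots> \<le> (\<Sum>k\<in>{m..<n}. B * (1 / (real k + 1)))"
      by (intro sum_mono) (use B(2) in auto)
    also have "\<dots> \<le> (\<Sum>k<n. B * (1 / (real k + 1)))"
      using B0 by (intro sum_mono2) auto
    finally show ?thesis by (simp only: sum_distrib_left)
  qed
  have rem: "\<bar>U 0 \<omega> - remainder n \<omega>\<bar> \<le> W \<omega> + C * Q n \<omega>" if "n \<ge> m" "\<omega> \<in> A n" "\<omega> \<in> space M" for n \<omega>
  proof -
    have "\<bar>remainder n \<omega>\<bar> \<le> (\<Sum>k<n. \<bar>hU k \<omega> - U k \<omega>\<bar>)" unfolding remainder_def by (rule sum_abs)
    also have "\<dots> = (\<Sum>k<m. \<bar>hU k \<omega> - U k \<omega>\<bar>) + (\<Sum>k\<in>{m..<n}. \<bar>hU k \<omega> - U k \<omega>\<bar>)"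
      using sum.atLeastLessThan_concat[of 0 m n "\<lambda>k. \<bar>hU k \<omega> - U k \<omega>\<bar>"] that(1) by (simp add: lessThan_atLeast0)
    also have "(\<Sum>k\<in>{m..<n}. \<bar>hU k \<omega> - U k \<omega>\<bar>) \<le> (\<Sum>k\<in>{m..<n}. C * (indicator (A k) \<omega> * (U k \<omega>)\<^sup>2))"
    proof (rule sum_mono)
      fix k assume k: "k \<in> {m..<n}"
      then have "\<omega> \<in> A k" using A_anti[of k n] that by auto
      moreover from this have "\<bar>U k \<omega>\<bar> \<le> \<delta>0" using mA(3)[of k \<omega>] k \<delta> by auto
      ultimately show "\<bar>hU k \<omega> - U k \<omega>\<bar> \<le> C * (indicator (A k) \<omega> * (U k \<omega>)\<^sup>2)"
        using h_lin[OF X_in_D[OF that(3)], of "U k \<omega>" k] by (simp add: hU_def)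
    qed
    also have "\<dots> = C * Q n \<omega>" by (simp only: Q_def sum_distrib_left)
    finally show ?thesis unfolding W_def by linarith
  qed
  define q where "q n = 2 * C * B / \<epsilon> * ((\<Sum>k<n. 1 / (real k + 1)) / sqrt (real n))" for n
  have bound: "prob {\<omega>\<in>space M. \<epsilon> * sqrt (real n) < \<bar>U 0 \<omega> - remainder n \<omega>\<bar>}
      \<le> prob (space M - A n) + prob {\<omega>\<in>space M. \<epsilon> / 2 * sqrt (real n) < \<bar>W \<omega>\<bar>} + q n"
    if n: "n \<ge> m" "n > 0" for n
  proof -
    have s: "0 < sqrt (real n)" using n by simp
    let ?b = "\<epsilon> / 2 * sqrt (real n) / C"
    have b: "0 < ?b" using s \<epsilon> C_pos by simp
    have Q0: "0 \<le> Q n \<omega>" for \<omega> unfolding Q_def by (intro sum_nonneg) auto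
    have [measurable]: "A n \<in> sets M" by (rule A_M[OF n(1)])
    have "{\<omega>\<in>space M. \<epsilon> * sqrt (real n) < \<bar>U 0 \<omega> - remainder n \<omega>\<bar>} \<subseteq>
      (space M - A n) \<union> {\<omega>\<in>space M. \<epsilon> / 2 * sqrt (real n) < \<bar>W \<omega>\<bar>} \<union> {\<omega>\<in>space M. ?b \<le> Q n \<omega>}"
    proof
      fix \<omega> assume \<omega>: "\<omega> \<in> {\<omega>\<in>space M. \<epsilon> * sqrt (real n) < \<bar>U 0 \<omega> - remainder n \<omega>\<bar>}"
      show "\<omega> \<in> (space M - A n) \<union> {\<omega>\<in>space M. \<epsilon> / 2 * sqrt (real n) < \<bar>W \<omega>\<bar>} \<union> {\<omega>\<in>space M. ?b \<le> Q n \<omega>}"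
      proof (rule ccontr)
        assume c: "\<omega> \<notin> (space M - A n) \<union> {\<omega>\<in>space M. \<epsilon> / 2 * sqrt (real n) < \<bar>W \<omega>\<bar>} \<union> {\<omega>\<in>space M. ?b \<le> Q n \<omega>}"
        then have "\<omega> \<in> A n" "\<bar>W \<omega>\<bar> \<le> \<epsilon> / 2 * sqrt (real n)" "Q n \<omega> < ?b" using \<omega> by auto
        moreover from this have "C * Q n \<omega> < \<epsilon> / 2 * sqrt (real n)" using C_pos by (simp add: pos_less_divide_eq mult_ac)
        ultimately show False using rem[OF n(1), of \<omega>] \<omega> by auto
      qed
    qed
    then have "prob {\<omega>\<in>space M. \<epsilon> * sqrt (real n) < \<bar>U 0 \<omega> - remainder n \<omega>\<bar>} \<le>
      prob ((space M - A n) \<union> {\<omega>\<in>space M. \<epsilon> / 2 * sqrt (real n) < \<bar>W \<omega>\<bar>} \<union> {\<omega>\<in>space M. ?b \<le> Q n \<omega>})"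
      by (intro finite_measure_mono) auto
    also have "\<dots> \<le> prob (space M - A n) + prob {\<omega>\<in>space M. \<epsilon> / 2 * sqrt (real n) < \<bar>W \<omega>\<bar>} + prob {\<omega>\<in>space M. ?b \<le> Q n \<omega>}"
      by (intro order.trans[OF measure_Un_le] add_mono measure_Un_le order.refl) auto
    also have "prob {\<omega>\<in>space M. ?b \<le> Q n \<omega>} \<le> expectation (Q n) / ?b"
      using integral_Markov_inequality_measure[OF Q_int sets.empty_sets _ b] Q0 by (simp add: Q_int)
    also have "\<dots> \<le> B * (\<Sum>k<n. 1 / (real k + 1)) / ?b"
      using b by (intro divide_right_mono Q_exp) auto
    also have "\<dots> = q n" by (simp add: q_def mult_ac)
    finally show ?thesis by simp
  qed
  have "filterlim (\<lambda>n. \<epsilon> / 2 * sqrt (real n)) at_top sequentially"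
    using \<epsilon> by (intro filterlim_tendsto_pos_mult_at_top[OF tendsto_const]
        filterlim_compose[OF sqrt_at_top filterlim_real_sequentially]) auto
  note tW = tail_tendsto[OF W this]
  have tq: "q \<longlonglongrightarrow> 0"
    unfolding q_def by (rule tendsto_mult_right_zero[OF sum_inverse_over_sqrt])
  show "eventually (\<lambda>n. prob {\<omega>\<in>space M. \<epsilon> * sqrt (real n) < \<bar>U 0 \<omega> - remainder n \<omega>\<bar>} < \<gamma>) sequentially"
    using order_tendstoD(2)[OF tW \<gamma>] order_tendstoD(2)[OF tq \<gamma>] eventually_ge_at_top[of m] eventually_gt_at_top[of 0]
  proof eventually_elim
    case (elim n)
    then show ?case using bound[of n] mA(4)[of n] by simp
  qed
qed (simp add: always_eventually less_le_trans[OF _ measure_nonneg])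

theorem asymptotic_normality:
  "weak_conv_m (\<lambda>n. distr M borel (\<lambda>\<omega>. sqrt (real n + 2) * U n \<omega>)) (normal_law 0 (\<Sum>d\<in>D. p d * v d))"
proof (rule levy_continuity)
  define \<sigma> where "\<sigma> = (\<Sum>d\<in>D. p d * v d)"
  have \<sigma>0: "0 \<le> \<sigma>" unfolding \<sigma>_def using inv by (intro sum_nonneg) (auto simp: invariant_prob_def v_nonneg)
  show "real_distribution (distr M borel (\<lambda>\<omega>. sqrt (real n + 2) * U n \<omega>))" for n
    by (rule real_distribution_distr) simp
  show "real_distribution (normal_law 0 (\<Sum>d\<in>D. p d * v d))"
    using char_normal_law(2)[OF \<sigma>0] by (simp add: \<sigma>_def)
  fix t :: real
  \<comment> \<open>The factor between \<open>(n + 1) * U n\<close>, which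
    \<open>linearization\<close> describes, and \<open>sqrt (n + 2) * U n\<close>. Here
    \<open>n * c n ^ 2\<close> equals
    \<open>n * (n + 2) / (n + 1)^2 = 1 - 1 / (n + 1)^2\<close>.\<close>
  define c where "c n = sqrt (real n + 2) / (real n + 1)" for n
  \<comment> \<open>The sign is negative because the noise enters \<open>linearization\<close> with
    a minus sign.\<close>
  define s where "s n = - t * c n" for n
  have c2: "(\<lambda>n. real n * (c n)\<^sup>2) \<longlonglongrightarrow> 1"
  proof -
    have "(\<lambda>n. (1 - inverse (real (Suc n))) * (1 + inverse (real (Suc n)))) \<longlonglongrightarrow> (1 - 0) * (1 + 0)"
      by (intro tendsto_intros LIMSEQ_inverse_real_of_nat)
    moreover have "(1 - inverse (real (Suc n))) * (1 + inverse (real (Suc n))) = real n * (c n)\<^sup>2" for n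
    proof -
      have "1 - inverse (real (Suc n)) = real n / (real n + 1)" "1 + inverse (real (Suc n)) = (real n + 2) / (real n + 1)"
        by (simp_all add: field_simps)
      then show ?thesis by (simp add: c_def power_divide power2_eq_square)
    qed
    ultimately show ?thesis by simp
  qed
  have s2: "(\<lambda>n. real n * (s n)\<^sup>2) \<longlonglongrightarrow> t\<^sup>2"
    using tendsto_mult_left[OF c2, of "t\<^sup>2"] by (simp add: s_def power_mult_distrib mult_ac)
  define \<phi> where "\<phi> n = expectation (\<lambda>\<omega>. iexp (s n * (\<Sum>j<n. Z j \<omega>)))" for n
  have \<phi>: "\<phi> \<longlonglongrightarrow> of_real (exp (- (t\<^sup>2 * \<sigma> / 2)))"
    using noise_clt[OF s2] unfolding \<phi>_def \<sigma>_def .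
  define \<psi> where "\<psi> n = expectation (\<lambda>\<omega>. iexp (t * (sqrt (real n + 2) * U n \<omega>)))" for n
  have diff: "t * (sqrt (real n + 2) * U n \<omega>) - s n * (\<Sum>j<n. Z j \<omega>) = t * c n * (U 0 \<omega> - remainder n \<omega>)" if "\<omega> \<in> space M" for n \<omega>
  proof -
    have "sqrt (real n + 2) * U n \<omega> = c n * ((real n + 1) * U n \<omega>)"
      by (simp add: c_def add_nonneg_pos)
    also note linearization[OF that]
    finally have eq: "sqrt (real n + 2) * U n \<omega> = c n * (U 0 \<omega> - remainder n \<omega> - (\<Sum>k<n. Z k \<omega>))" .
    show ?thesis unfolding eq s_def by (simp add: algebra_simps)
  qed
  have c_le: "c n \<le> 2 / sqrt (real n)" if "n > 0" for n
  proof -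
    have "sqrt (real n + 2) \<le> sqrt (4 * real n)" using that by (intro real_sqrt_le_mono) auto
    also have "\<dots> = 2 * sqrt (real n)" by (simp add: real_sqrt_mult)
    finally have "c n \<le> 2 * sqrt (real n) / (real n + 1)" unfolding c_def by (intro divide_right_mono) auto
    also have "\<dots> \<le> 2 * sqrt (real n) / real n" using that by (intro divide_left_mono) auto
    also have "\<dots> = 2 * (sqrt (real n) / real n)" by simp
    also have "\<dots> = 2 / sqrt (real n)" by (subst sqrt_divide_self_eq) (simp_all add: divide_inverse)
    finally show ?thesis .
  qed
  have "(\<lambda>n. \<psi> n - \<phi> n) \<longlonglongrightarrow> 0"
  proof (rule LIMSEQ_I)
    fix r :: real assume r: "0 < r"
    define \<eta> where "\<eta> = r / 2"
    \<comment> \<open>Chosen from \<open>c n \<le> 2 / sqrt n\<close>; the added 1 keeps the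
      denominator positive when \<open>t = 0\<close>.\<close>
    define e where "e = \<eta> / (2 * (\<bar>t\<bar> + 1))"
    have \<eta>: "0 < \<eta>" and e: "0 < e" using r by (auto simp: \<eta>_def e_def)
    have "eventually (\<lambda>n. prob {\<omega>\<in>space M. e * sqrt (real n) < \<bar>U 0 \<omega> - remainder n \<omega>\<bar>} < \<eta> / 2) sequentially"
      by (rule order_tendstoD(2)[OF remainder_negligible[OF e]]) (use \<eta> in simp)
    then have "eventually (\<lambda>n. norm (\<psi> n - \<phi> n - 0) < r) sequentially"
      using eventually_gt_at_top[of 0]
    proof eventually_elim
      case (elim n)
      have "{\<omega>\<in>space M. \<bar>t * (sqrt (real n + 2) * U n \<omega>) - s n * (\<Sum>j<n. Z j \<omega>)\<bar> > \<eta>}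
        \<subseteq> {\<omega>\<in>space M. e * sqrt (real n) < \<bar>U 0 \<omega> - remainder n \<omega>\<bar>}"
      proof clarsimp
        fix \<omega> assume \<omega>: "\<omega> \<in> space M" and big: "\<eta> < \<bar>t * (sqrt (real n + 2) * U n \<omega>) - s n * (\<Sum>j<n. Z j \<omega>)\<bar>"
        let ?R = "\<bar>U 0 \<omega> - remainder n \<omega>\<bar>"
        have c0: "0 \<le> c n" by (simp add: c_def)
        have "\<eta> < \<bar>t\<bar> * c n * ?R" using big unfolding diff[OF \<omega>] using c0 by (simp add: abs_mult)
        also have "\<dots> \<le> (\<bar>t\<bar> + 1) * (2 / sqrt (real n)) * ?R"
          using c_le[OF elim(2)] c0 by (intro mult_right_mono mult_mono) auto
        finally have "\<eta> * sqrt (real n) < (2 * (\<bar>t\<bar> + 1)) * ?R"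
          using elim(2) by (simp add: field_simps)
        then show "e * sqrt (real n) < ?R" by (simp add: e_def pos_divide_less_eq mult.commute)
      qed
      then have "prob {\<omega>\<in>space M. \<bar>t * (sqrt (real n + 2) * U n \<omega>) - s n * (\<Sum>j<n. Z j \<omega>)\<bar> > \<eta>}
        \<le> prob {\<omega>\<in>space M. e * sqrt (real n) < \<bar>U 0 \<omega> - remainder n \<omega>\<bar>}"
        by (intro finite_measure_mono) auto
      moreover have "norm (\<psi> n - \<phi> n) \<le> \<eta> + 2 * prob {\<omega>\<in>space M. \<bar>t * (sqrt (real n + 2) * U n \<omega>) - s n * (\<Sum>j<n. Z j \<omega>)\<bar> > \<eta>}"
        unfolding \<psi>_def \<phi>_def by (rule norm_char_diff_le) (use \<eta> in auto)
      ultimately show ?case using elim(1) by (simp add: \<eta>_def)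
    qed
    then show "\<exists>no. \<forall>n\<ge>no. norm (\<psi> n - \<phi> n - 0) < r" by (simp add: eventually_sequentially)
  qed
  from tendsto_add[OF this \<phi>] have "\<psi> \<longlonglongrightarrow> of_real (exp (- (t\<^sup>2 * \<sigma> / 2)))" by simp
  moreover have "char (distr M borel (\<lambda>\<omega>. sqrt (real n + 2) * U n \<omega>)) t = \<psi> n" for n
    unfolding char_def \<psi>_def by (subst integral_distr) auto
  ultimately show "(\<lambda>n. char (distr M borel (\<lambda>\<omega>. sqrt (real n + 2) * U n \<omega>)) t) \<longlonglongrightarrow> char (normal_law 0 (\<Sum>d\<in>D. p d * v d)) t"
    using char_normal_law(1)[OF \<sigma>0, of t] by (simp add: \<sigma>_def)
qed

end

section \<open>Hitting times on path space\<close>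

lemma space_path: "space (path_space S) = paths S"
  by (auto simp: path_space_def space_restrict_space space_PiM paths_def PiE_def)

lemma pathsD:
  assumes "\<omega> \<in> paths S"
  shows "continuous_on {0..} \<omega>" and "0 \<le> t \<Longrightarrow> \<omega> t \<in> S" and "\<omega> \<in> extensional {0..}"
  using assms by (auto simp: paths_def PiE_def)

lemma coord_measurable[measurable]: "0 \<le> u \<Longrightarrow> (\<lambda>\<omega>. \<omega> u) \<in> borel_measurable (path_space S)"
  unfolding path_space_def by (intro measurable_restrict_space1 measurable_component_singleton) simp

lemma measurable_into_path_space:
  assumes "\<And>x. x \<in> space L \<Longrightarrow> f x \<in> paths S"
    and "\<And>u. 0 \<le> u \<Longrightarrow> (\<lambda>x. f x u) \<in> borel_measurable L"
  shows "f \<in> measurable L (path_space S)"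
  unfolding path_space_def
proof (rule measurable_restrict_space2)
  show "f \<in> space L \<rightarrow> paths S" using assms(1) by auto
  show "f \<in> measurable L (PiM {0..} (\<lambda>_. borel))"
    by (rule measurable_PiM_single') (use assms in \<open>auto simp: paths_def\<close>)
qed

lemma space_natF: "space (natF S t) = paths S"
  by (simp add: natF_def space_measure_of_conv space_path)

lemma sets_natF: "sets (natF S t) = sigma_sets (paths S)
     {{\<omega> \<in> paths S. \<omega> u \<in> B} | u B. u \<in> {0..t} \<and> B \<in> sets (borel :: real measure)}"
  unfolding natF_def space_path by (rule sets_measure_of) auto

lemma natF_mono: "s \<le> t \<Longrightarrow> sets (natF S s) \<subseteq> sets (natF S t)"
  unfolding sets_natF by (rule sigma_sets_mono') (force intro: order.trans)

lemma coord_natF: "0 \<le> u \<Longrightarrow> u \<le> t \<Longrightarrow> (\<lambda>\<omega>. \<omega> u) \<in> borel_measurable (natF S t)"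
proof (rule measurableI)
  fix B :: "real set" assume "0 \<le> u" "u \<le> t" "B \<in> sets borel"
  then have "{\<omega> \<in> paths S. \<omega> u \<in> B} \<in> sets (natF S t)"
    unfolding sets_natF by (intro sigma_sets.Basic) auto
  then show "(\<lambda>\<omega>. \<omega> u) -` B \<inter> space (natF S t) \<in> sets (natF S t)"
    by (simp add: space_natF vimage_def Int_def conj_commute)
qed simp

section \<open>Stopped paths and the structure of hitting times\<close>

definition stop_path :: "real \<Rightarrow> (real \<Rightarrow> real) \<Rightarrow> real \<Rightarrow> real" where
  "stop_path t \<omega> = (\<lambda>u\<in>{0..}. \<omega> (min u t))"

lemma stop_path_in: "0 \<le> t \<Longrightarrow> \<omega> \<in> paths S \<Longrightarrow> stop_path t \<omega> \<in> paths S"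
proof -
  assume t: "0 \<le> t" and \<omega>: "\<omega> \<in> paths S"
  have "continuous_on {0..} (\<lambda>u. \<omega> (min u t))"
    by (rule continuous_on_compose2[OF pathsD(1)[OF \<omega>]]) (use t in \<open>auto intro!: continuous_intros\<close>)
  then have "continuous_on {0..} (stop_path t \<omega>)"
    by (rule continuous_on_eq) (simp add: stop_path_def)
  then show ?thesis using t pathsD(2)[OF \<omega>] by (auto simp: paths_def stop_path_def)
qed

lemma stop_path_measurable: "0 \<le> t \<Longrightarrow> stop_path t \<in> measurable (natF S t) (path_space S)"
  by (rule measurable_into_path_space, simp add: space_natF stop_path_in, simp add: stop_path_def coord_natF)

text \<open>The useful half of Galmarini's test.\<close>

lemma stop_invariant_in_natF:
  assumes t: "0 \<le> t" and A: "A \<in> sets (path_space S)"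
    and inv: "\<And>\<omega>. \<omega> \<in> paths S \<Longrightarrow> stop_path t \<omega> \<in> A \<longleftrightarrow> \<omega> \<in> A"
  shows "A \<in> sets (natF S t)"
proof -
  have "A = stop_path t -` A \<inter> space (natF S t)"
    using inv sets.sets_into_space[OF A] by (auto simp: space_natF space_path)
  then show ?thesis using measurable_sets[OF stop_path_measurable[OF t] A] by simp
qed

text \<open>A finite set is closed and paths are continuous, so the infimum in
  \<open>hit_from\<close> is attained. Later proofs argue with this case distinction instead of
  infima.\<close>

lemma hit_from_cases:
  assumes \<omega>: "\<omega> \<in> paths S" and A: "finite A" and s: "0 \<le> s"
  obtains (finite) r where "hit_from A (ereal s) \<omega> = ereal r" "s \<le> r" "\<omega> r \<in> A" "\<And>u. s \<le> u \<Longrightarrow> u < r \<Longrightarrow> \<omega> u \<notin> A"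
  | (infinite) "hit_from A (ereal s) \<omega> = \<infinity>" "\<And>u. s \<le> u \<Longrightarrow> \<omega> u \<notin> A"
proof (cases "\<exists>u\<ge>s. \<omega> u \<in> A")
  case True
  let ?H = "{t. ereal t \<ge> ereal s \<and> 0 \<le> t \<and> \<omega> t \<in> A}"
  have ex: "\<exists>t. ereal t \<ge> ereal s \<and> 0 \<le> t \<and> \<omega> t \<in> A"
  proof -
    from True obtain u where "s \<le> u" "\<omega> u \<in> A" by blast
    then show ?thesis using s by (intro exI[of _ u]) auto
  qed
  have H: "?H = {t\<in>{s..}. \<omega> t \<in> A}" using s by auto
  have eq: "hit_from A (ereal s) \<omega> = ereal (Inf ?H)"
    using ex by (simp add: hit_from_def)
  have "continuous_on {s..} \<omega>" using pathsD(1)[OF \<omega>] by (rule continuous_on_subset) (use s in auto)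
  then have "closed ({s..} \<inter> \<omega> -` A)"
    using A by (intro continuous_closed_preimage) (auto intro: finite_imp_closed)
  moreover have "{s..} \<inter> \<omega> -` A = ?H" using H by auto
  ultimately have cl: "closed ?H" by simp
  have bb: "bdd_below ?H" by (rule bdd_belowI[of _ s]) auto
  have ne: "?H \<noteq> {}" using ex by auto
  have "Inf ?H \<in> ?H" by (rule closed_contains_Inf[OF ne bb cl])
  moreover have "\<omega> u \<notin> A" if "s \<le> u" "u < Inf ?H" for u
    using that s cInf_lower[OF _ bb, of u] by auto
  ultimately show ?thesis using eq by (intro finite) auto
next
  case False
  then have "hit_from A (ereal s) \<omega> = \<infinity>" by (auto simp: hit_from_def)
  then show ?thesis using False by (intro infinite) auto
qed

lemma hit_from_eq_iff:
  assumes "\<omega> \<in> paths S" "finite A" "0 \<le> s"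
  shows "hit_from A (ereal s) \<omega> = ereal r \<longleftrightarrow> s \<le> r \<and> \<omega> r \<in> A \<and> (\<forall>u. s \<le> u \<and> u < r \<longrightarrow> \<omega> u \<notin> A)"
proof (cases rule: hit_from_cases[OF assms, case_names finite infinite])
  case (finite q)
  have "q = r" if "s \<le> r \<and> \<omega> r \<in> A \<and> (\<forall>u. s \<le> u \<and> u < r \<longrightarrow> \<omega> u \<notin> A)"
    using finite(2,3) finite(4)[of r] that by (metis linorder_neqE_linordered_idom)
  note eq = this
  show ?thesis
  proof
    assume "hit_from A (ereal s) \<omega> = ereal r"
    then have "q = r" using finite(1) by simp
    then show "s \<le> r \<and> \<omega> r \<in> A \<and> (\<forall>u. s \<le> u \<and> u < r \<longrightarrow> \<omega> u \<notin> A)" using finite(2-4) by blast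
  next
    assume "s \<le> r \<and> \<omega> r \<in> A \<and> (\<forall>u. s \<le> u \<and> u < r \<longrightarrow> \<omega> u \<notin> A)"
    from eq[OF this] show "hit_from A (ereal s) \<omega> = ereal r" using finite(1) by simp
  qed
next
  case infinite
  then show ?thesis by auto
qed

lemma hit_from_eq_PInfty_iff:
  assumes "\<omega> \<in> paths S" "finite A" "0 \<le> s"
  shows "hit_from A (ereal s) \<omega> = \<infinity> \<longleftrightarrow> (\<forall>u\<ge>s. \<omega> u \<notin> A)"
  by (cases rule: hit_from_cases[OF assms, case_names finite infinite]) auto

lemma hit_from_le_iff:
  assumes "\<omega> \<in> paths S" "finite A"
  shows "hit_from A 0 \<omega> \<le> ereal t \<longleftrightarrow> (\<exists>u\<in>{0..t}. \<omega> u \<in> A)"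
proof -
  have z: "hit_from A 0 \<omega> = hit_from A (ereal 0) \<omega>" by (simp add: zero_ereal_def)
  show ?thesis
  proof (cases rule: hit_from_cases[OF assms order.refl, case_names finite infinite])
    case (finite r)
    have "r \<le> t \<longleftrightarrow> (\<exists>u\<in>{0..t}. \<omega> u \<in> A)"
    proof
      assume "r \<le> t" then show "\<exists>u\<in>{0..t}. \<omega> u \<in> A" using finite(2,3) by (intro bexI[of _ r]) auto
    next
      assume "\<exists>u\<in>{0..t}. \<omega> u \<in> A"
      then obtain u where u: "0 \<le> u" "u \<le> t" "\<omega> u \<in> A" by auto
      then have "\<not> u < r" using finite(4)[of u] by blast
      then show "r \<le> t" using u by linarith
    qed
    then show ?thesis unfolding z using finite(1) by simp
  next
    case infinite
    then show ?thesis unfolding z by auto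
  qed
qed

lemma hit_from_PInfty: "hit_from A \<infinity> \<omega> = \<infinity>" by (simp add: hit_from_def)

lemma shifted_path_in: "0 \<le> s \<Longrightarrow> \<omega> \<in> paths S \<Longrightarrow> (\<lambda>t\<in>{0..}. \<omega> (s + t)) \<in> paths S"
proof -
  assume s: "0 \<le> s" and \<omega>: "\<omega> \<in> paths S"
  have "continuous_on {0..} (\<lambda>u. \<omega> (s + u))"
    by (rule continuous_on_compose2[OF pathsD(1)[OF \<omega>]]) (use s in \<open>auto intro!: continuous_intros\<close>)
  then have "continuous_on {0..} (\<lambda>t\<in>{0..}. \<omega> (s + t))" by (rule continuous_on_eq) simp
  then show ?thesis using s pathsD(2)[OF \<omega>] by (auto simp: paths_def)
qed

lemma hit_from_shifted:
  assumes \<omega>: "\<omega> \<in> paths S" and A: "finite A" and s: "0 \<le> s"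
  shows "hit_from A (ereal s) \<omega> = ereal s + hit_from A 0 (\<lambda>t\<in>{0..}. \<omega> (s + t))"
proof -
  let ?\<omega> = "\<lambda>t\<in>{0..}. \<omega> (s + t)"
  have z: "hit_from A 0 ?\<omega> = hit_from A (ereal 0) ?\<omega>" by (simp add: zero_ereal_def)
  note sh = shifted_path_in[OF s \<omega>]
  show ?thesis
  proof (cases rule: hit_from_cases[OF assms, case_names finite infinite])
    case (finite r)
    have "hit_from A (ereal 0) ?\<omega> = ereal (r - s)"
      unfolding hit_from_eq_iff[OF sh A order.refl] using finite by auto
    then show ?thesis unfolding z using finite(1) by simp
  next
    case infinite
    have "hit_from A (ereal 0) ?\<omega> = \<infinity>"
      unfolding hit_from_eq_PInfty_iff[OF sh A order.refl] using infinite by auto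
    then show ?thesis unfolding z using infinite(1) by simp
  qed
qed

lemma hit_times_cases:
  assumes \<omega>: "\<omega> \<in> paths S" and D: "finite D"
  obtains (finite) r where "hit_times D (Suc n) \<omega> = ereal r" "0 \<le> r" "\<omega> r \<in> D"
  | (infinite) "hit_times D (Suc n) \<omega> = \<infinity>"
proof -
  have "hit_times D (Suc n) \<omega> = \<infinity> \<or> (\<exists>r\<ge>0. hit_times D (Suc n) \<omega> = ereal r \<and> \<omega> r \<in> D)"
  proof (induction n)
    case 0
    have z: "hit_from D 0 \<omega> = hit_from D (ereal 0) \<omega>" by (simp add: zero_ereal_def)
    show ?case by (cases rule: hit_from_cases[OF \<omega> D order.refl, case_names finite infinite]) (auto simp: z)
  next
    case (Suc n)
    from Suc.IH show ?case
    proof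
      assume "hit_times D (Suc n) \<omega> = \<infinity>"
      then show ?thesis by (simp add: hit_from_PInfty)
    next
      assume "\<exists>r\<ge>0. hit_times D (Suc n) \<omega> = ereal r \<and> \<omega> r \<in> D"
      then obtain r where r: "r \<ge> 0" "hit_times D (Suc n) \<omega> = ereal r" by blast
      have f: "finite (D - {Xat (hit_times D (Suc n)) \<omega>})" using D by simp
      show ?thesis
        by (cases rule: hit_from_cases[OF \<omega> f r(1), case_names finite infinite]) (use r in auto)
    qed
  qed
  then show ?thesis using that by blast
qed

lemma hit_times_nonneg:
  assumes "\<omega> \<in> paths S" "finite D"
  shows "0 \<le> hit_times D n \<omega>"
proof (cases n)
  case (Suc k)
  show ?thesis unfolding Suc
    by (cases rule: hit_times_cases[OF assms, of k]) (simp_all del: hit_times.simps)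
qed simp

lemma hit_times_mono:
  assumes \<omega>: "\<omega> \<in> paths S" and D: "finite D"
  shows "hit_times D n \<omega> \<le> hit_times D (Suc n) \<omega>"
proof (cases n)
  case 0 then show ?thesis using hit_times_nonneg[OF assms, of "Suc 0"] by simp
next
  case (Suc k)
  have f: "finite (D - {Xat (hit_times D (Suc k)) \<omega>})" using D by simp
  show ?thesis
  proof (cases rule: hit_times_cases[OF assms, of k, case_names finite infinite])
    case (finite r)
    show ?thesis by (cases rule: hit_from_cases[OF \<omega> f finite(2), case_names finite infinite]) (use finite(1) Suc in auto)
  next
    case infinite
    then show ?thesis using Suc by (simp add: hit_from_PInfty)
  qed
qed

text \<open>A hitting time that has occurred by time \<open>t\<close> is determined, together with
  its state, by the path up to \<open>t\<close>. Combined with stopping the path at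
  \<open>t\<close>, this makes the hitting times stopping times of the natural filtration.\<close>

lemma hit_times_agree:
  assumes \<omega>: "\<omega> \<in> paths S" and \<omega>': "\<omega>' \<in> paths S" and D: "finite D"
    and agree: "\<And>u. 0 \<le> u \<Longrightarrow> u \<le> t \<Longrightarrow> \<omega>' u = \<omega> u"
    and le: "hit_times D (Suc n) \<omega> \<le> ereal t"
  shows "hit_times D (Suc n) \<omega>' = hit_times D (Suc n) \<omega> \<and> Xat (hit_times D (Suc n)) \<omega>' = Xat (hit_times D (Suc n)) \<omega>"
  using le
proof (induction n)
  case 0
  have z: "hit_times D (Suc 0) w = hit_from D (ereal 0) w" for w by (simp add: zero_ereal_def)
  show ?case
  proof (cases rule: hit_from_cases[OF \<omega> D order.refl, case_names finite infinite])
    case (finite r)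
    then have "r \<le> t" using 0 unfolding z by simp
    then have "hit_from D (ereal 0) \<omega>' = ereal r"
      unfolding hit_from_eq_iff[OF \<omega>' D order.refl] using finite agree by auto
    then show ?thesis using finite agree[of r] \<open>r \<le> t\<close> by (simp add: Xat_def z del: hit_times.simps)
  qed (use 0 in \<open>auto simp: z simp del: hit_times.simps\<close>)
next
  case (Suc n)
  have le: "hit_times D (Suc n) \<omega> \<le> ereal t" using hit_times_mono[OF \<omega> D, of "Suc n"] Suc.prems by (rule order.trans)
  note IH = Suc.IH[OF le]
  let ?A = "D - {Xat (hit_times D (Suc n)) \<omega>}"
  have f: "finite ?A" using D by simp
  obtain s where s: "hit_times D (Suc n) \<omega> = ereal s" "0 \<le> s"
    using le by (cases rule: hit_times_cases[OF \<omega> D, of n, case_names finite infinite]) auto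
  have e: "hit_times D (Suc (Suc n)) \<omega> = hit_from ?A (ereal s) \<omega>" "hit_times D (Suc (Suc n)) \<omega>' = hit_from ?A (ereal s) \<omega>'"
    using s IH by auto
  show ?case
  proof (cases rule: hit_from_cases[OF \<omega> f s(2), case_names finite infinite])
    case (finite r)
    then have "r \<le> t" using Suc.prems unfolding e by simp
    then have "hit_from ?A (ereal s) \<omega>' = ereal r"
      unfolding hit_from_eq_iff[OF \<omega>' f s(2)] using finite agree s by auto
    then show ?thesis using finite agree[of r] \<open>r \<le> t\<close> s(2) by (simp add: Xat_def e del: hit_times.simps)
  qed (use Suc.prems in \<open>auto simp: e simp del: hit_times.simps\<close>)
qed

text \<open>By continuity and compactness, \<open>A\<close> is hit by time \<open>t\<close> exactly
  when the distance to \<open>A\<close> has infimum 0 over the times up to \<open>t\<close>, and a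
  countable dense set of times suffices to detect this.\<close>

lemma hit_from_measurable:
  assumes A: "finite A"
  shows "hit_from A 0 \<in> borel_measurable (path_space S)"
proof (rule borel_measurableI_le)
  fix y :: ereal
  have nn: "0 \<le> hit_from A 0 \<omega>" if "\<omega> \<in> paths S" for \<omega>
    using hit_from_cases[OF that A order.refl] by (metis ereal_less_eq(1) ereal_less_eq(3) zero_ereal_def)
  show "{\<omega> \<in> space (path_space S). hit_from A 0 \<omega> \<le> y} \<in> sets (path_space S)"
  proof (cases y)
    case PInf then show ?thesis by simp
  next
    case MInf
    then have "{\<omega> \<in> space (path_space S). hit_from A 0 \<omega> \<le> y} = {}" using nn by (auto simp: space_path)
    then show ?thesis by (simp only: sets.empty_sets)
  next
    case (real t)
    \<comment> \<open>The empty set is treated apart because \<open>infdist\<close> to it is 0 by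
      convention, which would make the distance criterion hold for every path.\<close>
    show ?thesis
    proof (cases "t \<ge> 0 \<and> A \<noteq> {}")
      case False
      then have "{\<omega> \<in> space (path_space S). hit_from A 0 \<omega> \<le> y} = {}"
        using hit_from_le_iff[OF _ A, of _ S t] by (auto simp: space_path real)
      then show ?thesis by (simp only: sets.empty_sets)
    next
      case True
      \<comment> \<open>Rationals of the unit interval are rescaled by \<open>t\<close>, so that the
        endpoint \<open>t\<close> belongs to \<open>Q\<close> even when it is irrational; a path may
        hit \<open>A\<close> only there.\<close>
      define Q where "Q = (\<lambda>q. t * q) ` (\<rat> \<inter> {0..1})"
      have Qc: "countable Q" unfolding Q_def by (intro countable_image countable_Int1 countable_rat)
      have Q0: "q \<in> Q \<Longrightarrow> 0 \<le> q \<and> q \<le> t" for q using True by (auto simp: Q_def mult_left_le)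
      have iff: "(\<exists>u\<in>{0..t}. \<omega> u \<in> A) \<longleftrightarrow> (\<forall>k::nat. \<exists>q\<in>Q. infdist (\<omega> q) A < 1 / real (Suc k))"
        if \<omega>: "\<omega> \<in> paths S" for \<omega>
      proof -
        define f where "f u = infdist (\<omega> u) A" for u
        have cont: "continuous_on {0..t} f" unfolding f_def
          by (intro continuous_on_infdist continuous_on_subset[OF pathsD(1)[OF \<omega>]]) auto
        have f0: "f u = 0 \<longleftrightarrow> \<omega> u \<in> A" for u unfolding f_def
          using in_closed_iff_infdist_zero[OF finite_imp_closed[OF A]] True by auto
        have "\<exists>q\<in>Q. f q < 1 / real (Suc k)" if u: "u \<in> {0..t}" "\<omega> u \<in> A" for u k
        proof (cases "t = 0")
          case True
          then have "0 \<in> Q" "u = 0" using u by (auto simp: Q_def image_iff intro!: bexI[of _ 0])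
          then show ?thesis using f0[of u] u by (intro bexI[of _ 0]) auto
        next
          case False
          then have t: "t > 0" using u by auto
          define g where "g q = f (t * q)" for q
          have gc: "continuous_on {0..1} g" unfolding g_def
            by (rule continuous_on_compose2[OF cont]) (use t in \<open>auto intro!: continuous_intros simp: mult_left_le\<close>)
          have x: "u / t \<in> {0..1}" "g (u / t) = 0" using u t f0[of u] by (auto simp: g_def)
          from gc x(1) have "\<forall>e>0. \<exists>d>0. \<forall>x'\<in>{0..1}. dist x' (u / t) < d \<longrightarrow> dist (g x') (g (u / t)) < e"
            unfolding continuous_on_iff by blast
          then obtain d where d: "d > 0" "\<And>x'. x' \<in> {0..1} \<Longrightarrow> dist x' (u / t) < d \<Longrightarrow> dist (g x') (g (u / t)) < 1 / real (Suc k)"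
            by (metis of_nat_0_less_iff zero_less_Suc zero_less_divide_1_iff)
          let ?x = "u / t"
          have "\<exists>q\<in>\<rat>. q \<in> {0..1} \<and> dist q ?x < d"
          proof (cases "?x < 1")
            case True
            obtain q where q: "q \<in> \<rat>" "?x < q" "q < min 1 (?x + d)"
              using Rats_dense_in_real[of ?x "min 1 (?x + d)"] True d(1) by auto
            then show ?thesis using x(1) by (intro bexI[of _ q]) (auto simp: dist_real_def)
          next
            case False
            then have "?x = 1" using x(1) by auto
            then show ?thesis using d(1) by (intro bexI[of _ 1]) auto
          qed
          then obtain q where q: "q \<in> \<rat>" "q \<in> {0..1}" "dist q ?x < d" by blast
          have "g q < 1 / real (Suc k)" using d(2)[OF q(2,3)] x(2) by (simp add: dist_real_def)
          then show ?thesis using q by (intro bexI[of _ "t * q"]) (auto simp: g_def Q_def)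
        qed
        \<comment> \<open>The distance attains its minimum on the compact time interval, and values
          below every \<open>1 / (k + 1)\<close> force this minimum to be 0.\<close>
        moreover have "\<exists>u\<in>{0..t}. \<omega> u \<in> A" if all: "\<forall>k::nat. \<exists>q\<in>Q. f q < 1 / real (Suc k)"
        proof -
          obtain u where u: "u \<in> {0..t}" "\<And>w. w \<in> {0..t} \<Longrightarrow> f u \<le> f w"
            using continuous_attains_inf[OF compact_Icc _ cont] True by (metis atLeastatMost_empty_iff)
          have "f u \<le> 0"
          proof (rule ccontr)
            assume "\<not> f u \<le> 0"
            then obtain k where k: "1 / real (Suc k) < f u"
              using reals_Archimedean[of "f u"] by (auto simp: inverse_eq_divide)
            obtain q where "q \<in> Q" "f q < 1 / real (Suc k)" using all by blast
            then show False using u(2)[of q] Q0[of q] k by auto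
          qed
          moreover have "0 \<le> f u" by (simp add: f_def infdist_nonneg)
          ultimately show ?thesis using u(1) f0[of u] by auto
        qed
        ultimately show ?thesis unfolding f_def by blast
      qed
      have "{\<omega> \<in> space (path_space S). hit_from A 0 \<omega> \<le> y} =
         {\<omega> \<in> space (path_space S). \<forall>k::nat. \<exists>q\<in>Q. infdist (\<omega> q) A < 1 / real (Suc k)}"
        using iff hit_from_le_iff[OF _ A, of _ S t] by (auto simp: real space_path)
      also have "\<dots> \<in> sets (path_space S)"
      proof -
        have [measurable]: "(\<lambda>\<omega>. infdist (\<omega> q) A) \<in> borel_measurable (path_space S)" if "q \<in> Q" for q
        proof -
          have "(\<lambda>x. infdist x A) \<in> borel_measurable borel"
            by (intro borel_measurable_continuous_onI continuous_intros)
          then show ?thesis using coord_measurable[of q S] Q0[OF that] by (auto intro: measurable_compose)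
        qed
        show ?thesis by (intro sets.sets_Collect_countable_All sets.sets_Collect_countable_Ex' Qc) measurable
      qed
      finally show ?thesis .
    qed
  qed
qed

text \<open>The random time is rounded down to multiples of \<open>1 / (k + 1)\<close>. It then
  takes countably many values, so the evaluation is measurable, and path continuity gives the
  limit.\<close>

lemma eval_measurable:
  assumes [measurable]: "g \<in> borel_measurable (path_space S)" and g0: "\<And>\<omega>. \<omega> \<in> paths S \<Longrightarrow> 0 \<le> g \<omega>"
  shows "(\<lambda>\<omega>. \<omega> (g \<omega>)) \<in> borel_measurable (path_space S)"
proof (rule borel_measurable_LIMSEQ_real)
  let ?a = "\<lambda>k \<omega>. real (nat \<lfloor>real (Suc k) * g \<omega>\<rfloor>) / real (Suc k)"
  show "(\<lambda>\<omega>. \<omega> (?a k \<omega>)) \<in> borel_measurable (path_space S)" for k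
  proof (rule measurable_compose_countable[of "\<lambda>i \<omega>. \<omega> (real i / real (Suc k))" "path_space S" borel "\<lambda>\<omega>. nat \<lfloor>real (Suc k) * g \<omega>\<rfloor>"])
    show "(\<lambda>\<omega>. nat \<lfloor>real (Suc k) * g \<omega>\<rfloor>) \<in> measurable (path_space S) (count_space UNIV)" by measurable
  qed (rule coord_measurable; simp)
  fix \<omega> assume "\<omega> \<in> space (path_space S)"
  then have \<omega>: "\<omega> \<in> paths S" by (simp add: space_path)
  note g = g0[OF \<omega>]
  have lim: "(\<lambda>k. ?a k \<omega>) \<longlonglongrightarrow> g \<omega>"
  proof (rule tendsto_sandwich)
    have "g \<omega> - 1 / real (Suc k) \<le> ?a k \<omega> \<and> ?a k \<omega> \<le> g \<omega>" for k
    proof -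
      have n: "real (nat \<lfloor>real (Suc k) * g \<omega>\<rfloor>) = of_int \<lfloor>real (Suc k) * g \<omega>\<rfloor>" using g by simp
      have "real (Suc k) * g \<omega> - 1 \<le> of_int \<lfloor>real (Suc k) * g \<omega>\<rfloor>" "of_int \<lfloor>real (Suc k) * g \<omega>\<rfloor> \<le> real (Suc k) * g \<omega>" by linarith+
      moreover have "g \<omega> - 1 / x \<le> F / x \<and> F / x \<le> g \<omega>" if "x > 0" "x * g \<omega> - 1 \<le> F" "F \<le> x * g \<omega>" for x F :: real
      proof -
        have "(x * g \<omega> - 1) / x \<le> F / x" "F / x \<le> x * g \<omega> / x" using that by (intro divide_right_mono; simp)+
        then show ?thesis using that(1) by (simp add: diff_divide_distrib)
      qed
      ultimately show ?thesis unfolding n by simp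
    qed
    then show "eventually (\<lambda>k. g \<omega> - 1 / real (Suc k) \<le> ?a k \<omega>) sequentially" "eventually (\<lambda>k. ?a k \<omega> \<le> g \<omega>) sequentially"
      by auto
    show "(\<lambda>k. g \<omega> - 1 / real (Suc k)) \<longlonglongrightarrow> g \<omega>"
      using tendsto_diff[OF tendsto_const LIMSEQ_inverse_real_of_nat, of "g \<omega>"] by (simp add: inverse_eq_divide)
  qed simp
  show "(\<lambda>k. \<omega> (?a k \<omega>)) \<longlonglongrightarrow> \<omega> (g \<omega>)"
    by (rule continuous_on_tendsto_compose[OF pathsD(1)[OF \<omega>] lim]) (use g in auto)
qed

lemma shift_in:
  assumes "\<omega> \<in> paths S" "0 \<le> \<tau> \<omega>"
  shows "shift \<tau> \<omega> \<in> paths S"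
  unfolding shift_def by (rule shifted_path_in) (use assms in \<open>auto simp: real_of_ereal_pos\<close>)

lemma shift_measurable:
  assumes [measurable]: "\<tau> \<in> borel_measurable (path_space S)" and "\<And>\<omega>. \<omega> \<in> paths S \<Longrightarrow> 0 \<le> \<tau> \<omega>"
  shows "shift \<tau> \<in> measurable (path_space S) (path_space S)"
proof (rule measurable_into_path_space)
  fix u :: real assume u: "0 \<le> u"
  have "(\<lambda>\<omega>. \<omega> (real_of_ereal (\<tau> \<omega>) + u)) \<in> borel_measurable (path_space S)"
    by (rule eval_measurable) (use assms u in \<open>auto simp: real_of_ereal_pos\<close>)
  then show "(\<lambda>\<omega>. shift \<tau> \<omega> u) \<in> borel_measurable (path_space S)" using u by (simp add: shift_def)
qed (use assms shift_in in \<open>auto simp: space_path\<close>)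

lemma Xat_measurable:
  assumes [measurable]: "\<tau> \<in> borel_measurable (path_space S)" and "\<And>\<omega>. \<omega> \<in> paths S \<Longrightarrow> 0 \<le> \<tau> \<omega>"
  shows "Xat \<tau> \<in> borel_measurable (path_space S)"
  unfolding Xat_def[abs_def] by (rule eval_measurable) (use assms in \<open>auto simp: real_of_ereal_pos\<close>)

text \<open>Expresses the next hitting time by a hitting time started at 0 of the shifted path, so
  that both measurability and the strong Markov property can be applied to it.\<close>

lemma hit_times_Suc_shift:
  assumes \<omega>: "\<omega> \<in> paths S" and D: "finite D"
  shows "hit_times D (Suc (Suc n)) \<omega> = (if hit_times D (Suc n) \<omega> = \<infinity> then \<infinity>
     else hit_times D (Suc n) \<omega> + hit_from (D - {Xat (hit_times D (Suc n)) \<omega>}) 0 (shift (hit_times D (Suc n)) \<omega>))"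
proof (cases rule: hit_times_cases[OF assms, of n, case_names finite infinite])
  case (finite r)
  have f: "finite (D - {Xat (hit_times D (Suc n)) \<omega>})" using D by simp
  have "hit_times D (Suc (Suc n)) \<omega> = hit_from (D - {Xat (hit_times D (Suc n)) \<omega>}) (ereal r) \<omega>"
    using finite(1) by simp
  also have "\<dots> = ereal r + hit_from (D - {Xat (hit_times D (Suc n)) \<omega>}) 0 (\<lambda>t\<in>{0..}. \<omega> (r + t))"
    by (rule hit_from_shifted[OF \<omega> f finite(2)])
  also have "(\<lambda>t\<in>{0..}. \<omega> (r + t)) = shift (hit_times D (Suc n)) \<omega>" using finite(1) by (simp add: shift_def del: hit_times.simps)
  finally show ?thesis using finite(1) by (simp del: hit_times.simps)
qed (simp add: hit_from_PInfty)

lemma hit_times_measurable: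
  assumes D: "finite D"
  shows "hit_times D (Suc n) \<in> borel_measurable (path_space S)"
proof (induction n)
  case 0
  have "hit_times D (Suc 0) = hit_from D 0" by (rule ext) simp
  then show ?case using hit_from_measurable[OF D] by simp
next
  case (Suc n)
  let ?\<tau> = "hit_times D (Suc n)"
  note [measurable] = Suc
  note nn = hit_times_nonneg[OF _ D]
  note [measurable] = Xat_measurable[OF Suc nn] shift_measurable[OF Suc nn]
  \<comment> \<open>The target set is random but ranges over the finite set \<open>Pow D\<close>, so
    measurability for each fixed target is enough.\<close>
  have "(\<lambda>\<omega>. D - {Xat ?\<tau> \<omega>}) \<in> measurable (path_space S) (count_space (Pow D))"
  proof (rule measurable_count_space_eq2[THEN iffD2])
    show "finite (Pow D)" using D by simp
    show "(\<lambda>\<omega>. D - {Xat ?\<tau> \<omega>}) \<in> space (path_space S) \<rightarrow> Pow D \<and>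
      (\<forall>B\<in>Pow D. (\<lambda>\<omega>. D - {Xat ?\<tau> \<omega>}) -` {B} \<inter> space (path_space S) \<in> sets (path_space S))"
    proof (intro conjI ballI)
      fix B assume "B \<in> Pow D"
      then have "(\<lambda>\<omega>. D - {Xat ?\<tau> \<omega>}) -` {B} \<inter> space (path_space S) =
         {\<omega>\<in>space (path_space S). \<forall>d\<in>D. d \<in> B \<longleftrightarrow> Xat ?\<tau> \<omega> \<noteq> d}"
        by auto
      also have "\<dots> \<in> sets (path_space S)"
        by (rule sets.sets_Collect_finite_All[OF _ D]) measurable
      finally show "(\<lambda>\<omega>. D - {Xat ?\<tau> \<omega>}) -` {B} \<inter> space (path_space S) \<in> sets (path_space S)" .
    qed auto
  qed
  then have "(\<lambda>\<omega>. hit_from (D - {Xat ?\<tau> \<omega>}) 0 (shift ?\<tau> \<omega>)) \<in> borel_measurable (path_space S)"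
    by (rule measurable_compose_countable'[rotated, where f="\<lambda>B \<omega>. hit_from B 0 (shift ?\<tau> \<omega>)"])
       (use D in \<open>auto simp: countable_finite simp del: hit_times.simps intro!: measurable_compose[OF _ hit_from_measurable] finite_subset[of _ D] shift_measurable[OF Suc nn]\<close>)
  then have "(\<lambda>\<omega>. if ?\<tau> \<omega> = \<infinity> then \<infinity> else ?\<tau> \<omega> + hit_from (D - {Xat ?\<tau> \<omega>}) 0 (shift ?\<tau> \<omega>)) \<in> borel_measurable (path_space S)"
    by measurable
  then show ?case
    by (rule measurable_cong[THEN iffD1, rotated]) (simp only: space_path hit_times_Suc_shift[OF _ D])
qed

section \<open>Strong Markov property at hitting times\<close>

lemma space_F_tau: "space (F_tau S \<sigma>) = paths S"
  by (simp add: F_tau_def space_measure_of_conv space_path)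

context
  fixes S D :: "real set" and n :: nat
  assumes D: "finite D"
begin

abbreviation (input) "tau \<equiv> hit_times D (Suc n)"

text \<open>By \<open>hit_times_agree\<close>, used in both directions, the event is unchanged when
  the path is stopped at \<open>t\<close>; \<open>stop_invariant_in_natF\<close> then improves plain
  measurability to measurability at time \<open>t\<close>.\<close>

lemma stopped_event:
  assumes t: "0 \<le> t" and A: "{\<omega>\<in>paths S. tau \<omega> \<le> ereal t \<and> Q (Xat tau \<omega>)} \<in> sets (path_space S)"
  shows "{\<omega>\<in>paths S. tau \<omega> \<le> ereal t \<and> Q (Xat tau \<omega>)} \<in> sets (natF S t)"
proof (rule stop_invariant_in_natF[OF t A])
  fix \<omega> assume \<omega>: "\<omega> \<in> paths S"
  note s = stop_path_in[OF t \<omega>]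
  have ag: "0 \<le> u \<Longrightarrow> u \<le> t \<Longrightarrow> stop_path t \<omega> u = \<omega> u" for u by (simp add: stop_path_def min_def)
  have 1: "tau (stop_path t \<omega>) = tau \<omega> \<and> Xat tau (stop_path t \<omega>) = Xat tau \<omega>" if "tau \<omega> \<le> ereal t"
    by (rule hit_times_agree[OF \<omega> s D ag that])
  have 2: "tau \<omega> = tau (stop_path t \<omega>) \<and> Xat tau \<omega> = Xat tau (stop_path t \<omega>)" if "tau (stop_path t \<omega>) \<le> ereal t"
    by (rule hit_times_agree[OF s \<omega> D _ that]) (simp add: ag)
  show "stop_path t \<omega> \<in> {\<omega>\<in>paths S. tau \<omega> \<le> ereal t \<and> Q (Xat tau \<omega>)} \<longleftrightarrow> \<omega> \<in> {\<omega>\<in>paths S. tau \<omega> \<le> ereal t \<and> Q (Xat tau \<omega>)}"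
    using 1 2 s \<omega> by (simp del: hit_times.simps) metis
qed

lemma tau_measurable: "tau \<in> borel_measurable (path_space S)" by (rule hit_times_measurable[OF D])

lemma tau_nonneg: "\<omega> \<in> paths S \<Longrightarrow> 0 \<le> tau \<omega>" by (rule hit_times_nonneg[OF _ D])

lemma Xtau_measurable: "Xat tau \<in> borel_measurable (path_space S)"
  by (rule Xat_measurable[OF tau_measurable tau_nonneg])

lemma tau_le_event: "0 \<le> t \<Longrightarrow> {\<omega>\<in>paths S. tau \<omega> \<le> ereal t} \<in> sets (natF S t)"
proof -
  assume t: "0 \<le> t"
  have "{\<omega>\<in>space (path_space S). tau \<omega> \<le> ereal t} \<in> sets (path_space S)"
    using tau_measurable by measurable
  then show ?thesis using stopped_event[OF t, of "\<lambda>_. True"] by (simp only: space_path simp_thms)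
qed

lemma stopping: "stopping_time_plus S tau"
  unfolding stopping_time_plus_def plusF_def space_path
proof (intro conjI ballI allI impI CollectI)
  fix t \<epsilon> :: real assume "0 \<le> t" "0 < \<epsilon>"
  then show "{\<omega> \<in> paths S. tau \<omega> \<le> ereal t} \<in> sets (natF S (t + \<epsilon>))"
    by (intro subsetD[OF natF_mono tau_le_event]) auto
qed (rule tau_nonneg)

text \<open>The generator in the definition of \<open>F_tau\<close> is already a sigma-algebra.
  Closure under complements is where the stopping property \<open>tau_le_event\<close>
  enters.\<close>

lemma sets_F_tau: "sets (F_tau S tau) = {A \<in> sets (path_space S). \<forall>t\<ge>0. {\<omega> \<in> A. tau \<omega> \<le> ereal t} \<in> sets (natF S t)}"
proof -
  let ?\<A> = "{A \<in> sets (path_space S). \<forall>t\<ge>0. {\<omega> \<in> A. tau \<omega> \<le> ereal t} \<in> sets (natF S t)}"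
  have "sigma_algebra (paths S) ?\<A>"
    unfolding sigma_algebra_iff2
  proof (intro conjI ballI allI impI)
    show "?\<A> \<subseteq> Pow (paths S)" using sets.sets_into_space[of _ "path_space S"] by (auto simp: space_path)
    show "{} \<in> ?\<A>" by simp
    fix A assume A: "A \<in> ?\<A>"
    have "{\<omega> \<in> paths S - A. tau \<omega> \<le> ereal t} \<in> sets (natF S t)" if "t \<ge> 0" for t
    proof -
      have "{\<omega> \<in> paths S - A. tau \<omega> \<le> ereal t} = {\<omega>\<in>paths S. tau \<omega> \<le> ereal t} - {\<omega> \<in> A. tau \<omega> \<le> ereal t}" by auto
      then show ?thesis using A that tau_le_event[OF that] by (metis (no_types, lifting) mem_Collect_eq sets.Diff)
    qed
    then show "paths S - A \<in> ?\<A>" using A sets.compl_sets[of A "path_space S"] by (auto simp: space_path simp del: hit_times.simps)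
  next
    fix A :: "nat \<Rightarrow> (real \<Rightarrow> real) set" assume A: "range A \<subseteq> ?\<A>"
    have "{\<omega> \<in> (\<Union>i. A i). tau \<omega> \<le> ereal t} \<in> sets (natF S t)" if "t \<ge> 0" for t
    proof -
      have "{\<omega> \<in> (\<Union>i. A i). tau \<omega> \<le> ereal t} = (\<Union>i. {\<omega> \<in> A i. tau \<omega> \<le> ereal t})" by auto
      also have "\<dots> \<in> sets (natF S t)" using A that by (intro sets.countable_UN) (auto simp del: hit_times.simps)
      finally show ?thesis .
    qed
    then show "(\<Union>i. A i) \<in> ?\<A>" using A by (auto simp del: hit_times.simps)
  qed
  then show ?thesis unfolding F_tau_def space_path by (rule sigma_algebra.sets_measure_of_eq)
qed

lemma F_tau_subset_plus: "sets (F_tau S tau) \<subseteq> F_tau_plus S tau"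
proof
  fix A assume A: "A \<in> sets (F_tau S tau)"
  have "{\<omega> \<in> A. tau \<omega> \<le> ereal t} \<in> sets (natF S (t + \<epsilon>))" if "t \<ge> 0" "\<epsilon> > 0" for t \<epsilon>
    using A that natF_mono[of t "t + \<epsilon>" S] unfolding sets_F_tau by (auto simp del: hit_times.simps)
  then show "A \<in> F_tau_plus S tau" using A unfolding sets_F_tau F_tau_plus_def plusF_def by (simp del: hit_times.simps)
qed

lemma Xtau_event: "{\<omega>\<in>paths S. Xat tau \<omega> = d} \<in> sets (F_tau S tau)"
  unfolding sets_F_tau
proof (intro CollectI conjI allI impI)
  note [measurable] = tau_measurable Xtau_measurable
  have "{\<omega>\<in>space (path_space S). Xat tau \<omega> = d} \<in> sets (path_space S)" by measurable
  then show "{\<omega>\<in>paths S. Xat tau \<omega> = d} \<in> sets (path_space S)" by (simp only: space_path)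
  fix t :: real assume t: "0 \<le> t"
  have "{\<omega>\<in>space (path_space S). tau \<omega> \<le> ereal t \<and> Xat tau \<omega> = d} \<in> sets (path_space S)" by measurable
  then have "{\<omega>\<in>paths S. tau \<omega> \<le> ereal t \<and> Xat tau \<omega> = d} \<in> sets (natF S t)"
    using stopped_event[OF t, of "\<lambda>x. x = d"] by (simp only: space_path)
  also have "{\<omega>\<in>paths S. tau \<omega> \<le> ereal t \<and> Xat tau \<omega> = d} = {\<omega> \<in> {\<omega>\<in>paths S. Xat tau \<omega> = d}. tau \<omega> \<le> ereal t}" by auto
  finally show "{\<omega> \<in> {\<omega>\<in>paths S. Xat tau \<omega> = d}. tau \<omega> \<le> ereal t} \<in> sets (natF S t)" .
qed

end

lemma sets_F_tau_subset: "sets (F_tau S \<sigma>) \<subseteq> sets (path_space S)"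
  unfolding F_tau_def
  by (subst sets_measure_of) (use sets.sets_into_space in \<open>auto intro!: sets.sigma_sets_subset\<close>)

lemma F_tau_mono:
  assumes D: "finite D"
  shows "sets (F_tau S (hit_times D (Suc n))) \<subseteq> sets (F_tau S (hit_times D (Suc (Suc n))))"
proof
  fix A assume A: "A \<in> sets (F_tau S (hit_times D (Suc n)))"
  then have A_sub: "A \<subseteq> paths S" using sets.sets_into_space[of A "F_tau S (hit_times D (Suc n))"] by (simp only: space_F_tau)
  have "{\<omega> \<in> A. hit_times D (Suc (Suc n)) \<omega> \<le> ereal t} \<in> sets (natF S t)" if t: "t \<ge> 0" for t
  proof -
    have "{\<omega> \<in> A. hit_times D (Suc (Suc n)) \<omega> \<le> ereal t} =
      {\<omega> \<in> A. hit_times D (Suc n) \<omega> \<le> ereal t} \<inter> {\<omega>\<in>paths S. hit_times D (Suc (Suc n)) \<omega> \<le> ereal t}"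
      using A_sub hit_times_mono[OF _ D, of _ S "Suc n"] by (auto simp del: hit_times.simps intro: order.trans)
    also have "\<dots> \<in> sets (natF S t)"
      using A t tau_le_event[OF D t, of S "Suc n"] unfolding sets_F_tau[OF D] by (auto simp del: hit_times.simps)
    finally show ?thesis .
  qed
  then show "A \<in> sets (F_tau S (hit_times D (Suc (Suc n))))"
    using A unfolding sets_F_tau[OF D] by (simp del: hit_times.simps)
qed

section \<open>The Markov property at hitting times for a fixed starting point\<close>

locale recurrent_markov =
  fixes S D :: "real set" and P :: "real \<Rightarrow> (real \<Rightarrow> real) measure"
  assumes D: "finite D" "D \<subseteq> S" "card D \<ge> 2"
    and fam: "path_family S P" and mk: "strong_markov S P" and rc: "recurrent S P"
begin

lemma P_kernel: "P \<in> measurable (restrict_space borel S) (prob_algebra (path_space S))"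
  using fam by (simp add: path_family_def)

lemma P_prob: "x \<in> S \<Longrightarrow> prob_space (P x)" and P_sets: "x \<in> S \<Longrightarrow> sets (P x) = sets (path_space S)"
  using measurable_space[OF P_kernel, of x] by (auto simp: space_restrict_space space_prob_algebra)

lemma P_space: "x \<in> S \<Longrightarrow> space (P x) = paths S"
  using sets_eq_imp_space_eq[OF P_sets] by (simp add: space_path)

abbreviation "\<tau> n \<equiv> hit_times D (Suc n)"

text \<open>The event that \<open>\<tau>\<close> is finite with \<open>X\<close> in state \<open>d\<close> there; \<open>Xat\<close> alone reads the path at time 0
  where \<open>\<tau>\<close> is infinite.\<close>

definition at_state :: "nat \<Rightarrow> real \<Rightarrow> (real \<Rightarrow> real) set" where
  "at_state n d = {\<omega>\<in>paths S. \<tau> n \<omega> < \<infinity> \<and> Xat (\<tau> n) \<omega> = d}"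

lemma at_state_sets: "at_state n d \<in> sets (path_space S)"
proof -
  note [measurable] = tau_measurable[OF D(1), of n S] Xtau_measurable[OF D(1), of n S]
  have "{\<omega>\<in>space (path_space S). \<tau> n \<omega> < \<infinity> \<and> Xat (\<tau> n) \<omega> = d} \<in> sets (path_space S)" by measurable
  then show ?thesis by (simp only: at_state_def space_path)
qed

text \<open>The strong Markov property for the indicator of \<open>B\<close>: on the event that the
  state is \<open>d\<close>, the inner integral is the constant \<open>measure (P d) B\<close> and
  comes out of the integral.\<close>

lemma markov_law:
  assumes x: "x \<in> S" and d: "d \<in> D" and A: "A \<in> sets (F_tau S (\<tau> n))" and B: "B \<in> sets (path_space S)"
  shows "measure (P x) (A \<inter> at_state n d \<inter> {\<omega>\<in>paths S. shift (\<tau> n) \<omega> \<in> B}) = measure (P x) (A \<inter> at_state n d) * measure (P d) B"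
proof -
  interpret Px: prob_space "P x" by (rule P_prob[OF x])
  have dS: "d \<in> S" using d D by auto
  \<comment> \<open>The state condition is part of the event tested; intersected with finiteness of
    the hitting time, as in \<open>strong_markov\<close>, it gives exactly
    \<open>at_state n d\<close>.\<close>
  define A' where "A' = A \<inter> {\<omega>\<in>paths S. Xat (\<tau> n) \<omega> = d}"
  have A'F: "A' \<in> sets (F_tau S (\<tau> n))" unfolding A'_def using A Xtau_event[OF D(1)] by auto
  have As: "A' \<in> F_tau_plus S (\<tau> n)" using A'F F_tau_subset_plus[OF D(1)] by auto
  have eqA: "{\<omega>\<in>A'. \<tau> n \<omega> < \<infinity>} = A \<inter> at_state n d" by (auto simp: A'_def at_state_def simp del: hit_times.simps)
  have AM: "A \<in> sets (path_space S)" using A sets_F_tau_subset by blast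
  have shm: "shift (\<tau> n) \<in> measurable (path_space S) (path_space S)"
    by (rule shift_measurable[OF tau_measurable[OF D(1)] tau_nonneg[OF D(1)]])
  have sB: "{\<omega>\<in>paths S. shift (\<tau> n) \<omega> \<in> B} \<in> sets (P x)"
  proof -
    have "shift (\<tau> n) -` B \<inter> space (path_space S) \<in> sets (path_space S)" by (rule measurable_sets[OF shm B])
    also have "shift (\<tau> n) -` B \<inter> space (path_space S) = {\<omega>\<in>paths S. shift (\<tau> n) \<omega> \<in> B}" by (auto simp: space_path)
    finally show ?thesis using P_sets[OF x] by simp
  qed
  have E: "A \<inter> at_state n d \<in> sets (P x)" using AM at_state_sets P_sets[OF x] by auto
  have E_sub: "A \<inter> at_state n d \<subseteq> paths S" by (auto simp: at_state_def)
  have "(LINT \<omega>:{\<omega>\<in>A'. \<tau> n \<omega> < \<infinity>}|P x. indicator B (shift (\<tau> n) \<omega>)) =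
        (LINT \<omega>:{\<omega>\<in>A'. \<tau> n \<omega> < \<infinity>}|P x. (\<integral>\<omega>'. indicator B \<omega>' \<partial>P (Xat (\<tau> n) \<omega>) :: real))"
  proof -
    have "(indicator B :: _ \<Rightarrow> real) \<in> borel_measurable (path_space S)" using B by simp
    moreover have "\<exists>K. \<forall>\<omega>\<in>space (path_space S). \<bar>indicator B \<omega> :: real\<bar> \<le> K" by (intro exI[of _ 1]) (simp add: indicator_def)
    ultimately show ?thesis using mk x stopping[OF D(1), of S n] As unfolding strong_markov_def by blast
  qed
  then have "(\<integral>\<omega>. indicator (A \<inter> at_state n d) \<omega> * indicator B (shift (\<tau> n) \<omega>) \<partial>P x) =
     (\<integral>\<omega>. indicator (A \<inter> at_state n d) \<omega> * (\<integral>\<omega>'. indicator B \<omega>' \<partial>P (Xat (\<tau> n) \<omega>) :: real) \<partial>P x)"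
    unfolding eqA set_lebesgue_integral_def by simp
  moreover have "(\<integral>\<omega>. indicator (A \<inter> at_state n d) \<omega> * (indicator B (shift (\<tau> n) \<omega>) :: real) \<partial>P x)
     = (\<integral>\<omega>. indicator (A \<inter> at_state n d \<inter> {\<omega>\<in>paths S. shift (\<tau> n) \<omega> \<in> B}) \<omega> \<partial>P x)"
    by (rule Bochner_Integration.integral_cong) (auto simp: P_space[OF x] indicator_def)
  moreover have "(\<integral>\<omega>. indicator (A \<inter> at_state n d) \<omega> * (\<integral>\<omega>'. indicator B \<omega>' \<partial>P (Xat (\<tau> n) \<omega>) :: real) \<partial>P x)
     = (\<integral>\<omega>. indicator (A \<inter> at_state n d) \<omega> * measure (P d) B \<partial>P x)"
  proof (rule Bochner_Integration.integral_cong)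
    fix \<omega>
    show "indicator (A \<inter> at_state n d) \<omega> * (\<integral>\<omega>'. indicator B \<omega>' \<partial>P (Xat (\<tau> n) \<omega>) :: real) = indicator (A \<inter> at_state n d) \<omega> * measure (P d) B"
    proof (cases "\<omega> \<in> A \<inter> at_state n d")
      case True
      then have "Xat (\<tau> n) \<omega> = d" by (simp add: at_state_def)
      moreover have "B \<inter> space (P d) = B" using sets.sets_into_space[OF B] P_space[OF dS] by (auto simp: space_path)
      ultimately show ?thesis by simp
    qed simp
  qed simp
  moreover have "(\<integral>\<omega>. indicator (A \<inter> at_state n d \<inter> {\<omega>\<in>paths S. shift (\<tau> n) \<omega> \<in> B}) \<omega> \<partial>P x)
    = measure (P x) (A \<inter> at_state n d \<inter> {\<omega>\<in>paths S. shift (\<tau> n) \<omega> \<in> B})"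
    using E_sub P_space[OF x] by (simp add: Int_absorb2 le_infI1)
  moreover have "(\<integral>\<omega>. indicator (A \<inter> at_state n d) \<omega> * measure (P d) B \<partial>P x) = measure (P x) (A \<inter> at_state n d) * measure (P d) B"
    using E_sub P_space[OF x] by (simp add: Int_absorb2)
  ultimately show ?thesis by simp
qed

lemma tau_finite_iff:
  assumes "\<omega> \<in> paths S"
  shows "\<tau> n \<omega> < \<infinity> \<longleftrightarrow> (\<exists>d\<in>D. \<omega> \<in> at_state n d)"
proof (cases rule: hit_times_cases[OF assms D(1), of n, case_names finite infinite])
  case (finite r)
  then have "Xat (\<tau> n) \<omega> = \<omega> r" by (simp add: Xat_def del: hit_times.simps)
  then have "\<omega> \<in> at_state n (\<omega> r)" using finite(1) assms by (simp add: at_state_def del: hit_times.simps)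
  then show ?thesis using finite by (auto simp del: hit_times.simps)
qed (simp add: at_state_def del: hit_times.simps)

lemma other_state: "d \<in> D \<Longrightarrow> \<exists>e\<in>D. e \<noteq> d"
proof (rule ccontr)
  assume "d \<in> D" "\<not> (\<exists>e\<in>D. e \<noteq> d)"
  then have "D \<subseteq> {d}" by blast
  then have "card D \<le> card {d}" by (intro card_mono) auto
  then show False using D(3) by simp
qed

lemma hit_other_AE:
  assumes d: "d \<in> D"
  shows "AE \<omega> in P d. hit_from (D - {d}) 0 \<omega> < \<infinity>"
proof -
  obtain e where e: "e \<in> D" "e \<noteq> d" using other_state[OF d] by blast
  have dS: "d \<in> S" "e \<in> S" using d e D by auto
  have "AE \<omega> in P d. \<exists>t\<ge>0. \<omega> t = e" using rc dS by (simp add: recurrent_def)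
  moreover have "AE \<omega> in P d. \<omega> \<in> space (P d)" by (rule AE_space)
  ultimately show ?thesis
  proof eventually_elim
    case (elim \<omega>)
    then have \<omega>: "\<omega> \<in> paths S" using P_space dS by simp
    from elim(1) obtain t where t: "t \<ge> 0" "\<omega> t = e" by blast
    have "hit_from (D - {d}) 0 \<omega> \<le> ereal t"
      unfolding hit_from_le_iff[OF \<omega> finite_Diff[OF D(1)]] using t e by auto
    then show ?case by (rule le_less_trans) simp
  qed
qed

text \<open>Recurrence speaks of visits after time 0 only. For later hitting times the path is
  restarted at the previous one, where by \<open>markov_law\<close> it behaves like the process
  started in a point of \<open>D\<close> and so almost surely visits another point.\<close>

lemma tau_finite_AE: "x \<in> S \<Longrightarrow> AE \<omega> in P x. \<tau> n \<omega> < \<infinity>"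
proof (induction n)
  case 0
  obtain e where e: "e \<in> D" using D(3) by fastforce
  have "AE \<omega> in P x. \<exists>t\<ge>0. \<omega> t = e" using rc 0 e D by (auto simp: recurrent_def)
  moreover have "AE \<omega> in P x. \<omega> \<in> space (P x)" by (rule AE_space)
  ultimately show ?case
  proof eventually_elim
    case (elim \<omega>)
    then have \<omega>: "\<omega> \<in> paths S" using P_space[OF 0] by simp
    from elim(1) obtain t where t: "t \<ge> 0" "\<omega> t = e" by blast
    have "hit_from D 0 \<omega> \<le> ereal t" unfolding hit_from_le_iff[OF \<omega> D(1)] using t e by auto
    then have "hit_from D 0 \<omega> < \<infinity>" by (rule le_less_trans) simp
    then show ?case by simp
  qed
next
  case (Suc n)
  note x = Suc.prems
  interpret Px: prob_space "P x" by (rule P_prob[OF x])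
  define B where "B d = {\<omega>\<in>paths S. hit_from (D - {d}) 0 \<omega> = \<infinity>}" for d
  have Bm: "B d \<in> sets (path_space S)" for d
  proof -
    note [measurable] = hit_from_measurable[OF finite_Diff[OF D(1), of "{d}"], of S]
    have "{\<omega>\<in>space (path_space S). hit_from (D - {d}) 0 \<omega> = \<infinity>} \<in> sets (path_space S)" by measurable
    then show ?thesis by (simp only: B_def space_path)
  qed
  have null: "AE \<omega> in P x. \<not> (\<omega> \<in> at_state n d \<and> shift (\<tau> n) \<omega> \<in> B d)" if d: "d \<in> D" for d
  proof -
    have dS: "d \<in> S" using d D by auto
    interpret Pd: prob_space "P d" by (rule P_prob[OF dS])
    have "Pd.prob (B d) = 0"
    proof -
      have "AE \<omega> in P d. \<omega> \<notin> B d" using hit_other_AE[OF d] by eventually_elim (auto simp: B_def)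
      moreover have "B d \<in> sets (P d)" using Bm P_sets[OF dS] by simp
      moreover have "{\<omega>\<in>space (P d). \<not> \<omega> \<notin> B d} = B d" using P_space[OF dS] by (auto simp: B_def)
      ultimately have "emeasure (P d) (B d) = 0" using AE_iff_measurable[of "B d" "P d" "\<lambda>\<omega>. \<omega> \<notin> B d"] by simp
      then show ?thesis by (simp add: measure_def)
    qed
    moreover have "paths S \<in> sets (F_tau S (\<tau> n))" using sets.top[of "F_tau S (\<tau> n)"] by (simp add: space_F_tau)
    ultimately have 0: "measure (P x) (paths S \<inter> at_state n d \<inter> {\<omega>\<in>paths S. shift (\<tau> n) \<omega> \<in> B d}) = 0"
      using markov_law[OF x d _ Bm, of "paths S" n d] by simp
    have eq: "paths S \<inter> at_state n d \<inter> {\<omega>\<in>paths S. shift (\<tau> n) \<omega> \<in> B d} = {\<omega>\<in>space (P x). \<omega> \<in> at_state n d \<and> shift (\<tau> n) \<omega> \<in> B d}"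
      using P_space[OF x] by (auto simp: at_state_def)
    have shm: "shift (\<tau> n) \<in> measurable (path_space S) (path_space S)"
      by (rule shift_measurable[OF tau_measurable[OF D(1)] tau_nonneg[OF D(1)]])
    have "{\<omega>\<in>space (P x). \<omega> \<in> at_state n d \<and> shift (\<tau> n) \<omega> \<in> B d} \<in> sets (P x)"
    proof -
      have "at_state n d \<inter> (shift (\<tau> n) -` B d \<inter> space (path_space S)) \<in> sets (path_space S)"
        using at_state_sets measurable_sets[OF shm Bm] by blast
      also have "at_state n d \<inter> (shift (\<tau> n) -` B d \<inter> space (path_space S)) = {\<omega>\<in>space (P x). \<omega> \<in> at_state n d \<and> shift (\<tau> n) \<omega> \<in> B d}"
        using P_space[OF x] by (auto simp: space_path)
      finally show ?thesis using P_sets[OF x] by simp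
    qed
    then show ?thesis using 0[unfolded eq] by (subst AE_iff_measurable[OF _ refl]) (auto simp: Px.emeasure_eq_measure)
  qed
  have "AE \<omega> in P x. \<forall>d\<in>D. \<not> (\<omega> \<in> at_state n d \<and> shift (\<tau> n) \<omega> \<in> B d)"
    by (rule AE_finite_allI[OF D(1) null])
  moreover have "AE \<omega> in P x. \<omega> \<in> space (P x)" by (rule AE_space)
  ultimately show ?case using Suc.IH[OF x]
  proof eventually_elim
    case (elim \<omega>)
    then have \<omega>: "\<omega> \<in> paths S" using P_space[OF x] by simp
    obtain d where d: "d \<in> D" "\<omega> \<in> at_state n d" using elim(3) tau_finite_iff[OF \<omega>] by blast
    have Xd: "Xat (\<tau> n) \<omega> = d" using d(2) by (simp add: at_state_def)
    have sh: "shift (\<tau> n) \<omega> \<in> paths S" by (rule shift_in[of \<omega> S "\<tau> n", OF \<omega> tau_nonneg[OF D(1) \<omega>]])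
    have "shift (\<tau> n) \<omega> \<notin> B d" using elim(1) d by blast
    then have h: "hit_from (D - {d}) 0 (shift (\<tau> n) \<omega>) \<noteq> \<infinity>" using sh by (simp add: B_def)
    obtain r where r: "\<tau> n \<omega> = ereal r"
      using elim(3) by (cases rule: hit_times_cases[OF \<omega> D(1), of n]) auto
    have "hit_times D (Suc (Suc n)) \<omega> = ereal r + hit_from (D - {d}) 0 (shift (\<tau> n) \<omega>)"
      unfolding hit_times_Suc_shift[OF \<omega> D(1)] r Xd by simp
    also have "\<dots> < \<infinity>" using h by (cases "hit_from (D - {d}) 0 (shift (\<tau> n) \<omega>)") auto
    finally show ?case .
  qed
qed

text \<open>From a point of \<open>D\<close> the first hitting time is 0, so the second one is the
  first visit to the other points. Thus \<open>trans_mat\<close>, which is defined through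
  \<open>hit_times D 2\<close>, describes one step of the chain.\<close>

lemma hit_time_2_from:
  assumes \<omega>: "\<omega> \<in> paths S" and d: "d \<in> D" "\<omega> 0 = d"
  shows "hit_times D 2 \<omega> = hit_from (D - {d}) 0 \<omega>"
proof -
  have "hit_from D (ereal 0) \<omega> = ereal 0" unfolding hit_from_eq_iff[OF \<omega> D(1) order.refl] using d by auto
  then have 1: "hit_times D (Suc 0) \<omega> = 0" by (simp add: zero_ereal_def)
  then have "Xat (hit_times D (Suc 0)) \<omega> = d" using d by (simp add: Xat_def del: hit_times.simps)
  then show ?thesis using 1 by (simp only: numeral_2_eq_2 hit_times.simps)
qed

text \<open>Shows that the next state is a fixed functional of the shifted path; this functional
  becomes \<open>\<xi>\<close> in \<open>modulated_noise\<close>. The abbreviation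
  \<open>\<tau> n\<close> stands for the hitting time with index \<open>n + 1\<close>.\<close>

lemma Xat_Suc_shift:
  assumes \<omega>: "\<omega> \<in> paths S" and fin: "\<tau> (Suc n) \<omega> < \<infinity>"
  shows "Xat (\<tau> (Suc n)) \<omega> = Xat (hit_times D 2) (shift (\<tau> n) \<omega>)"
proof -
  have fn: "\<tau> n \<omega> < \<infinity>" using hit_times_mono[OF \<omega> D(1), of "Suc n"] fin by (rule le_less_trans)
  obtain r where r: "\<tau> n \<omega> = ereal r" "0 \<le> r" "\<omega> r \<in> D"
    using fn by (cases rule: hit_times_cases[OF \<omega> D(1), of n]) auto
  have X: "Xat (\<tau> n) \<omega> = \<omega> r" using r by (simp add: Xat_def del: hit_times.simps)
  let ?s = "shift (\<tau> n) \<omega>"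
  have sh: "?s \<in> paths S" by (rule shift_in[of \<omega> S "\<tau> n", OF \<omega> tau_nonneg[OF D(1) \<omega>]])
  have s_eq: "?s u = \<omega> (r + u)" if "u \<ge> 0" for u using that r by (simp add: shift_def del: hit_times.simps)
  have h2: "hit_times D 2 ?s = hit_from (D - {\<omega> r}) 0 ?s"
    by (rule hit_time_2_from[OF sh r(3)]) (simp add: s_eq)
  have e: "\<tau> (Suc n) \<omega> = ereal r + hit_times D 2 ?s"
    unfolding hit_times_Suc_shift[OF \<omega> D(1)] r(1) X h2 by simp
  have z: "hit_from (D - {\<omega> r}) 0 ?s = hit_from (D - {\<omega> r}) (ereal 0) ?s" by (simp add: zero_ereal_def)
  obtain q where q: "hit_times D 2 ?s = ereal q" "0 \<le> q"
    using fin unfolding e h2 z by (cases rule: hit_from_cases[OF sh finite_Diff[OF D(1), of "{\<omega> r}"] order.refl]) auto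
  show ?thesis unfolding Xat_def e q(1) using s_eq[OF q(2)] by simp
qed

end

text \<open>Monotonicity and a non-vanishing derivative make \<open>f' c\<close> positive, which
  gives sign and monotonicity of \<open>g\<close>. The quadratic error is Taylor's formula of order
  2, with the continuous second derivative bounded on the compact interval of radius 1 around
  \<open>c\<close>.\<close>

lemma drift_linearization:
  fixes f f' f'' :: "real \<Rightarrow> real"
  assumes mono: "strict_mono f"
    and d1: "\<And>\<theta>. (f has_real_derivative f' \<theta>) (at \<theta>)"
    and d2: "\<And>\<theta>. (f' has_real_derivative f'' \<theta>) (at \<theta>)"
    and cont: "continuous_on UNIV f''" and ne: "f' c \<noteq> 0"
  defines "g \<equiv> \<lambda>u. (f (c + u) - f c) / f' c"
  shows "g \<in> borel_measurable borel" "mono g" "u \<noteq> 0 \<Longrightarrow> 0 < u * g u"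
    and "\<exists>C>0. \<forall>u. \<bar>u\<bar> \<le> 1 \<longrightarrow> \<bar>g u - u\<bar> \<le> C * u\<^sup>2"
proof -
  have "0 \<le> f' c"
    by (rule mono_on_imp_deriv_nonneg[of UNIV f]) (use d1 strict_mono_mono[OF mono] in auto)
  then have pos: "0 < f' c" using ne by simp
  have fc: "isCont f x" for x using d1 by (rule DERIV_isCont)
  have "continuous_on UNIV f" using fc by (simp add: continuous_at_imp_continuous_on)
  then have "f \<in> borel_measurable borel" by (rule borel_measurable_continuous_onI)
  then show "g \<in> borel_measurable borel" unfolding g_def by measurable
  show "mono g" unfolding g_def
    using pos strict_mono_less_eq[OF mono] by (intro monoI divide_right_mono diff_right_mono) auto
  show "0 < u * g u" if "u \<noteq> 0"
  proof (cases "u > 0")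
    case True
    then have "f c < f (c + u)" using strict_mono_less[OF mono] by simp
    then show ?thesis using True pos by (simp add: g_def)
  next
    case False
    then have "u < 0" "f (c + u) < f c" using that strict_mono_less[OF mono] by auto
    then show ?thesis using pos by (simp add: g_def mult_neg_neg divide_neg_pos)
  qed
  obtain B where B: "\<And>x. x \<in> {c - 1..c + 1} \<Longrightarrow> \<bar>f'' x\<bar> \<le> B"
  proof -
    have "compact (f'' ` {c - 1..c + 1})"
      by (rule compact_continuous_image[OF continuous_on_subset[OF cont]]) auto
    then have "bounded (f'' ` {c - 1..c + 1})" by (rule compact_imp_bounded)
    then obtain B where "\<forall>x\<in>{c - 1..c + 1}. \<bar>f'' x\<bar> \<le> B" by (auto simp: bounded_iff)
    then show ?thesis using that by blast
  qed
  \<comment> \<open>The added 1 makes \<open>C\<close> strictly positive even when the second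
    derivative vanishes; the factor 1/2 of Taylor's formula is given away.\<close>
  define C where "C = (\<bar>B\<bar> + 1) / f' c"
  have C: "0 < C" using pos by (simp add: C_def)
  have "\<bar>g u - u\<bar> \<le> C * u\<^sup>2" if u: "\<bar>u\<bar> \<le> 1" for u
  proof (cases "u = 0")
    case False
    define df where "df m = (if m = 0 then f else if m = 1 then f' else f'')" for m :: nat
    have "\<exists>t. (if c + u < c then c + u < t \<and> t < c else c < t \<and> t < c + u) \<and>
      f (c + u) = (\<Sum>m<2. df m c / fact m * (c + u - c) ^ m) + df 2 t / fact 2 * (c + u - c) ^ 2"
      by (rule Taylor[of 2 df f "c - 1" "c + 1" c "c + u"])
         (use u False d1 d2 in \<open>auto simp: df_def less_2_cases_iff\<close>)
    then obtain t where "if c + u < c then c + u < t \<and> t < c else c < t \<and> t < c + u"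
      and t2: "f (c + u) = f c + f' c * u + f'' t / 2 * u\<^sup>2"
      by (auto simp: df_def numeral_2_eq_2)
    then have "t \<in> {c - 1..c + 1}" using u by (auto split: if_splits)
    note t = this t2
    have "g u - u = (f'' t / 2 * u\<^sup>2) / f' c" using pos by (simp add: g_def t(2) add_divide_distrib)
    then have "\<bar>g u - u\<bar> = \<bar>f'' t\<bar> / 2 / f' c * u\<^sup>2" using pos by (simp add: abs_mult)
    also have "\<dots> \<le> C * u\<^sup>2"
      unfolding C_def using B[OF t(1)] pos by (intro mult_right_mono divide_right_mono) auto
    finally show ?thesis .
  qed (simp add: g_def)
  then show "\<exists>C>0. \<forall>u. \<bar>u\<bar> \<le> 1 \<longrightarrow> \<bar>g u - u\<bar> \<le> C * u\<^sup>2" using C by blast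
qed

section \<open>Mixing over the initial law and the chain of visited states\<close>

locale mixed_markov = recurrent_markov +
  fixes \<mu> :: "real measure"
  assumes mu_prob: "prob_space \<mu>" and mu_sets: "sets \<mu> = sets (restrict_space borel S)"
begin

definition PP :: "(real \<Rightarrow> real) measure" where "PP = \<mu> \<bind> P"

lemma mu_space: "space \<mu> = S"
  using sets_eq_imp_space_eq[OF mu_sets] by (simp add: space_restrict_space)

lemma P_kernel_mu: "P \<in> measurable \<mu> (prob_algebra (path_space S))"
  using P_kernel measurable_cong_sets[OF mu_sets refl] by blast

lemma P_kernel_sub: "P \<in> measurable \<mu> (subprob_algebra (path_space S))"
  using P_kernel_mu by (rule measurable_prob_algebraD)

lemma PP_sets: "sets PP = sets (path_space S)"
  unfolding PP_def
  by (rule sets_bind[OF sets_kernel[OF P_kernel_sub]]) (use prob_space.not_empty[OF mu_prob] in auto)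

lemma PP_space: "space PP = paths S"
  using sets_eq_imp_space_eq[OF PP_sets] by (simp add: space_path)

lemma PP_prob: "prob_space PP"
proof -
  interpret mu: prob_space \<mu> by (rule mu_prob)
  show ?thesis
    unfolding PP_def
    by (rule mu.prob_space_bind[OF _ P_kernel_sub]) (auto intro!: AE_I2 P_prob simp: mu_space)
qed

lemma PP_measure: "A \<in> sets (path_space S) \<Longrightarrow> measure PP A = (\<integral>x. measure (P x) A \<partial>\<mu>)"
proof -
  interpret mu: prob_space \<mu> by (rule mu_prob)
  show "A \<in> sets (path_space S) \<Longrightarrow> measure PP A = (\<integral>x. measure (P x) A \<partial>\<mu>)"
    unfolding PP_def by (rule mu.measure_bind[OF P_kernel_sub])
qed

lemma PP_AE:
  assumes "\<And>x. x \<in> S \<Longrightarrow> AE \<omega> in P x. Q \<omega>" and "Measurable.pred (path_space S) Q"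
  shows "AE \<omega> in PP. Q \<omega>"
  unfolding PP_def AE_bind[OF P_kernel_sub assms(2)] by (rule AE_I2) (simp add: mu_space assms(1))

lemma PP_tau_finite: "AE \<omega> in PP. \<tau> n \<omega> < \<infinity>"
proof (rule PP_AE[OF tau_finite_AE])
  note [measurable] = tau_measurable[OF D(1), of n S]
  show "Measurable.pred (path_space S) (\<lambda>\<omega>. \<tau> n \<omega> < \<infinity>)" by measurable
qed

text \<open>Where the hitting time is infinite, a null event, \<open>Xat\<close> may lie outside \<open>D\<close>; clipping makes the chain
  \<open>D\<close>-valued everywhere.\<close>

definition clip :: "real \<Rightarrow> real" where
  "clip x = (if x \<in> D then x else (SOME d. d \<in> D))"

lemma clip_in: "clip x \<in> D"
proof -
  have "D \<noteq> {}" using D(3) by auto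
  then show ?thesis by (auto simp: clip_def some_in_eq)
qed

lemma clip_eq: "x \<in> D \<Longrightarrow> clip x = x" by (simp add: clip_def)

lemma clip_eq_iff: "d \<in> D \<Longrightarrow> clip x = d \<longleftrightarrow> x = d \<or> ((SOME d. d \<in> D) = d \<and> (\<forall>e\<in>D. x \<noteq> e))"
  by (auto simp: clip_def)

lemma clip_measurable:
  assumes ev: "\<And>d. {\<omega>\<in>space L. f \<omega> = d} \<in> sets L"
  shows "(\<lambda>\<omega>. clip (f \<omega>)) \<in> measurable L (count_space D)"
proof (rule measurable_count_space_eq2[OF D(1), THEN iffD2], intro conjI ballI)
  fix d assume d: "d \<in> D"
  have "{\<omega>\<in>space L. f \<omega> = d} \<union> {\<omega>\<in>space L. (SOME d. d \<in> D) = d \<and> (\<forall>e\<in>D. f \<omega> \<noteq> e)} \<in> sets L"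
  proof (intro sets.Un ev)
    have "{\<omega>\<in>space L. \<forall>e\<in>D. f \<omega> \<noteq> e} \<in> sets L"
      by (rule sets.sets_Collect_finite_All[OF _ D(1)]) (rule sets.sets_Collect_neg[OF ev])
    then show "{\<omega>\<in>space L. (SOME d. d \<in> D) = d \<and> (\<forall>e\<in>D. f \<omega> \<noteq> e)} \<in> sets L"
      by (cases "(SOME d. d \<in> D) = d") simp_all
  qed
  moreover have "(\<lambda>\<omega>. clip (f \<omega>)) -` {d} \<inter> space L =
    {\<omega>\<in>space L. f \<omega> = d} \<union> {\<omega>\<in>space L. (SOME d. d \<in> D) = d \<and> (\<forall>e\<in>D. f \<omega> \<noteq> e)}"
    using clip_eq_iff[OF d] by auto
  ultimately show "(\<lambda>\<omega>. clip (f \<omega>)) -` {d} \<inter> space L \<in> sets L" by simp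
qed (simp add: clip_in)

definition state :: "nat \<Rightarrow> (real \<Rightarrow> real) \<Rightarrow> real" where "state n \<omega> = clip (Xat (\<tau> n) \<omega>)"

lemma state_measurable: "state n \<in> measurable (F_tau S (\<tau> n)) (count_space D)"
  unfolding state_def[abs_def]
  by (rule clip_measurable) (use Xtau_event[OF D(1)] in \<open>simp only: space_F_tau\<close>)

lemma state_eq:
  assumes "\<omega> \<in> paths S" "\<tau> n \<omega> < \<infinity>"
  shows "state n \<omega> = Xat (\<tau> n) \<omega>" and "Xat (\<tau> n) \<omega> \<in> D"
proof -
  show "Xat (\<tau> n) \<omega> \<in> D" using assms tau_finite_iff[OF assms(1), of n] by (auto simp: at_state_def)
  then show "state n \<omega> = Xat (\<tau> n) \<omega>" by (simp add: state_def clip_eq)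
qed

lemma state_AE: "AE \<omega> in PP. state n \<omega> = Xat (\<tau> n) \<omega> \<and> \<tau> n \<omega> < \<infinity>"
  using PP_tau_finite[of n] AE_space
  by eventually_elim (use PP_space state_eq in auto)

lemma shift_tau_measurable: "shift (\<tau> n) \<in> measurable (path_space S) (path_space S)"
  by (rule shift_measurable[OF tau_measurable[OF D(1)] tau_nonneg[OF D(1)]])

text \<open>The factor \<open>measure (P d) B\<close> in \<open>markov_law\<close> does not depend
  on the starting point, so the identity survives integration against \<open>\<mu>\<close>.\<close>

lemma PP_markov_law:
  assumes d: "d \<in> D" and A: "A \<in> sets (F_tau S (\<tau> n))" and B: "B \<in> sets (path_space S)"
  shows "measure PP (A \<inter> at_state n d \<inter> {\<omega>\<in>paths S. shift (\<tau> n) \<omega> \<in> B}) = measure PP (A \<inter> at_state n d) * measure (P d) B"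
proof -
  have AM: "A \<in> sets (path_space S)" using A sets_F_tau_subset by blast
  have sB: "{\<omega>\<in>paths S. shift (\<tau> n) \<omega> \<in> B} \<in> sets (path_space S)"
  proof -
    have "shift (\<tau> n) -` B \<inter> space (path_space S) = {\<omega>\<in>paths S. shift (\<tau> n) \<omega> \<in> B}" by (auto simp: space_path)
    then show ?thesis using measurable_sets[OF shift_tau_measurable B, of n] by simp
  qed
  have E: "A \<inter> at_state n d \<in> sets (path_space S)" using AM at_state_sets by blast
  have "measure PP (A \<inter> at_state n d \<inter> {\<omega>\<in>paths S. shift (\<tau> n) \<omega> \<in> B}) =
     (\<integral>x. measure (P x) (A \<inter> at_state n d \<inter> {\<omega>\<in>paths S. shift (\<tau> n) \<omega> \<in> B}) \<partial>\<mu>)"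
    using E sB by (intro PP_measure) blast
  also have "\<dots> = (\<integral>x. measure (P x) (A \<inter> at_state n d) * measure (P d) B \<partial>\<mu>)"
    by (rule Bochner_Integration.integral_cong) (simp_all add: mu_space markov_law[OF _ d A B])
  also have "\<dots> = measure PP (A \<inter> at_state n d) * measure (P d) B"
    by (simp add: PP_measure[OF E])
  finally show ?thesis .
qed

text \<open>Given the past of a hitting time, the shifted path has the law of the process started in
  the current state. Compared with \<open>PP_markov_law\<close> only the event changes: the clipped
  state equals \<open>d\<close> exactly on \<open>at_state n d\<close>, up to the null event of an
  infinite hitting time.\<close>

lemma conditional_law_shift:
  "conditional_law PP (F_tau S (\<tau> n)) D (state n) (path_space S) (shift (\<tau> n)) P"
proof -
  interpret PP: prob_space PP by (rule PP_prob)
  show ?thesis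
  proof (rule conditional_law.intro[OF PP_prob conditional_law_axioms.intro])
    show "subalgebra PP (F_tau S (\<tau> n))"
      unfolding subalgebra_def PP_space PP_sets space_F_tau using sets_F_tau_subset by simp
    show "finite D" by (rule D(1))
    show "state n \<in> measurable (F_tau S (\<tau> n)) (count_space D)" by (rule state_measurable)
    show "shift (\<tau> n) \<in> measurable PP (path_space S)"
      using shift_tau_measurable measurable_cong_sets[OF PP_sets refl] by blast
    fix d assume d: "d \<in> D"
    then have dS: "d \<in> S" using D by auto
    show "prob_space (P d)" "sets (P d) = sets (path_space S)" using P_prob[OF dS] P_sets[OF dS] by auto
    fix A B assume A: "A \<in> sets (F_tau S (\<tau> n))" and B: "B \<in> sets (path_space S)"
    have AM: "A \<in> sets PP" using A sets_F_tau_subset PP_sets by blast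
    have sB: "{\<omega>\<in>space PP. shift (\<tau> n) \<omega> \<in> B} \<in> sets PP"
    proof -
      have "shift (\<tau> n) -` B \<inter> space (path_space S) = {\<omega>\<in>space PP. shift (\<tau> n) \<omega> \<in> B}" by (auto simp: space_path PP_space)
      then show ?thesis using measurable_sets[OF shift_tau_measurable B, of n] PP_sets by simp
    qed
    have sX: "{\<omega>\<in>space PP. state n \<omega> = d} \<in> sets PP"
    proof -
      have "state n -` {d} \<inter> space (F_tau S (\<tau> n)) \<in> sets (F_tau S (\<tau> n))"
        by (rule measurable_sets[OF state_measurable]) (use d in simp)
      moreover have "state n -` {d} \<inter> space (F_tau S (\<tau> n)) = {\<omega>\<in>space PP. state n \<omega> = d}"
        by (auto simp: space_F_tau PP_space)
      ultimately have "{\<omega>\<in>space PP. state n \<omega> = d} \<in> sets (F_tau S (\<tau> n))" by simp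
      then show ?thesis unfolding PP_sets by (rule subsetD[OF sets_F_tau_subset])
    qed
    have aM: "at_state n d \<in> sets PP" using at_state_sets PP_sets by simp
    have ae: "AE \<omega> in PP. \<omega> \<in> {\<omega>\<in>space PP. state n \<omega> = d} \<longleftrightarrow> \<omega> \<in> at_state n d"
      using state_AE[of n] AE_space by eventually_elim (auto simp: at_state_def PP_space)
    have 1: "PP.prob (A \<inter> {\<omega>\<in>space PP. state n \<omega> = d} \<inter> {\<omega>\<in>space PP. shift (\<tau> n) \<omega> \<in> B})
       = PP.prob (A \<inter> at_state n d \<inter> {\<omega>\<in>space PP. shift (\<tau> n) \<omega> \<in> B})"
      using ae by (intro PP.finite_measure_eq_AE sets.Int AM sX aM sB) auto
    have 2: "PP.prob (A \<inter> {\<omega>\<in>space PP. state n \<omega> = d}) = PP.prob (A \<inter> at_state n d)"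
      using ae by (intro PP.finite_measure_eq_AE sets.Int AM sX aM) auto
    show "PP.prob (A \<inter> {\<omega>\<in>space PP. state n \<omega> = d} \<inter> {\<omega>\<in>space PP. shift (\<tau> n) \<omega> \<in> B}) =
      PP.prob (A \<inter> {\<omega>\<in>space PP. state n \<omega> = d}) * measure (P d) B"
      unfolding 1 2 using PP_markov_law[OF d A B] by (simp only: PP_space)
  qed
qed

lemma state_1_measurable: "state (Suc 0) \<in> measurable (path_space S) (count_space D)"
proof -
  have "state (Suc 0) \<in> measurable (F_tau S (\<tau> (Suc 0))) (count_space D)" by (rule state_measurable)
  then show ?thesis
    by (rule measurable_from_subalg[rotated]) (simp add: subalgebra_def space_F_tau space_path sets_F_tau_subset)
qed

lemma state_Suc: "AE \<omega> in PP. state (Suc n) \<omega> = state (Suc 0) (shift (\<tau> n) \<omega>)"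
  using PP_tau_finite[of "Suc n"] AE_space
proof eventually_elim
  case (elim \<omega>)
  then have "\<omega> \<in> paths S" by (simp only: PP_space)
  from Xat_Suc_shift[OF this elim(1)] show ?case by (simp only: state_def numeral_2_eq_2)
qed

text \<open>The matrix is defined with the raw state and the chain uses the clipped one; they differ
  only where the second hitting time is infinite, a null event under \<open>P d\<close>.\<close>

lemma trans_mat_state:
  assumes d: "d \<in> D" and e: "e \<in> D"
  shows "trans_mat D P d e = measure (P d) {x\<in>space (path_space S). state (Suc 0) x = e}"
proof -
  have dS: "d \<in> S" using d D by auto
  interpret Pd: prob_space "P d" by (rule P_prob[OF dS])
  have s1: "{\<omega>\<in>space (P d). Xat (hit_times D 2) \<omega> = e} \<in> sets (P d)"
  proof -
    note [measurable] = Xtau_measurable[OF D(1), of "Suc 0" S]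
    have "{\<omega>\<in>space (path_space S). Xat (\<tau> (Suc 0)) \<omega> = e} \<in> sets (path_space S)" by measurable
    then show ?thesis by (simp only: numeral_2_eq_2 P_space[OF dS] P_sets[OF dS] space_path)
  qed
  have s2: "{x\<in>space (path_space S). state (Suc 0) x = e} \<in> sets (P d)"
  proof -
    have "state (Suc 0) -` {e} \<inter> space (path_space S) \<in> sets (path_space S)"
      by (rule measurable_sets[OF state_1_measurable]) (use e in simp)
    moreover have "state (Suc 0) -` {e} \<inter> space (path_space S) = {x\<in>space (path_space S). state (Suc 0) x = e}" by auto
    ultimately show ?thesis by (simp only: P_sets[OF dS])
  qed
  show ?thesis
    unfolding trans_mat_def
  proof (rule Pd.finite_measure_eq_AE[OF _ s1 s2])
    show "AE x in P d. x \<in> {\<omega> \<in> space (P d). Xat (hit_times D 2) \<omega> = e} \<longleftrightarrow> x \<in> {x \<in> space (path_space S). state (Suc 0) x = e}"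
      using tau_finite_AE[OF dS, of "Suc 0"] AE_space
    proof eventually_elim
      case (elim x)
      then have x: "x \<in> paths S" by (simp only: P_space[OF dS])
      show ?case using state_eq(1)[OF x elim(1)] x by (simp only: numeral_2_eq_2 P_space[OF dS] space_path mem_Collect_eq simp_thms)
    qed
  qed
qed

end

section \<open>Asymptotic normality of the Newton-type estimator\<close>

text \<open>The decreasing case reduces to the increasing one by passing to \<open>- f\<close>,
  which leaves the quotient \<open>g\<close> unchanged.\<close>

lemma drift_linearization_deriv:
  fixes f :: "real \<Rightarrow> real" and c :: real
  assumes mono: "strict_mono f \<or> strict_mono (\<lambda>\<theta>. - f \<theta>)"
    and ex: "\<exists>f' f''. (\<forall>\<theta>. (f has_real_derivative f' \<theta>) (at \<theta>)) \<and> (\<forall>\<theta>. (f' has_real_derivative f'' \<theta>) (at \<theta>)) \<and>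
      continuous_on UNIV f'' \<and> (\<forall>\<theta>. f' \<theta> \<noteq> 0)"
  defines "g \<equiv> \<lambda>u. (f (c + u) - f c) / deriv f c"
  shows "deriv f c \<noteq> 0" "g \<in> borel_measurable borel" "mono g" "u \<noteq> 0 \<Longrightarrow> 0 < u * g u"
    and "\<exists>C>0. \<forall>u. \<bar>u\<bar> \<le> 1 \<longrightarrow> \<bar>g u - u\<bar> \<le> C * u\<^sup>2"
proof -
  obtain f' f'' where d1: "\<And>\<theta>. (f has_real_derivative f' \<theta>) (at \<theta>)" and d2: "\<And>\<theta>. (f' has_real_derivative f'' \<theta>) (at \<theta>)"
    and cont: "continuous_on UNIV f''" and ne: "\<And>\<theta>. f' \<theta> \<noteq> 0" using ex by blast
  have dv: "deriv f c = f' c" using d1 by (rule DERIV_imp_deriv)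
  then show "deriv f c \<noteq> 0" using ne by simp
  have "g \<in> borel_measurable borel \<and> mono g \<and> (\<forall>u. u \<noteq> 0 \<longrightarrow> 0 < u * g u) \<and> (\<exists>C>0. \<forall>u. \<bar>u\<bar> \<le> 1 \<longrightarrow> \<bar>g u - u\<bar> \<le> C * u\<^sup>2)"
    using mono
  proof
    assume m: "strict_mono f"
    show ?thesis using drift_linearization[OF m d1 d2 cont ne[of c]] unfolding g_def dv by blast
  next
    assume m: "strict_mono (\<lambda>\<theta>. - f \<theta>)"
    have 1: "((\<lambda>\<theta>. - f \<theta>) has_real_derivative - f' \<theta>) (at \<theta>)" for \<theta> using d1 by (rule DERIV_minus)
    have 2: "((\<lambda>\<theta>. - f' \<theta>) has_real_derivative - f'' \<theta>) (at \<theta>)" for \<theta> using d2 by (rule DERIV_minus)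
    have 3: "continuous_on UNIV (\<lambda>\<theta>. - f'' \<theta>)" using cont by (rule continuous_on_minus)
    have ne': "- f' c \<noteq> 0" using ne by simp
    have eq: "(- f (c + u) - - f c) / - f' c = g u" for u
      unfolding g_def dv using ne[of c] by (simp add: field_simps)
    show ?thesis using drift_linearization[OF m 1 2 3 ne'] unfolding eq by blast
  qed
  then show "g \<in> borel_measurable borel" "mono g" "u \<noteq> 0 \<Longrightarrow> 0 < u * g u" "\<exists>C>0. \<forall>u. \<bar>u\<bar> \<le> 1 \<longrightarrow> \<bar>g u - u\<bar> \<le> C * u\<^sup>2"
    by blast+
qed

theorem theorem4p1:
  fixes S D :: "real set"
    and P :: "real \<Rightarrow> real \<Rightarrow> (real \<Rightarrow> real) measure"
    and \<theta>s :: real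
    and \<mu> :: "real measure"
    and Y :: "(real \<Rightarrow> real) \<Rightarrow> real"
    and \<Theta> :: "nat \<Rightarrow> (real \<Rightarrow> real) \<Rightarrow> real"
    and p :: "real \<Rightarrow> real"
    and L L' :: real
  defines "\<eta> \<equiv> \<lambda>\<theta> d. \<integral>\<omega>. Y \<omega> \<partial>P \<theta> d"
  defines "\<alpha> \<equiv> \<lambda>d. - deriv (\<lambda>\<theta>. \<eta> \<theta> d) \<theta>s"
  defines "PP \<equiv> bind \<mu> (P \<theta>s)"
  assumes S: "S = UNIV \<or> S = {0..} \<or> S = {0<..}"
    and D: "finite D" "D \<subseteq> S" "card D \<ge> 2"
    and family: "\<And>\<theta>. path_family S (P \<theta>)"
    and markov: "\<And>\<theta>. strong_markov S (P \<theta>)"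
    and recurrent: "\<And>\<theta>. recurrent S (P \<theta>)"
    and mu: "prob_space \<mu>" "sets \<mu> = sets (restrict_space borel S)"
    and Y_meas: "Y \<in> borel_measurable (F_tau S (hit_times D 2))"
    and Y_below: "\<exists>c. \<forall>\<omega>\<in>space (path_space S). c \<le> Y \<omega>"
    and Y_L2: "\<forall>d\<in>D. integrable (P \<theta>s d) (\<lambda>\<omega>. (Y \<omega>)\<^sup>2)"
    and Y_int: "\<forall>\<theta>. \<forall>d\<in>D. integrable (P \<theta> d) Y"
    and N1: "\<forall>d\<in>D. (strict_mono (\<lambda>\<theta>. \<eta> \<theta> d) \<or> strict_mono (\<lambda>\<theta>. - \<eta> \<theta> d)) \<and>
              (\<exists>\<eta>' \<eta>''. (\<forall>\<theta>. ((\<lambda>\<theta>. \<eta> \<theta> d) has_real_derivative \<eta>' \<theta>) (at \<theta>)) \<and>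
                        (\<forall>\<theta>. (\<eta>' has_real_derivative \<eta>'' \<theta>) (at \<theta>)) \<and>
                        continuous_on UNIV \<eta>'' \<and> (\<forall>\<theta>. \<eta>' \<theta> \<noteq> 0))"
    and N2: "L > 0" "L' > 0" "\<forall>\<theta>. \<forall>d\<in>D. \<bar>\<eta> \<theta> d - \<eta> \<theta>s d\<bar> \<le> L * \<bar>\<theta> - \<theta>s\<bar> + L'"
    and adapted: "\<forall>n\<ge>1. \<Theta> n \<in> borel_measurable (F_tau S (hit_times D n))"
    and init: "integrable PP (\<lambda>\<omega>. (\<Theta> 1 \<omega>)\<^sup>2)"
    and recursion: "\<forall>n\<ge>1. AE \<omega> in PP.
        \<Theta> (n + 1) \<omega> = \<Theta> n \<omega> - (1 / real n) *
          ((Yseq D Y (n + 1) \<omega> - \<eta> (\<Theta> n \<omega>) (Xat (hit_times D n) \<omega>))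
            / \<alpha> (Xat (hit_times D n) \<omega>))"
    and irred: "irreducible_on D (trans_mat D (P \<theta>s))"
    and p: "invariant_prob D (trans_mat D (P \<theta>s)) p"
  shows "weak_conv_m (\<lambda>n. distr PP borel (\<lambda>\<omega>. sqrt (real n) * (\<Theta> n \<omega> - \<theta>s)))
           (normal_law 0 (\<Sum>d\<in>D. p d * (\<integral>\<omega>. (Y \<omega> - \<eta> \<theta>s d)\<^sup>2 \<partial>P \<theta>s d) / (\<alpha> d)\<^sup>2))"
proof -
  interpret MM: mixed_markov S D "P \<theta>s" \<mu>
    by (rule mixed_markov.intro[OF recurrent_markov.intro[OF D family markov recurrent] mixed_markov_axioms.intro[OF mu]])
  have PP_eq: "PP = mixed_markov.PP (P \<theta>s) \<mu>" by (simp add: assms(3) MM.PP_def)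
  \<comment> \<open>\<open>MM.\<tau> (Suc n)\<close> is the hitting time with index
    \<open>n + 2\<close>, so index 0 of all the sequences below refers to the second hitting
    time.\<close>
  define X where "X n = MM.state (Suc n)" for n
  define V where "V n = shift (MM.\<tau> (Suc n))" for n
  define F where "F n = F_tau S (MM.\<tau> (Suc n))" for n
  \<comment> \<open>As \<open>\<alpha> d\<close> is minus the derivative, the correction
    \<open>(Y - \<eta> \<theta> d) / \<alpha> d\<close> at \<open>\<theta> = \<theta>s + u\<close>
    splits exactly into \<open>\<zeta> d + h d u\<close>, with \<open>\<zeta> d\<close> centred
    under \<open>P \<theta>s d\<close>.\<close>
  define h where "h d u = (\<eta> (\<theta>s + u) d - \<eta> \<theta>s d) / deriv (\<lambda>\<theta>. \<eta> \<theta> d) \<theta>s" for d u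
  define \<zeta> where "\<zeta> d \<omega> = (Y \<omega> - \<eta> \<theta>s d) / \<alpha> d" for d \<omega>
  \<comment> \<open>Indices start at 2 because \<open>Y\<^sub>2\<close>, evaluated on the unshifted path, need not have the right mean
    nor be integrable; only \<open>\<Theta> 2\<close> being finite matters.\<close>
  define U where "U n \<omega> = \<Theta> (n + 2) \<omega> - \<theta>s" for n \<omega>
  \<comment> \<open>The noise is read off from the recursion itself, so that \<open>U_rec\<close>
    holds on every path and \<open>Z n\<close> is measurable at time \<open>n + 1\<close>; agreement
    with \<open>\<zeta>\<close> is proved only almost everywhere, like the given recursion.\<close>
  define Z where "Z n \<omega> = (real n + 2) * (U n \<omega> - U (Suc n) \<omega>) - h (X n \<omega>) (U n \<omega>)" for n \<omega>
  have dP: "d \<in> D \<Longrightarrow> prob_space (P \<theta>s d)" for d using MM.P_prob D(2) by auto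
  have drift: "deriv (\<lambda>\<theta>. \<eta> \<theta> d) \<theta>s \<noteq> 0" "h d \<in> borel_measurable borel" "mono (h d)" "\<And>u. u \<noteq> 0 \<Longrightarrow> 0 < u * h d u"
    "\<exists>C>0. \<forall>u. \<bar>u\<bar> \<le> 1 \<longrightarrow> \<bar>h d u - u\<bar> \<le> C * u\<^sup>2" if "d \<in> D" for d
  proof -
    note N1d = bspec[OF N1 that]
    show "deriv (\<lambda>\<theta>. \<eta> \<theta> d) \<theta>s \<noteq> 0" by (rule drift_linearization_deriv(1)[OF conjunct1[OF N1d] conjunct2[OF N1d]])
    show "h d \<in> borel_measurable borel" "mono (h d)" "\<And>u. u \<noteq> 0 \<Longrightarrow> 0 < u * h d u"
      "\<exists>C>0. \<forall>u. \<bar>u\<bar> \<le> 1 \<longrightarrow> \<bar>h d u - u\<bar> \<le> C * u\<^sup>2"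
      unfolding h_def[abs_def]
      by (rule drift_linearization_deriv(2-5)[OF conjunct1[OF N1d] conjunct2[OF N1d]]; assumption)+
  qed
  have \<alpha>: "d \<in> D \<Longrightarrow> \<alpha> d \<noteq> 0" for d using drift(1) by (simp add: \<alpha>_def)
  have "\<forall>d\<in>D. \<exists>C>0. \<forall>u. \<bar>u\<bar> \<le> 1 \<longrightarrow> \<bar>h d u - u\<bar> \<le> C * u\<^sup>2" using drift(5) by blast
  then obtain Cd where Cd: "\<And>d. d \<in> D \<Longrightarrow> 0 < Cd d" "\<And>d u. d \<in> D \<Longrightarrow> \<bar>u\<bar> \<le> 1 \<Longrightarrow> \<bar>h d u - u\<bar> \<le> Cd d * u\<^sup>2"
    by metis
  define C where "C = (\<Sum>d\<in>D. Cd d)"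
  have D_ne: "D \<noteq> {}" using D(3) by auto
  have C_pos: "0 < C" unfolding C_def using D(1) D_ne Cd(1) by (rule sum_pos)
  have CdC: "d \<in> D \<Longrightarrow> Cd d \<le> C" for d
    unfolding C_def by (rule member_le_sum) (use D(1) Cd(1) in \<open>auto intro: less_imp_le\<close>)
  \<comment> \<open>Assumption N2 bounds the increment of \<open>\<eta>\<close> by
    \<open>(L + L') * (1 + \<bar>u\<bar>)\<close>; the sum over \<open>D\<close> serves as a bound
    common to all states.\<close>
  define K where "K = (\<Sum>d\<in>D. (L + L') / \<bar>\<alpha> d\<bar>)"
  have KdK: "(L + L') / \<bar>\<alpha> d\<bar> \<le> K" if "d \<in> D" for d
    unfolding K_def by (rule member_le_sum[where f="\<lambda>d. (L + L') / \<bar>\<alpha> d\<bar>"]) (use D(1) N2 that in auto)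
  have h_growth: "\<bar>h d u\<bar> \<le> K * (1 + \<bar>u\<bar>)" if d: "d \<in> D" for d u
  proof -
    have "\<bar>h d u\<bar> = \<bar>\<eta> (\<theta>s + u) d - \<eta> \<theta>s d\<bar> / \<bar>\<alpha> d\<bar>" by (simp add: h_def \<alpha>_def)
    also have "\<dots> \<le> (L * \<bar>u\<bar> + L') / \<bar>\<alpha> d\<bar>"
      using N2(3)[rule_format, OF d, of "\<theta>s + u"] by (intro divide_right_mono) auto
    also have "\<dots> \<le> (L + L') * (1 + \<bar>u\<bar>) / \<bar>\<alpha> d\<bar>"
      using N2(1,2) by (intro divide_right_mono) (auto simp: algebra_simps)
    also have "\<dots> = (L + L') / \<bar>\<alpha> d\<bar> * (1 + \<bar>u\<bar>)" by simp
    also have "\<dots> \<le> K * (1 + \<bar>u\<bar>)" by (intro mult_right_mono KdK d) simp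
    finally show ?thesis .
  qed
  have F_sub: "sets (F n) \<subseteq> sets (F (Suc n))" for n unfolding F_def by (rule F_tau_mono[OF D(1)])
  have liftF: "g \<in> borel_measurable (F n) \<Longrightarrow> g \<in> borel_measurable (F (Suc n))" for g :: "_ \<Rightarrow> real" and n
    by (rule measurable_from_subalg) (auto simp: subalgebra_def F_def space_F_tau dest: F_sub[unfolded F_def, THEN subsetD])
  have U_F: "U n \<in> borel_measurable (F n)" for n
  proof -
    have "\<Theta> (n + 2) \<in> borel_measurable (F_tau S (hit_times D (n + 2)))" using adapted by simp
    also have "n + 2 = Suc (Suc n)" by simp
    finally have "\<Theta> (n + 2) \<in> borel_measurable (F n)" by (simp only: F_def add_2_eq_Suc')
    then show ?thesis unfolding U_def[abs_def] by measurable
  qed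
  have hU_F: "(\<lambda>\<omega>. h (X n \<omega>) (U n \<omega>)) \<in> borel_measurable (F n)" for n
    unfolding X_def F_def
    by (rule conditional_law.finite_measurable_select[OF MM.conditional_law_shift, of "\<lambda>d \<omega>. h d (U n \<omega>)"])
       (rule measurable_compose[OF U_F[unfolded F_def] drift(2)])
  have Z_F: "Z n \<in> borel_measurable (F (Suc n))" for n
    unfolding Z_def[abs_def]
    by (intro borel_measurable_diff borel_measurable_times borel_measurable_const liftF U_F hU_F)
  have \<zeta>_int: "integrable (P \<theta>s d) (\<zeta> d)" and \<zeta>_sq: "integrable (P \<theta>s d) (\<lambda>\<omega>. (\<zeta> d \<omega>)\<^sup>2)"
    and \<zeta>_mean: "(\<integral>\<omega>. \<zeta> d \<omega> \<partial>P \<theta>s d) = 0" if d: "d \<in> D" for d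
  proof -
    interpret Pd: prob_space "P \<theta>s d" by (rule dP[OF d])
    have i: "integrable (P \<theta>s d) Y" using Y_int d by blast
    have i2: "integrable (P \<theta>s d) (\<lambda>\<omega>. (Y \<omega>)\<^sup>2)" using Y_L2 d by blast
    show "integrable (P \<theta>s d) (\<zeta> d)" unfolding \<zeta>_def using i by simp
    have "(\<zeta> d \<omega>)\<^sup>2 = ((Y \<omega>)\<^sup>2 - 2 * \<eta> \<theta>s d * Y \<omega> + (\<eta> \<theta>s d)\<^sup>2) / (\<alpha> d)\<^sup>2" for \<omega>
      by (simp add: \<zeta>_def power_divide power2_diff algebra_simps)
    then show "integrable (P \<theta>s d) (\<lambda>\<omega>. (\<zeta> d \<omega>)\<^sup>2)" using i i2 by simp
    show "(\<integral>\<omega>. \<zeta> d \<omega> \<partial>P \<theta>s d) = 0" unfolding \<zeta>_def using i by (simp add: Pd.prob_space \<eta>_def)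
  qed
  have Z_eq: "AE \<omega> in PP. Z n \<omega> = \<zeta> (X n \<omega>) (V n \<omega>)" for n
  proof -
    have "AE \<omega> in PP. \<Theta> (n + 2 + 1) \<omega> = \<Theta> (n + 2) \<omega> - (1 / real (n + 2)) *
          ((Yseq D Y (n + 2 + 1) \<omega> - \<eta> (\<Theta> (n + 2) \<omega>) (Xat (hit_times D (n + 2)) \<omega>)) / \<alpha> (Xat (hit_times D (n + 2)) \<omega>))"
      by (rule recursion[rule_format]) simp
    moreover have "AE \<omega> in PP. MM.state (Suc n) \<omega> = Xat (MM.\<tau> (Suc n)) \<omega> \<and> MM.\<tau> (Suc n) \<omega> < \<infinity>"
      unfolding PP_eq by (rule MM.state_AE)
    moreover have "AE \<omega> in PP. \<omega> \<in> space PP" by (rule AE_space)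
    ultimately show ?thesis
    proof eventually_elim
      case (elim \<omega>)
      define x where "x = X n \<omega>"
      have xD: "x \<in> D" unfolding x_def X_def MM.state_def by (rule MM.clip_in)
      have x: "Xat (hit_times D (n + 2)) \<omega> = x" using elim(2) by (simp only: x_def X_def add_2_eq_Suc')
      \<comment> \<open>The index is at least 3, so the shifted branch of \<open>Yseq\<close>
        applies.\<close>
      have y: "Yseq D Y (n + 2 + 1) \<omega> = Y (V n \<omega>)" by (simp add: Yseq_def V_def del: hit_times.simps)
      have m: "real (n + 2) \<noteq> 0" by simp
      have r: "U (Suc n) \<omega> = U n \<omega> - (1 / real (n + 2)) * ((Y (V n \<omega>) - \<eta> (\<Theta> (n + 2) \<omega>) x) / \<alpha> x)"
        using elim(1) unfolding x y by (simp add: U_def)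
      have "Z n \<omega> = (Y (V n \<omega>) - \<eta> (\<Theta> (n + 2) \<omega>) x) / \<alpha> x - h x (U n \<omega>)"
      proof -
        have "(real n + 2) * (U n \<omega> - U (Suc n) \<omega>) = (Y (V n \<omega>) - \<eta> (\<Theta> (n + 2) \<omega>) x) / \<alpha> x"
        proof -
          have gen: "b * (a - (a - (1 / b) * q)) = q" if "b \<noteq> 0" for a b q :: real using that by simp
          have rn: "real n + 2 = real (n + 2)" by simp
          show ?thesis unfolding r rn by (rule gen[OF m])
        qed
        then show ?thesis by (simp add: Z_def x_def)
      qed
      also have "h x (U n \<omega>) = - ((\<eta> (\<Theta> (n + 2) \<omega>) x - \<eta> \<theta>s x) / \<alpha> x)"
        by (simp add: h_def U_def \<alpha>_def)
      finally show ?case unfolding \<zeta>_def x_def[symmetric] by (simp add: diff_divide_distrib)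
    qed
  qed
  \<comment> \<open>The last argument is the radius of linearisation: it is 1, as in
    \<open>drift_linearization\<close>.\<close>
  interpret RM: robbins_monro PP F D X "path_space S" V "P \<theta>s" "MM.state (Suc 0)" "trans_mat D (P \<theta>s)" Z \<zeta> p U h K C 1
  proof (rule robbins_monro.intro[OF modulated_noise.intro[OF MM.PP_prob[folded PP_eq] modulated_noise_axioms.intro] robbins_monro_axioms.intro])
    show "conditional_law PP (F n) D (X n) (path_space S) (V n) (P \<theta>s)" for n
      unfolding F_def X_def V_def PP_eq by (rule MM.conditional_law_shift)
    show "sets (F n) \<subseteq> sets (F (Suc n))" for n by (rule F_sub)
    show "MM.state (Suc 0) \<in> measurable (path_space S) (count_space D)" by (rule MM.state_1_measurable)
    show "AE \<omega> in PP. X (Suc n) \<omega> = MM.state (Suc 0) (V n \<omega>)" for n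
      unfolding X_def V_def PP_eq by (rule MM.state_Suc)
    show "trans_mat D (P \<theta>s) d e = measure (P \<theta>s d) {x \<in> space (path_space S). MM.state (Suc 0) x = e}" if "d \<in> D" "e \<in> D" for d e
      using that by (rule MM.trans_mat_state)
    show "irreducible_on D (trans_mat D (P \<theta>s))" by (rule irred)
    show "invariant_prob D (trans_mat D (P \<theta>s)) p" by (rule p)
    show "Z n \<in> borel_measurable (F (Suc n))" for n by (rule Z_F)
    show "AE \<omega> in PP. Z n \<omega> = \<zeta> (X n \<omega>) (V n \<omega>)" for n by (rule Z_eq)
    show "integrable (P \<theta>s d) (\<zeta> d)" "integrable (P \<theta>s d) (\<lambda>x. (\<zeta> d x)\<^sup>2)" "(\<integral>x. \<zeta> d x \<partial>P \<theta>s d) = 0" if "d \<in> D" for d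
      using that by (rule \<zeta>_int \<zeta>_sq \<zeta>_mean)+
    show "U n \<in> borel_measurable (F n)" for n by (rule U_F)
    show "h d \<in> borel_measurable borel" "mono (h d)" if "d \<in> D" for d using drift[OF that] by auto
    show "U (Suc n) \<omega> = U n \<omega> - (h (X n \<omega>) (U n \<omega>) + Z n \<omega>) / (real n + 2)" for n \<omega>
    proof -
      have "h (X n \<omega>) (U n \<omega>) + Z n \<omega> = (real n + 2) * (U n \<omega> - U (Suc n) \<omega>)" by (simp add: Z_def)
      then show ?thesis by (simp add: add_nonneg_pos)
    qed
    show "\<bar>h d u\<bar> \<le> K * (1 + \<bar>u\<bar>)" if "d \<in> D" for d u using that by (rule h_growth)
    show "0 < u * h d u" if "d \<in> D" "u \<noteq> 0" for d u using drift(4)[OF that] .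
    show "\<bar>h d u - u\<bar> \<le> C * u\<^sup>2" if "d \<in> D" "\<bar>u\<bar> \<le> 1" for d u
      using Cd(2)[OF that] mult_right_mono[OF CdC[OF that(1)], of "u\<^sup>2"] by simp
  qed (simp_all add: C_pos)
  have "(\<Sum>d\<in>D. p d * RM.v d) = (\<Sum>d\<in>D. p d * (\<integral>\<omega>. (Y \<omega> - \<eta> \<theta>s d)\<^sup>2 \<partial>P \<theta>s d) / (\<alpha> d)\<^sup>2)"
    by (rule sum.cong[OF refl]) (simp add: RM.v_def \<zeta>_def power_divide)
  then have "weak_conv_m (\<lambda>n. distr PP borel (\<lambda>\<omega>. sqrt (real n + 2) * U n \<omega>))
     (normal_law 0 (\<Sum>d\<in>D. p d * (\<integral>\<omega>. (Y \<omega> - \<eta> \<theta>s d)\<^sup>2 \<partial>P \<theta>s d) / (\<alpha> d)\<^sup>2))"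
    using RM.asymptotic_normality by simp
  then have "weak_conv_m (\<lambda>n. distr PP borel (\<lambda>\<omega>. sqrt (real (n + 2)) * (\<Theta> (n + 2) \<omega> - \<theta>s)))
     (normal_law 0 (\<Sum>d\<in>D. p d * (\<integral>\<omega>. (Y \<omega> - \<eta> \<theta>s d)\<^sup>2 \<partial>P \<theta>s d) / (\<alpha> d)\<^sup>2))"
    by (simp only: U_def of_nat_add of_nat_numeral)
  \<comment> \<open>The first two terms of the sequence, missing because of the shift of the index,
    do not affect the limit.\<close>
  then show ?thesis
    unfolding weak_conv_m_def weak_conv_def by (blast intro: LIMSEQ_offset[where k=2])
qed

end
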